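(* Let $k$ be a field of characteristic $2$ and let $V_4$ be the Klein four group. Let $M$ be a non-trivial finite-dimensional indecomposable representation of $V_4$ over $k$. Then $M$ is even dimensional if and only if $M$ is self-dual, i.e. $M \cong M^*$ as $kV_4$-modules.
   Context: A representation of $V_4$ over $k$ is a finite-dimensional $kV_4$-module. "Non-trivial" means not isomorphic to the trivial one-dimensional module $k$. The dual representation is $M^* = \mathrm{Hom}_k(M,k)$, with a group element $g$ acting on a linear functional $\phi$ by $(g\cdot\phi)(x) = \phi(g^{-1}x)$. A representation is self-dual if it is isomorphic to its dual. *)

theory Defs
  imports
    "HOL-Algebra.Group_Action"
    "HOL-Algebra.Elementary_Groups"
    "HOL-Library.Function_Algebras"
    "HOL-Computational_Algebra.Computational_Algebra"
begin

definition klein_four :: "(int \<times> int) monoid" where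
  "klein_four = integer_mod_group 2 \<times>\<times> integer_mod_group 2"

definition linear_on ::
  "('k \<Rightarrow> 'v \<Rightarrow> 'v) \<Rightarrow> ('k \<Rightarrow> 'w \<Rightarrow> 'w) \<Rightarrow> 'v set \<Rightarrow> ('v::plus \<Rightarrow> 'w::plus) \<Rightarrow> bool" where
  "linear_on s t V f \<longleftrightarrow>
    (\<forall>x\<in>V. \<forall>y\<in>V. f (x + y) = f x + f y) \<and> (\<forall>c. \<forall>x\<in>V. f (s c x) = t c (f x))"

text \<open>
  A finite-dimensional representation lives on a linear subspace \<open>V\<close> of an ambient vector space
  (possibly all of it). As \<open>act\<close> is a homomorphism into \<open>BijGroup V\<close>, the maps \<open>act g\<close>
  are extensional, i.e. \<open>undefined\<close> outside \<open>V\<close>.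
\<close>

locale group_rep = group_action G V act + vector_space scale
  for G (structure)
    and scale :: "'k::field \<Rightarrow> 'v::ab_group_add \<Rightarrow> 'v" (infixr \<open>*s\<close> 75)
    and V :: "'v set"
    and act :: "'g \<Rightarrow> 'v \<Rightarrow> 'v" +
  assumes subspace_carrier: "subspace V"
    and finite_dim: "\<exists>B. finite B \<and> span B = V"
    and act_linear: "g \<in> carrier G \<Longrightarrow> linear_on scale scale V (act g)"

definition rep_iso ::
  "('g, 'm) monoid_scheme \<Rightarrow>
    ('k::field \<Rightarrow> 'v::ab_group_add \<Rightarrow> 'v) \<Rightarrow> 'v set \<Rightarrow> ('g \<Rightarrow> 'v \<Rightarrow> 'v) \<Rightarrow>
    ('k \<Rightarrow> 'w::ab_group_add \<Rightarrow> 'w) \<Rightarrow> 'w set \<Rightarrow> ('g \<Rightarrow> 'w \<Rightarrow> 'w) \<Rightarrow> bool" where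
  "rep_iso G s V a t W b \<longleftrightarrow>
    (\<exists>f. bij_betw f V W \<and> linear_on s t V f \<and>
      (\<forall>g\<in>carrier G. \<forall>x\<in>V. f (a g x) = b g (f x)))"

definition subrep ::
  "('g, 'm) monoid_scheme \<Rightarrow> ('k::field \<Rightarrow> 'v::ab_group_add \<Rightarrow> 'v) \<Rightarrow> 'v set \<Rightarrow>
    ('g \<Rightarrow> 'v \<Rightarrow> 'v) \<Rightarrow> 'v set \<Rightarrow> bool" where
  "subrep G s V a U \<longleftrightarrow>
    U \<subseteq> V \<and> module.subspace s U \<and> (\<forall>g\<in>carrier G. \<forall>x\<in>U. a g x \<in> U)"

definition indecomposable_rep ::
  "('g, 'm) monoid_scheme \<Rightarrow> ('k::field \<Rightarrow> 'v::ab_group_add \<Rightarrow> 'v) \<Rightarrow> 'v set \<Rightarrow>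
    ('g \<Rightarrow> 'v \<Rightarrow> 'v) \<Rightarrow> bool" where
  "indecomposable_rep G s V a \<longleftrightarrow>
    V \<noteq> {0} \<and>
    (\<forall>U W. subrep G s V a U \<and> subrep G s V a W \<and>
        U \<inter> W = {0} \<and> {u + w |u w. u \<in> U \<and> w \<in> W} = V \<longrightarrow>
      U = {0} \<or> W = {0})"

text \<open>The trivial representation has carrier \<open>UNIV :: 'k set\<close> and scaling \<open>(*)\<close>.\<close>

definition trivial_act :: "'g \<Rightarrow> 'k \<Rightarrow> 'k" where
  "trivial_act g = (\<lambda>x. x)"

text \<open>
  Functionals on \<open>V\<close> are represented by functions on the ambient type that vanish outside \<open>V\<close>;
  addition of functionals is the pointwise one.
\<close>

definition dual_carrier ::
  "('k::field \<Rightarrow> 'v::ab_group_add \<Rightarrow> 'v) \<Rightarrow> 'v set \<Rightarrow> ('v \<Rightarrow> 'k) set" where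
  "dual_carrier s V = {\<phi>. linear_on s (*) V \<phi> \<and> (\<forall>x. x \<notin> V \<longrightarrow> \<phi> x = 0)}"

definition dual_scale :: "'k::field \<Rightarrow> ('v \<Rightarrow> 'k) \<Rightarrow> 'v \<Rightarrow> 'k" where
  "dual_scale c \<phi> = (\<lambda>x. c * \<phi> x)"

definition dual_act ::
  "('g, 'm) monoid_scheme \<Rightarrow> ('k::field \<Rightarrow> 'v::ab_group_add \<Rightarrow> 'v) \<Rightarrow> 'v set \<Rightarrow>
    ('g \<Rightarrow> 'v \<Rightarrow> 'v) \<Rightarrow> 'g \<Rightarrow> ('v \<Rightarrow> 'k) \<Rightarrow> 'v \<Rightarrow> 'k" where
  "dual_act G s V a g =
    (\<lambda>\<phi>\<in>dual_carrier s V. \<lambda>x. if x \<in> V then \<phi> (a (inv\<^bsub>G\<^esub> g) x) else 0)"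

definition self_dual_rep ::
  "('g, 'm) monoid_scheme \<Rightarrow> ('k::field \<Rightarrow> 'v::ab_group_add \<Rightarrow> 'v) \<Rightarrow> 'v set \<Rightarrow>
    ('g \<Rightarrow> 'v \<Rightarrow> 'v) \<Rightarrow> bool" where
  "self_dual_rep G s V a \<longleftrightarrow>
    rep_iso G s V a dual_scale (dual_carrier s V) (dual_act G s V a)"

lemma vector_space_dual_scale:
  "vector_space (dual_scale :: 'k::field \<Rightarrow> ('v \<Rightarrow> 'k) \<Rightarrow> 'v \<Rightarrow> 'k)"
  by unfold_locales (auto simp: dual_scale_def fun_eq_iff algebra_simps)

lemma group_klein_four: "group klein_four"
  by (simp add: klein_four_def DirProd_group)

lemma group_rep_trivial:
  assumes "group G"
  shows "group_rep G ((*) :: 'k::field \<Rightarrow> 'k \<Rightarrow> 'k) UNIV trivial_act"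
proof -
  interpret V: vector_space "(*) :: 'k \<Rightarrow> 'k \<Rightarrow> 'k"
    by unfold_locales (auto simp: algebra_simps)
  have id: "(\<lambda>x. x) \<in> Bij (UNIV :: 'k set)"
    using bij_id by (simp add: Bij_def id_def)
  have act: "group_action G (UNIV :: 'k set) trivial_act"
    using assms id
    by (auto simp: group_action_def group_hom_def group_hom_axioms_def hom_def
        group_BijGroup[unfolded BijGroup_def compose_def] trivial_act_def BijGroup_def compose_def)
  have "x \<in> V.span {1}" for x :: 'k
    using V.span_scale[OF V.span_base, of 1 "{1}" x] by simp
  then have "\<exists>B. finite B \<and> V.span B = UNIV"
    by (intro exI[of _ "{1}"]) auto
  with act show ?thesis
    by (auto simp: group_rep_def group_rep_axioms_def V.vector_space_axioms linear_on_def
        trivial_act_def)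
qed

context group_rep
begin

lemma act_one: "x \<in> V \<Longrightarrow> act \<one> x = x"
  by (metis id_eq_one restrict_apply')

lemma act_closed: "g \<in> carrier G \<Longrightarrow> x \<in> V \<Longrightarrow> act g x \<in> V"
  using element_image by blast

lemma dual_act_closed:
  assumes "g \<in> carrier G" "\<phi> \<in> dual_carrier scale V"
  shows "dual_act G scale V act g \<phi> \<in> dual_carrier scale V"
proof -
  interpret group G
    using group_hom by (simp add: group_hom_def)
  have "linear_on scale scale V (act (inv g))"
    using act_linear assms by simp
  with assms show ?thesis
    using act_closed[of "inv g"]
    by (auto simp: dual_act_def dual_carrier_def linear_on_def subspace_add[OF subspace_carrier]
        subspace_scale[OF subspace_carrier])
qed

lemma dual_act_mult:
  assumes g: "g \<in> carrier G" and h: "h \<in> carrier G" and \<phi>: "\<phi> \<in> dual_carrier scale V"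
  shows "dual_act G scale V act (g \<otimes> h) \<phi> =
    dual_act G scale V act g (dual_act G scale V act h \<phi>)"
proof -
  interpret group G
    using group_hom by (simp add: group_hom_def)
  show ?thesis
    using assms dual_act_closed[OF h \<phi>] act_closed[of "inv g"]
    by (auto simp: dual_act_def fun_eq_iff inv_mult_group composition_rule)
qed

lemma dual_act_one:
  assumes "\<phi> \<in> dual_carrier scale V"
  shows "dual_act G scale V act \<one> \<phi> = \<phi>"
proof -
  interpret group G
    using group_hom by (simp add: group_hom_def)
  show ?thesis
    using assms by (auto simp: dual_act_def dual_carrier_def fun_eq_iff act_one)
qed

lemma dual_finite_dim:
  "\<exists>B. finite B \<and> module.span dual_scale B = dual_carrier scale V"
proof -
  interpret D: vector_space "dual_scale :: 'k \<Rightarrow> ('v \<Rightarrow> 'k) \<Rightarrow> 'v \<Rightarrow> 'k"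
    by (rule vector_space_dual_scale)
  obtain A where A: "finite A" "span A = V"
    using finite_dim by blast
  obtain B where B: "B \<subseteq> V" "independent B" "span B = V"
    using maximal_independent_subset[of V] span_mono[of _ V] subspace_carrier
    by (metis span_eq_iff subset_antisym)
  have fin: "finite B"
    using A B independent_span_bound by blast
  define e where "e b x = (if x \<in> V then representation B x b else 0)" for b x
  have e: "e b \<in> dual_carrier scale V" for b
    using B
    by (auto simp: e_def dual_carrier_def linear_on_def representation_add representation_scale
        subspace_add[OF subspace_carrier] subspace_scale[OF subspace_carrier])
  have sub: "D.subspace (dual_carrier scale V)"
    by (auto simp: D.subspace_def dual_carrier_def linear_on_def dual_scale_def algebra_simps)
  have "\<phi> \<in> D.span (e ` B)" if \<phi>: "\<phi> \<in> dual_carrier scale V" for \<phi>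
  proof -
    have z: "\<phi> 0 = 0"
    proof -
      have "\<phi> (0 *s 0) = 0 * \<phi> 0"
        using \<phi> subspace_0[OF subspace_carrier] unfolding dual_carrier_def linear_on_def by blast
      then show ?thesis by simp
    qed
    have sum: "\<phi> (\<Sum>b\<in>F. c b *s b) = (\<Sum>b\<in>F. c b * \<phi> b)" if "F \<subseteq> V" "finite F" for F c
      using that(2,1)
    proof (induction F)
      case empty
      then show ?case by (simp add: z)
    next
      case (insert b F)
      have "(\<Sum>b\<in>F. c b *s b) \<in> V" "c b *s b \<in> V" "b \<in> V"
        using insert by (auto intro!: subspace_sum subspace_scale subspace_carrier)
      with insert \<phi> show ?case
        by (simp add: dual_carrier_def linear_on_def)
    qed
    have "\<phi> = (\<Sum>b\<in>B. dual_scale (\<phi> b) (e b))"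
    proof
      fix x
      have app: "(\<Sum>b\<in>F. dual_scale (\<phi> b) (e b)) x = (\<Sum>b\<in>F. \<phi> b * e b x)" if "finite F" for F
        using that by (induction F) (auto simp: dual_scale_def)
      show "\<phi> x = (\<Sum>b\<in>B. dual_scale (\<phi> b) (e b)) x"
      proof (cases "x \<in> V")
        case True
        have "x = (\<Sum>b\<in>B. representation B x b *s b)"
          using sum_representation_eq[OF B(2) _ fin order_refl, of x] True B by simp
        then have "\<phi> x = (\<Sum>b\<in>B. representation B x b * \<phi> b)"
          using sum[OF B(1) fin, of "representation B x"] by simp
        then show ?thesis
          using True by (simp add: app[OF fin] e_def mult.commute)
      next
        case False
        then show ?thesis
          using \<phi> by (simp add: app[OF fin] e_def dual_carrier_def)
      qed
    qed
    moreover have "(\<Sum>b\<in>B. dual_scale (\<phi> b) (e b)) \<in> D.span (e ` B)"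
      by (intro D.span_sum D.span_scale D.span_base) auto
    ultimately show ?thesis by simp
  qed
  moreover have "D.span (e ` B) \<subseteq> dual_carrier scale V"
    using e by (intro D.span_minimal sub) auto
  ultimately show ?thesis
    using fin by (intro exI[of _ "e ` B"]) auto
qed

theorem group_rep_dual:
  "group_rep G dual_scale (dual_carrier scale V) (dual_act G scale V act)"
proof -
  interpret group G
    using group_hom by (simp add: group_hom_def)
  interpret D: vector_space "dual_scale :: 'k \<Rightarrow> ('v \<Rightarrow> 'k) \<Rightarrow> 'v \<Rightarrow> 'k"
    by (rule vector_space_dual_scale)
  let ?D = "dual_carrier scale V" and ?a = "dual_act G scale V act"
  have bij: "?a g \<in> Bij ?D" if g: "g \<in> carrier G" for g
  proof -
    have "?a (inv g) (?a g \<phi>) = \<phi>" "?a g (?a (inv g) \<phi>) = \<phi>" if "\<phi> \<in> ?D" for \<phi>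
      using that g dual_act_mult[of "inv g" g \<phi>] dual_act_mult[of g "inv g" \<phi>]
      by (simp_all add: dual_act_one)
    then have "bij_betw (?a g) ?D ?D"
      using g by (intro bij_betwI[where g = "?a (inv g)"]) (auto intro: dual_act_closed)
    then show ?thesis
      by (simp add: Bij_def dual_act_def)
  qed
  have "?a (g \<otimes> h) = compose ?D (?a g) (?a h)" if "g \<in> carrier G" "h \<in> carrier G" for g h
    using dual_act_mult[OF that]
    by (intro extensionalityI[of _ ?D]) (auto simp: compose_def dual_act_def)
  then have act: "group_action G ?D ?a"
    using bij
    by (auto simp: group_action_def group_hom_def group_hom_axioms_def hom_def
        group_BijGroup[unfolded BijGroup_def] BijGroup_def)
  have sub: "D.subspace ?D"
    by (auto simp: D.subspace_def dual_carrier_def linear_on_def dual_scale_def algebra_simps)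
  have "linear_on dual_scale dual_scale ?D (?a g)" if "g \<in> carrier G" for g
    using D.subspace_add[OF sub] D.subspace_scale[OF sub]
    by (auto simp: linear_on_def[of dual_scale] dual_act_def dual_scale_def fun_eq_iff)
  with act sub dual_finite_dim show ?thesis
    by (simp add: group_rep_def group_rep_axioms_def D.vector_space_axioms)
qed

end

end

theory Submission
  imports Defs "HOL-Library.Product_Plus"
begin

text \<open>
  In characteristic 2 put \<open>x = g + 1\<close> and \<open>y = h + 1\<close> for generators \<open>g, h\<close> of the Klein four
  group: a representation is a space with commuting operators \<open>x, y\<close> of square zero, and it is
  self-dual iff it carries a nondegenerate bilinear form for which \<open>x\<close> and \<open>y\<close> are self-adjoint.

  If \<open>xy \<noteq> 0\<close> the regular representation splits off, because the group algebra is a Frobenius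
  algebra; it has dimension 4 and a form. Otherwise the radical \<open>R\<close> coincides with the socle, and a
  complement \<open>T\<close> of \<open>R\<close> gives an indecomposable Kronecker module \<open>x, y : T \<rightarrow> R\<close>. A self-duality makes
  \<open>R\<close> its own orthogonal complement, so the dimension is \<open>2 dim R\<close>. Conversely, reflection functors
  reduce Kronecker modules with \<open>dim T \<noteq> dim R\<close> to simple ones, which gives
  \<open>\<bar>dim T - dim R\<bar> \<le> 1\<close>; hence even dimension forces \<open>dim T = dim R\<close>. The same reflections show that a
  square indecomposable Kronecker module is semistable, a Fitting-type decomposition then makes \<open>x\<close>
  or \<open>y\<close> bijective, and the module becomes a single indecomposable operator \<open>A\<close>. The algebra \<open>k[A]\<close>
  is again Frobenius, whence a form for which \<open>A\<close> is self-adjoint.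
\<close>

section \<open>Finite-dimensional subspaces\<close>

text \<open>The trivial module is self-dual of dimension 1, so it has to be excluded. Each group
  element is its own inverse, so an isomorphism onto the dual is a form with B(gu, v) = B(u, gv);
  this is why self-adjointness of x and y is the right condition and no signs occur. The field is
  arbitrary of characteristic 2, so eigenvalues may be missing and no list of normal forms is used.
  One functional does two jobs instead. If phi does not vanish on the simple socle of a commutative
  algebra such as kV_4 or k[A], then (a, b) -> phi(ab) is nondegenerate. This splits a cyclic
  submodule off the module, and an indecomposable module is therefore cyclic and inherits the form.
  For two maps x, y : T -> R of equal dimensions the obstacle is that, a priori, every combination
  of them could be singular, as happens when pieces with dim T > dim R and dim T < dim R are added
  up. Semistability excludes such pieces; only then does the operator A, namely the inverse of x
  followed after y, or the same with x and y exchanged, make sense.\<close>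

definition ssum :: "'v::plus set \<Rightarrow> 'v set \<Rightarrow> 'v set" where
  "ssum A B = {a + b | a b. a \<in> A \<and> b \<in> B}"

lemma ssumI: "a \<in> A \<Longrightarrow> b \<in> B \<Longrightarrow> a + b \<in> ssum A B"
  by (auto simp: ssum_def)

lemma ssumE:
  assumes "x \<in> ssum A B"
  obtains a b where "a \<in> A" "b \<in> B" "x = a + b"
  using assms by (auto simp: ssum_def)

lemma ssum_commute: "ssum A B = ssum B (A :: 'v::ab_semigroup_add set)"
  by (auto simp: ssum_def) (metis add.commute)+

locale vec_space = vector_space
begin

text \<open>The ambient space may be infinite-dimensional, and \<open>dim\<close> is 0 for a
  subspace with an infinite basis. Monotonicity of \<open>dim\<close> and every dimension count
  therefore need this predicate.\<close>

definition fin_subspace :: "'b set \<Rightarrow> bool" where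
  "fin_subspace V \<longleftrightarrow> subspace V \<and> (\<exists>B. finite B \<and> span B = V)"

lemma fin_subspace_subspace: "fin_subspace V \<Longrightarrow> subspace V"
  by (simp add: fin_subspace_def)

lemma fin_subspace_basis:
  assumes "fin_subspace V"
  obtains B where "finite B" "independent B" "span B = V" "card B = dim V" "B \<subseteq> V"
proof -
  obtain A where A: "finite A" "span A = V"
    using assms by (auto simp: fin_subspace_def)
  obtain B where B: "B \<subseteq> V" "independent B" "V \<subseteq> span B" "card B = dim V"
    by (rule basis_exists)
  have "finite B"
    using A B independent_span_bound by blast
  moreover have "span B = V"
    using B assms by (simp add: span_subspace fin_subspace_def)
  ultimately show ?thesis
    using that B by blast
qed

lemma fin_subspace_subset:
  assumes "fin_subspace V" "subspace U" "U \<subseteq> V"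
  shows "fin_subspace U"
proof -
  obtain A where A: "finite A" "span A = V"
    using assms by (auto simp: fin_subspace_def)
  obtain B where B: "B \<subseteq> U" "independent B" "U \<subseteq> span B" "card B = dim U"
    by (rule basis_exists)
  have "finite B"
    using A B assms independent_span_bound[of A B] by blast
  then show ?thesis
    using B assms(2) unfolding fin_subspace_def by (metis span_subspace)
qed

lemma dim_mono_fin_subspace:
  assumes "fin_subspace V" "U \<subseteq> V"
  shows "dim U \<le> dim V"
proof -
  obtain B where "finite B" "span B = V" "card B = dim V"
    using fin_subspace_basis[OF assms(1)] by metis
  then show ?thesis
    using dim_le_card[of U B] assms(2) by simp
qed

lemma eq_if_dim_le:
  assumes "fin_subspace V" "subspace U" "U \<subseteq> V" "dim V \<le> dim U"
  shows "U = V"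
proof -
  obtain B where B: "finite B" "independent B" "span B = U" "card B = dim U" "B \<subseteq> U"
    using fin_subspace_basis[OF fin_subspace_subset[OF assms(1-3)]] by metis
  obtain C where C: "B \<subseteq> C" "C \<subseteq> V" "independent C" "V \<subseteq> span C"
    using maximal_independent_subset_extend[of B V] B assms(3) by blast
  have "card C = dim V"
    using C basis_card_eq_dim by blast
  moreover have "finite C"
    using C independent_span_bound assms(1) unfolding fin_subspace_def by metis
  ultimately have "B = C"
    using C B assms(4) by (simp add: card_seteq)
  then show ?thesis
    using B C assms by auto
qed

lemma fin_subspace_dim_0: "fin_subspace V \<Longrightarrow> dim V = 0 \<longleftrightarrow> V = {0}"
proof
  assume V: "fin_subspace V" and "dim V = 0"
  then show "V = {0}"
    using fin_subspace_basis[OF V] by (metis card_0_eq span_empty)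
next
  assume "V = {0}"
  then show "dim V = 0"
    using dim_le_card[of "{0}" "{}"] by simp
qed

lemma fin_subspace_zero [simp]: "fin_subspace {0}"
  unfolding fin_subspace_def using subspace_single_0 span_empty by blast

lemma dim_zero [simp]: "dim {0} = 0"
  using fin_subspace_dim_0 fin_subspace_zero by blast

lemma subspace_ssum: "subspace A \<Longrightarrow> subspace B \<Longrightarrow> subspace (ssum A B)"
  unfolding ssum_def by (rule subspace_sums)

lemma ssum_span: "ssum (span A) (span B) = span (A \<union> B)"
  by (auto simp: ssum_def span_Un)

lemma ssum_zero [simp]: "ssum A {0 :: 'b} = A" "ssum {0 :: 'b} A = A"
  by (auto simp: ssum_def)

lemma ssum_left: "subspace B \<Longrightarrow> A \<subseteq> ssum A B"
  using subspace_0 ssumI[of _ A 0 B] by auto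

lemma ssum_right: "subspace A \<Longrightarrow> B \<subseteq> ssum A B"
  using subspace_0 ssumI[of 0 A _ B] by auto

lemma ssum_minimal: "subspace C \<Longrightarrow> A \<subseteq> C \<Longrightarrow> B \<subseteq> C \<Longrightarrow> ssum A B \<subseteq> C"
  by (auto simp: ssum_def intro: subspace_add)

lemma ssum_mono: "A \<subseteq> A' \<Longrightarrow> B \<subseteq> B' \<Longrightarrow> ssum A B \<subseteq> ssum A' B'"
  by (auto simp: ssum_def)

lemma fin_subspace_ssum:
  assumes "fin_subspace A" "fin_subspace B"
  shows "fin_subspace (ssum A B)"
proof -
  obtain C D where "finite C" "span C = A" "finite D" "span D = B"
    using assms by (auto simp: fin_subspace_def)
  then have "finite (C \<union> D)" "span (C \<union> D) = ssum A B"
    using ssum_span[of C D] by auto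
  then show ?thesis
    using assms subspace_ssum unfolding fin_subspace_def by metis
qed

lemma complement_exists:
  assumes "subspace V" "subspace U" "U \<subseteq> V"
  obtains C where "subspace C" "C \<subseteq> V" "U \<inter> C = {0}" "ssum U C = V"
proof -
  obtain B where B: "B \<subseteq> U" "independent B" "U \<subseteq> span B"
    using maximal_independent_subset .
  then have sB: "span B = U"
    using assms span_subspace by blast
  obtain E where E: "B \<subseteq> E" "E \<subseteq> V" "independent E" "V \<subseteq> span E"
    using maximal_independent_subset_extend[of B V] B assms(3) by blast
  then have sE: "span E = V"
    using assms span_subspace by blast
  have "ssum U (span (E - B)) = V"
    using ssum_span[of B "E - B"] sB sE E(1) by (simp add: Un_absorb1)
  moreover have "U \<inter> span (E - B) = {0}"
  proof -
    have "x = 0" if x: "x \<in> U" "x \<in> span (E - B)" for x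
    proof -
      \<comment> \<open>The coordinates of x in the basis E are supported in B and also in
        \<open>E - B\<close>, so all of them vanish.\<close>
      have "representation E x = representation B x"
        using E x B sB representation_extend by blast
      moreover have "representation E x = representation (E - B) x"
        using E x representation_extend by blast
      ultimately have "representation E x b = 0" for b
        using representation_ne_zero by (metis DiffE)
      then have "(\<Sum>b | representation E x b \<noteq> 0. representation E x b *s b) = 0"
        by simp
      then show ?thesis
        using sum_nonzero_representation_eq[OF E(3)] x sE assms by auto
    qed
    then show ?thesis
      using assms(2) subspace_0 span_zero by auto
  qed
  moreover have "span (E - B) \<subseteq> V"
    using sE span_mono[of "E - B" E] by auto
  ultimately show ?thesis
    using that subspace_span by blast
qed

lemma dim_ssum_direct:
  assumes "fin_subspace A" "fin_subspace B" "A \<inter> B \<subseteq> {0}"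
  shows "dim (ssum A B) = dim A + dim B"
proof -
  obtain C where C: "finite C" "independent C" "span C = A" "card C = dim A" "C \<subseteq> A"
    using fin_subspace_basis[OF assms(1)] by metis
  obtain D where D: "finite D" "independent D" "span D = B" "card D = dim B" "D \<subseteq> B"
    using fin_subspace_basis[OF assms(2)] by metis
  have "C \<inter> D = {}"
    using C D assms(3) dependent_zero by blast
  moreover have "independent (C \<union> D)"
  proof (rule independent_if_scalars_zero)
    show "finite (C \<union> D)" using C D by simp
    fix f x
    assume 0: "(\<Sum>x\<in>C \<union> D. f x *s x) = 0" and x: "x \<in> C \<union> D"
    have "(\<Sum>x\<in>C. f x *s x) + (\<Sum>x\<in>D. f x *s x) = 0"
      using 0 C D \<open>C \<inter> D = {}\<close> by (simp add: sum.union_disjoint)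
    then have e: "(\<Sum>x\<in>C. f x *s x) = - (\<Sum>x\<in>D. f x *s x)"
      by (simp add: eq_neg_iff_add_eq_0)
    have c: "(\<Sum>x\<in>C. f x *s x) \<in> A" "(\<Sum>x\<in>D. f x *s x) \<in> B"
      unfolding C(3)[symmetric] D(3)[symmetric] by (intro span_sum span_scale span_base; assumption)+
    then have "(\<Sum>x\<in>C. f x *s x) \<in> B"
      using e assms(2) subspace_neg by (simp add: fin_subspace_def)
    with c assms(3) have 1: "(\<Sum>x\<in>C. f x *s x) = 0"
      by auto
    then have 2: "(\<Sum>x\<in>D. f x *s x) = 0"
      using e by simp
    show "f x = 0"
      using x independentD[OF C(2) C(1) order_refl 1] independentD[OF D(2) D(1) order_refl 2] by auto
  qed
  moreover have "span (C \<union> D) = ssum A B"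
    using C D ssum_span by metis
  ultimately show ?thesis
    using C D by (metis card_Un_disjoint dim_span_eq_card_independent)
qed

lemma dim_ssum_Int:
  assumes "fin_subspace A" "fin_subspace B"
  shows "dim (ssum A B) + dim (A \<inter> B) = dim A + dim B"
proof -
  have s: "subspace A" "subspace B" "subspace (A \<inter> B)"
    using assms subspace_inter by (auto simp: fin_subspace_def)
  obtain C where C: "subspace C" "C \<subseteq> B" "(A \<inter> B) \<inter> C = {0}" "ssum (A \<inter> B) C = B"
    using complement_exists[OF s(2,3)] by auto
  have f: "fin_subspace C" "fin_subspace (A \<inter> B)"
    using assms C s fin_subspace_subset by blast+
  have "ssum A B = ssum A C"
  proof
    show "ssum A C \<subseteq> ssum A B"
      using C ssum_mono by blast
    show "ssum A B \<subseteq> ssum A C"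
    proof (rule ssum_minimal[OF subspace_ssum[OF s(1) C(1)]])
      show "A \<subseteq> ssum A C"
        by (rule ssum_left[OF C(1)])
      have "ssum (A \<inter> B) C \<subseteq> ssum A C"
        by (rule ssum_mono) auto
      then show "B \<subseteq> ssum A C"
        using C(4) by simp
    qed
  qed
  moreover have "dim (ssum A C) = dim A + dim C"
    by (rule dim_ssum_direct[OF assms(1) f(1)]) (use C in auto)
  moreover have "dim B = dim (A \<inter> B) + dim C"
    using dim_ssum_direct[OF f(2,1)] C by simp
  ultimately show ?thesis by simp
qed

lemma dim_direct_sum:
  assumes "fin_subspace V" "subspace A" "subspace B" "A \<inter> B = {0}" "ssum A B = V"
  shows "dim V = dim A + dim B"
proof -
  have "A \<subseteq> V" "B \<subseteq> V"
    unfolding assms(5)[symmetric] using ssum_left[OF assms(3)] ssum_right[OF assms(2)] by blast+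
  then have "fin_subspace A" "fin_subspace B"
    using fin_subspace_subset[OF assms(1)] assms(2,3) by blast+
  then show ?thesis
    using dim_ssum_direct[of A B] assms(4,5) by simp
qed

lemma direct_sum_if_dim:
  assumes "fin_subspace V" "subspace A" "subspace B" "A \<subseteq> V" "B \<subseteq> V" "A \<inter> B \<subseteq> {0}" "dim V \<le> dim A + dim B"
  shows "ssum A B = V"
proof (rule eq_if_dim_le[OF assms(1)])
  have "fin_subspace A" "fin_subspace B"
    using assms fin_subspace_subset by auto
  then show "dim V \<le> dim (ssum A B)"
    using assms dim_ssum_direct by simp
qed (use assms subspace_ssum ssum_minimal[of V A B] in \<open>auto simp: fin_subspace_def\<close>)

lemma dim_line: "x \<noteq> 0 \<Longrightarrow> dim (span {x}) = 1"
  using dim_span_eq_card_independent[of "{x}"] by simp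

lemma fin_subspace_span: "finite B \<Longrightarrow> fin_subspace (span B)"
  unfolding fin_subspace_def by blast

text \<open>A basis of W stays independent when v is added, so values can be prescribed on both.
  This supplies the functional of each Frobenius form and the hyperplane in
  \<open>socle_in_radical\<close>.\<close>

lemma separating_functional:
  assumes "subspace W" "v \<notin> W"
  obtains \<phi> where "Vector_Spaces.linear scale (*) \<phi>" "\<phi> v = 1" "\<And>w. w \<in> W \<Longrightarrow> \<phi> w = 0"
proof -
  interpret k: vector_space "(*) :: 'a \<Rightarrow> 'a \<Rightarrow> 'a"
    by unfold_locales (auto simp: algebra_simps)
  interpret p: vector_space_pair scale "(*) :: 'a \<Rightarrow> 'a \<Rightarrow> 'a" ..
  obtain B where B: "B \<subseteq> W" "independent B" "W \<subseteq> span B"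
    using maximal_independent_subset .
  have sB: "span B = W"
    using B assms span_subspace by blast
  then have "independent (insert v B)"
    using B assms independent_insertI by metis
  then obtain \<phi> where \<phi>: "Vector_Spaces.linear scale (*) \<phi>" "\<forall>x\<in>insert v B. \<phi> x = (if x = v then 1 else 0)"
    using p.linear_independent_extend[of "insert v B" "\<lambda>x. if x = v then 1 else 0"] by blast
  have "\<phi> w = 0" if "w \<in> W" for w
  proof (rule p.linear_eq_0_on_span[OF \<phi>(1)])
    show "w \<in> span B" using that sB by simp
    show "\<phi> x = 0" if "x \<in> B" for x
      using that \<phi>(2) B assms(2) by auto
  qed
  then show ?thesis
    using that \<phi> by auto
qed

lemma dim_kernel_functional:
  assumes "fin_subspace V" "Vector_Spaces.linear scale (*) \<psi>"
  shows "dim V \<le> dim {v\<in>V. \<psi> v = 0} + 1"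
proof -
  interpret k: vector_space "(*) :: 'a \<Rightarrow> 'a \<Rightarrow> 'a"
    by unfold_locales (auto simp: algebra_simps)
  interpret \<psi>: Vector_Spaces.linear scale "(*)" \<psi> by fact
  let ?K = "{v\<in>V. \<psi> v = 0}"
  have "?K = V \<inter> {v. \<psi> v = 0}" by auto
  then have s: "subspace ?K"
    using assms(1) subspace_inter \<psi>.subspace_kernel by (simp add: fin_subspace_def)
  have fK: "fin_subspace ?K"
    using assms(1) s fin_subspace_subset by auto
  show ?thesis
  proof (cases "?K = V")
    case False
    then obtain u where u: "u \<in> V" "\<psi> u \<noteq> 0" by auto
    have "V \<subseteq> ssum ?K (span {u})"
    proof
      fix v assume v: "v \<in> V"
      let ?c = "\<psi> v / \<psi> u"
      have "v - ?c *s u \<in> ?K"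
        using u v assms(1) by (auto simp: fin_subspace_def \<psi>.diff \<psi>.scale intro: subspace_diff subspace_scale)
      then have "(v - ?c *s u) + ?c *s u \<in> ssum ?K (span {u})"
        by (intro ssumI) (auto intro: span_scale span_base)
      then show "v \<in> ssum ?K (span {u})" by simp
    qed
    then have "dim V \<le> dim (ssum ?K (span {u}))"
      using dim_mono_fin_subspace fin_subspace_ssum[OF fK] fin_subspace_span[of "{u}"] by auto
    also have "\<dots> \<le> dim ?K + dim (span {u})"
      using dim_ssum_Int[OF fK fin_subspace_span[of "{u}"]] by simp
    also have "\<dots> = dim ?K + 1"
      using u \<psi>.zero by (subst dim_line) auto
    finally show ?thesis .
  qed simp
qed

lemma subspace_kernel_functionals:
  assumes "subspace V" "\<And>i. i < d \<Longrightarrow> Vector_Spaces.linear scale (*) (\<psi> i)"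
  shows "subspace {v\<in>V. \<forall>i<(d::nat). \<psi> i v = 0}"
proof -
  have "\<psi> i 0 = 0 \<and> \<psi> i (x + y) = \<psi> i x + \<psi> i y \<and> \<psi> i (c *s x) = c * \<psi> i x" if "i < d" for i x y c
  proof -
    interpret \<psi>: Vector_Spaces.linear scale "(*)" "\<psi> i" by (rule assms(2)[OF that])
    show ?thesis by (simp add: \<psi>.add \<psi>.scale)
  qed
  then show ?thesis
    using assms(1) by (auto simp: subspace_def)
qed

lemma dim_kernel_functionals:
  assumes "fin_subspace V" "\<And>i. i < d \<Longrightarrow> Vector_Spaces.linear scale (*) (\<psi> i)"
  shows "dim V \<le> dim {v\<in>V. \<forall>i<(d::nat). \<psi> i v = 0} + d"
  using assms(2)
proof (induction d)
  case 0
  then show ?case by simp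
next
  case (Suc d)
  let ?K = "{v\<in>V. \<forall>i<d. \<psi> i v = 0}"
  have "subspace ?K"
    using Suc.prems assms(1) by (intro subspace_kernel_functionals) (auto simp: fin_subspace_def)
  then have "fin_subspace ?K"
    using assms(1) fin_subspace_subset by auto
  from dim_kernel_functional[OF this Suc.prems[of d]]
  have "dim ?K \<le> dim {v \<in> ?K. \<psi> d v = 0} + 1" by simp
  moreover have "{v \<in> ?K. \<psi> d v = 0} = {v\<in>V. \<forall>i<Suc d. \<psi> i v = 0}"
    by (auto simp: less_Suc_eq)
  ultimately show ?case
    using Suc by force
qed

lemma card_le_dim_if_independent_family:
  fixes u :: "nat \<Rightarrow> 'b"
  assumes "fin_subspace U" "\<And>i. i < d \<Longrightarrow> u i \<in> U"
    and ind: "\<And>c i. (\<Sum>i<d. c i *s u i) = 0 \<Longrightarrow> i < d \<Longrightarrow> c i = 0"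
  shows "d \<le> dim U"
proof -
  have inj: "inj_on u {..<d}"
  proof
    fix i j assume ij: "i \<in> {..<d}" "j \<in> {..<d}" and e: "u i = u j"
    \<comment> \<open>The coefficients of the relation \<open>u i - u j = 0\<close>; for distinct i
      and j the one at i would be 1.\<close>
    let ?c = "\<lambda>l. (if l = i then 1 :: 'a else 0) - (if l = j then 1 else 0)"
    have "?c l *s u l = (if l = i then u l else 0) - (if l = j then u l else 0)" for l
      by (simp add: scale_left_diff_distrib)
    then have "(\<Sum>l<d. ?c l *s u l) =
      (\<Sum>l<d. if l = i then u l else 0) - (\<Sum>l<d. if l = j then u l else 0)"
      by (simp only: sum_subtractf)
    also have "\<dots> = 0"
      using ij e by simp
    finally have "?c i = 0"
      by (rule ind[of ?c]) (use ij in simp)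
    then show "i = j" by (cases "i = j") auto
  qed
  have "independent (u ` {..<d})"
  proof (rule independent_if_scalars_zero)
    fix f x assume 0: "(\<Sum>x\<in>u ` {..<d}. f x *s x) = 0" and x: "x \<in> u ` {..<d}"
    then have "(\<Sum>i<d. f (u i) *s u i) = 0"
      using inj by (simp add: sum.reindex)
    with x ind[of "\<lambda>i. f (u i)"] show "f x = 0" by auto
  qed simp
  then have "dim (span (u ` {..<d})) = card (u ` {..<d})"
    by (rule dim_span_eq_card_independent)
  moreover have "span (u ` {..<d}) \<subseteq> U"
    using assms by (intro span_minimal) (auto simp: fin_subspace_def)
  ultimately show ?thesis
    using inj dim_mono_fin_subspace[OF assms(1)] by (metis card_image card_lessThan)
qed

end

section \<open>Linear maps between two spaces\<close>

locale vec_space_pair = vs1: vec_space s1 + vs2: vec_space s2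
  for s1 :: "'a::field \<Rightarrow> 'b::ab_group_add \<Rightarrow> 'b"
    and s2 :: "'a::field \<Rightarrow> 'c::ab_group_add \<Rightarrow> 'c"
begin

sublocale vector_space_pair s1 s2 ..

lemma fin_subspace_image:
  assumes "Vector_Spaces.linear s1 s2 f" "vs1.fin_subspace U"
  shows "vs2.fin_subspace (f ` U)"
proof -
  obtain B where "finite B" "vs1.span B = U"
    using assms by (auto simp: vs1.fin_subspace_def)
  then have "finite (f ` B)" "vs2.span (f ` B) = f ` U"
    using linear_span_image[OF assms(1)] by auto
  then show ?thesis
    by (metis vs2.fin_subspace_span)
qed

lemma dim_image_inj:
  assumes "Vector_Spaces.linear s1 s2 f" "vs1.fin_subspace U" "inj_on f U"
  shows "vs2.dim (f ` U) = vs1.dim U"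
proof -
  obtain B where B: "finite B" "vs1.independent B" "vs1.span B = U" "card B = vs1.dim U" "B \<subseteq> U"
    using vs1.fin_subspace_basis[OF assms(2)] by metis
  have "vs2.independent (f ` B)"
    using linear_independent_injective_image[OF assms(1) B(2)] B(3) assms(3) by simp
  moreover have "vs2.span (f ` B) = f ` U"
    using linear_span_image[OF assms(1)] B by auto
  moreover have "card (f ` B) = card B"
    using B assms(3) inj_on_subset card_image by blast
  ultimately show ?thesis
    using B vs2.dim_span_eq_card_independent by metis
qed

lemma subspace_kernel_on:
  assumes "Vector_Spaces.linear s1 s2 f" "vs1.subspace U"
  shows "vs1.subspace {u\<in>U. f u = 0}"
proof -
  have "{u\<in>U. f u = 0} = U \<inter> {u. f u = 0}" by auto
  then show ?thesis
    using vs1.subspace_inter assms linear_subspace_kernel by metis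
qed

lemma rank_nullity:
  assumes f: "Vector_Spaces.linear s1 s2 f" and "vs1.fin_subspace U"
  shows "vs2.dim (f ` U) + vs1.dim {u\<in>U. f u = 0} = vs1.dim U"
proof -
  let ?K = "{u\<in>U. f u = 0}"
  have U: "vs1.subspace U" using assms(2) by (rule vs1.fin_subspace_subspace)
  note K = subspace_kernel_on[OF f U]
  obtain C where C: "vs1.subspace C" "C \<subseteq> U" "?K \<inter> C = {0}" "ssum ?K C = U"
    by (rule vs1.complement_exists[OF U K]) auto
  have d: "vs1.dim U = vs1.dim ?K + vs1.dim C"
    by (rule vs1.dim_direct_sum[OF assms(2) K C(1,3,4)])
  have "f ` U \<subseteq> f ` C"
  proof (rule image_subsetI)
    fix x assume "x \<in> U"
    then have "x \<in> ssum ?K C"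
      using C(4) by simp
    then obtain a b where "a \<in> ?K" "b \<in> C" "x = a + b"
      by (rule ssumE)
    then show "f x \<in> f ` C"
      by (simp add: linear_add[OF f])
  qed
  then have "f ` U = f ` C" using C(2) by blast
  moreover have "inj_on f C"
    using C(1-3) by (subst linear_inj_on_iff_eq_0[OF f]) auto
  ultimately show ?thesis
    using d dim_image_inj[OF f vs1.fin_subspace_subset[OF assms(2) C(1,2)]] by simp
qed

lemma inj_on_if_dim_le:
  assumes f: "Vector_Spaces.linear s1 s2 f" and "vs1.fin_subspace U" "vs1.dim U \<le> vs2.dim (f ` U)"
  shows "inj_on f U"
proof -
  have s: "vs1.subspace {u\<in>U. f u = 0}" "vs1.subspace U"
    using subspace_kernel_on[OF f] assms vs1.fin_subspace_subspace by auto
  have "vs1.dim {u\<in>U. f u = 0} = 0"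
    using rank_nullity[OF f assms(2)] assms(3) by simp
  then have "{u\<in>U. f u = 0} = {0}"
    using vs1.fin_subspace_dim_0 vs1.fin_subspace_subset[OF assms(2) s(1)] by auto
  then show ?thesis
    using linear_inj_on_iff_eq_0[OF f] s by auto
qed

text \<open>Passes from a map controlled only on U, such as \<open>act g\<close>, to a total linear
  map. Both are determined on U by their values on a basis of U.\<close>

lemma linear_on_extend:
  assumes "linear_on s1 s2 U f" "vs1.subspace U"
  obtains g where "Vector_Spaces.linear s1 s2 g" "\<And>u. u \<in> U \<Longrightarrow> g u = f u"
proof -
  obtain B where B: "B \<subseteq> U" "vs1.independent B" "U \<subseteq> vs1.span B"
    using vs1.maximal_independent_subset .
  obtain g where g: "Vector_Spaces.linear s1 s2 g" "\<forall>b\<in>B. g b = f b"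
    using linear_independent_extend[OF B(2)] by blast
  have sB: "vs1.span B = U"
    using B assms(2) vs1.span_subspace by blast
  have f0: "f 0 = 0"
  proof -
    have "f (s1 0 0) = s2 0 (f 0)"
      using assms vs1.subspace_0 unfolding linear_on_def by blast
    then show ?thesis by simp
  qed
  have "g u = f u" if "u \<in> U" for u
  proof -
    have "u \<in> vs1.span B" using that sB by simp
    then have "u \<in> U \<and> g u = f u"
    proof (induction rule: vs1.span_induct_alt)
      case base
      then show ?case using f0 linear_0[OF g(1)] vs1.subspace_0[OF assms(2)] by simp
    next
      case (step c x y)
      then have "x \<in> U" "s1 c x \<in> U"
        using B vs1.subspace_scale[OF assms(2)] by auto
      then show ?case
        using step g assms(1) vs1.subspace_add[OF assms(2)]
        by (auto simp: linear_on_def linear_add[OF g(1)] linear_scale[OF g(1)])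
    qed
    then show ?thesis by simp
  qed
  then show ?thesis
    using that g by blast
qed

text \<open>Brings a space living in another type into T. The reflections are computed inside spaces
  of pairs and return to the ambient type in this way.\<close>

lemma embedding_exists:
  assumes "vs1.fin_subspace N" "vs2.fin_subspace T" "vs1.dim N \<le> vs2.dim T"
  obtains f where "Vector_Spaces.linear s1 s2 f" "inj_on f N" "f ` N \<subseteq> T"
proof -
  obtain B where B: "finite B" "vs1.independent B" "vs1.span B = N" "card B = vs1.dim N" "B \<subseteq> N"
    using vs1.fin_subspace_basis[OF assms(1)] by metis
  obtain C where C: "finite C" "vs2.independent C" "vs2.span C = T" "card C = vs2.dim T" "C \<subseteq> T"
    using vs2.fin_subspace_basis[OF assms(2)] by metis
  obtain D where D: "D \<subseteq> C" "card D = vs1.dim N"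
    using obtain_subset_with_card_n C assms(3) by metis
  have iD: "vs2.independent D" "finite D"
    using C D vs2.independent_mono finite_subset by auto
  then have dD: "vs2.dim (vs2.span D) = vs1.dim N"
    using D vs2.dim_span_eq_card_independent by simp
  have "\<exists>f. Vector_Spaces.linear s1 s2 f \<and> f ` B = D \<and> f ` N = vs2.span D \<and> inj_on f N"
    using finite_basis_to_basis_subspace_isomorphism[of N "vs2.span D" B D] assms B D iD dD
    by (simp add: vs1.fin_subspace_subspace vs2.span_superset)
  moreover have "vs2.span D \<subseteq> T"
    using C D vs2.span_mono by metis
  ultimately show ?thesis
    using that by blast
qed

end

section \<open>Kronecker modules\<close>

definition pair_scale :: "('k \<Rightarrow> 'v \<Rightarrow> 'v) \<Rightarrow> 'k \<Rightarrow> 'v \<times> 'v \<Rightarrow> 'v \<times> 'v" where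
  "pair_scale s c p = (s c (fst p), s c (snd p))"

lemma linear_if:
  assumes "vector_space s" "vector_space t" "\<And>x y. f (x + y) = f x + f y" "\<And>c x. f (s c x) = t c (f x)"
  shows "Vector_Spaces.linear s t f"
  using assms by (simp add: Vector_Spaces.linear_iff)

context vec_space
begin

lemma vec_space_pair_scale: "vec_space (pair_scale scale)"
  by unfold_locales (auto simp: pair_scale_def algebra_simps)

section \<open>Direct decompositions and projections\<close>

definition direct :: "'b set \<Rightarrow> 'b set \<Rightarrow> 'b set \<Rightarrow> bool" where
  "direct A B C \<longleftrightarrow> subspace A \<and> subspace B \<and> A \<inter> B = {0} \<and> ssum A B = C"

lemma direct_unique:
  assumes "direct A B C" "a \<in> A" "b \<in> B" "a' \<in> A" "b' \<in> B" "a + b = a' + b'"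
  shows "a = a'" "b = b'"
proof -
  have e: "a - a' = b' - b"
    using assms(6) by (simp add: algebra_simps)
  have "a - a' \<in> A" "b' - b \<in> B"
    using assms by (auto simp: direct_def intro: subspace_diff)
  then have "a - a' = 0"
    using e assms(1) unfolding direct_def by (metis IntI singletonD)
  then show "a = a'" "b = b'"
    using e by simp_all
qed

lemma direct_subset: "direct A B C \<Longrightarrow> A \<subseteq> C \<and> B \<subseteq> C"
  using ssum_left[of B A] ssum_right[of A B] by (auto simp: direct_def)

lemma direct_split:
  assumes "direct A B C" "x \<in> C"
  obtains a b where "a \<in> A" "b \<in> B" "x = a + b"
  using assms ssumE[of x A B] by (auto simp: direct_def)

lemma direct_zero: "subspace A \<Longrightarrow> direct {0} A A"
  by (simp add: direct_def subspace_0)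

lemma direct_commute: "direct A B C \<longleftrightarrow> direct B A C"
  using ssum_commute[of A B] by (auto simp: direct_def)

lemma direct_complement:
  assumes "subspace V" "subspace U" "U \<subseteq> V"
  obtains C where "direct U C V"
  using complement_exists[OF assms] assms unfolding direct_def by metis

lemma directI:
  assumes "subspace A" "subspace B" "A \<subseteq> C" "B \<subseteq> C" "subspace C"
    "\<And>x. x \<in> A \<Longrightarrow> x \<in> B \<Longrightarrow> x = 0" "C \<subseteq> ssum A B"
  shows "direct A B C"
  using assms ssum_minimal[of C A B] subspace_0[of A] subspace_0[of B] by (auto simp: direct_def)

lemma direct_trivial:
  assumes "direct A B C" "A = {0}"
  shows "B = C"
  using assms by (auto simp: direct_def)

lemma projection_exists:
  assumes "direct U C V" "subspace V"
  obtains q where "Vector_Spaces.linear scale scale q"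
    "\<And>u c. u \<in> U \<Longrightarrow> c \<in> C \<Longrightarrow> q (u + c) = c"
proof -
  interpret p: vec_space_pair scale scale ..
  define q where "q x = (SOME c. c \<in> C \<and> (\<exists>u\<in>U. x = u + c))" for x
  have q: "q (u + c) = c" if "u \<in> U" "c \<in> C" for u c
    unfolding q_def using that direct_unique[OF assms(1)] by (intro some_equality) blast+
  have s: "subspace U" "subspace C"
    using assms by (auto simp: direct_def)
  have "linear_on scale scale V q"
    unfolding linear_on_def
  proof (intro conjI ballI allI)
    fix x y assume "x \<in> V" "y \<in> V"
    then obtain u c u' c' where *: "u \<in> U" "c \<in> C" "x = u + c" "u' \<in> U" "c' \<in> C" "y = u' + c'"
      by (meson direct_split[OF assms(1)])
    have "q ((u + u') + (c + c')) = c + c'"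
      using * s by (intro q subspace_add)
    moreover have "(u + u') + (c + c') = x + y"
      using * by (simp add: algebra_simps)
    ultimately show "q (x + y) = q x + q y"
      using * by (simp add: q)
  next
    fix k x assume "x \<in> V"
    then obtain u c where *: "u \<in> U" "c \<in> C" "x = u + c"
      by (meson direct_split[OF assms(1)])
    have "q (k *s u + k *s c) = k *s c"
      using * s by (intro q subspace_scale)
    then show "q (k *s x) = k *s q x"
      using * by (simp add: q scale_right_distrib)
  qed
  then obtain g where g: "Vector_Spaces.linear scale scale g" "\<And>u. u \<in> V \<Longrightarrow> g u = q u"
    using p.linear_on_extend[OF _ assms(2)] by blast
  have "g (u + c) = c" if "u \<in> U" "c \<in> C" for u c
    using that q g(2) direct_subset[OF assms(1)] subspace_add[OF assms(2)] by (metis subsetD)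
  then show ?thesis
    using that g by blast
qed

abbreviation lin :: "('b \<Rightarrow> 'b) \<Rightarrow> bool" where
  "lin \<equiv> Vector_Spaces.linear scale scale"

lemma linD:
  assumes "lin f"
  shows "f (x + y) = f x + f y" "f (c *s x) = c *s f x" "f 0 = 0" "f (x - y) = f x - f y" "f (- x) = - f x"
proof -
  interpret f: Vector_Spaces.linear scale scale f by fact
  show "f (x + y) = f x + f y" "f (c *s x) = c *s f x" "f 0 = 0" "f (x - y) = f x - f y" "f (- x) = - f x"
    by (auto simp: f.add f.scale f.diff f.neg)
qed

lemma subspace_image: "lin f \<Longrightarrow> subspace U \<Longrightarrow> subspace (f ` U)"
  by (metis Vector_Spaces.linear.axioms(3) module_hom.subspace_image)

lemma fin_subspace_image: "lin f \<Longrightarrow> fin_subspace U \<Longrightarrow> fin_subspace (f ` U)"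
  using vec_space_pair.fin_subspace_image[of scale scale f U] by (simp add: vec_space_pair_def vec_space_axioms)

lemma rank_nullity: "lin f \<Longrightarrow> fin_subspace U \<Longrightarrow> dim (f ` U) + dim {u\<in>U. f u = 0} = dim U"
  using vec_space_pair.rank_nullity[of scale scale f U] by (simp add: vec_space_pair_def vec_space_axioms)

lemma dim_image_inj: "lin f \<Longrightarrow> fin_subspace U \<Longrightarrow> inj_on f U \<Longrightarrow> dim (f ` U) = dim U"
  using vec_space_pair.dim_image_inj[of scale scale f U] by (simp add: vec_space_pair_def vec_space_axioms)

lemma inj_on_if_dim_le: "lin f \<Longrightarrow> fin_subspace U \<Longrightarrow> dim U \<le> dim (f ` U) \<Longrightarrow> inj_on f U"
  using vec_space_pair.inj_on_if_dim_le[of scale scale f U] by (simp add: vec_space_pair_def vec_space_axioms)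

lemma inj_on_iff_kernel:
  assumes "lin f" "subspace U"
  shows "inj_on f U \<longleftrightarrow> (\<forall>u\<in>U. f u = 0 \<longrightarrow> u = 0)"
  using vec_space_pair.axioms vector_space_pair.linear_inj_on_iff_eq_0[of scale scale f U] assms
  by (simp add: vector_space_pair_def vector_space_axioms)

text \<open>
  A Kronecker module is a pair of linear maps \<open>X, Y : T \<rightarrow> R\<close>. The source \<open>T\<close> and the target \<open>R\<close> live
  in the same ambient space, so that reflections do not change the type, but they count as separate
  spaces and may overlap.
\<close>

definition kron :: "'b set \<Rightarrow> 'b set \<Rightarrow> ('b \<Rightarrow> 'b) \<Rightarrow> ('b \<Rightarrow> 'b) \<Rightarrow> bool" where
  "kron T R X Y \<longleftrightarrow> fin_subspace T \<and> fin_subspace R \<and> lin X \<and> lin Y \<and> X ` T \<subseteq> R \<and> Y ` T \<subseteq> R"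

definition kron_indec :: "'b set \<Rightarrow> 'b set \<Rightarrow> ('b \<Rightarrow> 'b) \<Rightarrow> ('b \<Rightarrow> 'b) \<Rightarrow> bool" where
  "kron_indec T R X Y \<longleftrightarrow> kron T R X Y \<and> (T \<noteq> {0} \<or> R \<noteq> {0}) \<and>
    (\<forall>T1 T2 R1 R2. direct T1 T2 T \<and> direct R1 R2 R \<and>
        X ` T1 \<subseteq> R1 \<and> Y ` T1 \<subseteq> R1 \<and> X ` T2 \<subseteq> R2 \<and> Y ` T2 \<subseteq> R2 \<longrightarrow>
      T1 = {0} \<and> R1 = {0} \<or> T2 = {0} \<and> R2 = {0})"

lemma kron_indecD:
  assumes "kron_indec T R X Y" "direct T1 T2 T" "direct R1 R2 R"
    "X ` T1 \<subseteq> R1" "Y ` T1 \<subseteq> R1" "X ` T2 \<subseteq> R2" "Y ` T2 \<subseteq> R2"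
  shows "T1 = {0} \<and> R1 = {0} \<or> T2 = {0} \<and> R2 = {0}"
  using assms unfolding kron_indec_def by metis

lemma kron_indec_kron: "kron_indec T R X Y \<Longrightarrow> kron T R X Y"
  by (simp add: kron_indec_def)

lemma kron_subspace: "kron T R X Y \<Longrightarrow> subspace T \<and> subspace R"
  by (simp add: kron_def fin_subspace_subspace)

text \<open>A vector killed by both maps spans a summand with target \<open>{0}\<close>: a
  complement of its span in T, together with all of R, is the other summand.\<close>

lemma kron_indec_kernel:
  assumes "kron_indec T R X Y" "t \<in> T" "X t = 0" "Y t = 0" "t \<noteq> 0"
  shows "T = span {t} \<and> R = {0}"
proof -
  note k = kron_indec_kron[OF assms(1)]
  then have s: "subspace T" "subspace R" by (simp_all add: kron_subspace)
  have "span {t} \<subseteq> T"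
    using s assms(2) by (intro span_minimal) auto
  then obtain C where C: "direct (span {t}) C T"
    using direct_complement s by blast
  have l: "lin X" "lin Y" and CR: "X ` C \<subseteq> R" "Y ` C \<subseteq> R"
    using k direct_subset[OF C] unfolding kron_def by blast+
  have "X ` span {t} \<subseteq> {0}" "Y ` span {t} \<subseteq> {0}"
    using assms l by (auto simp: span_singleton linD)
  from kron_indecD[OF assms(1) C direct_zero[OF s(2)] this CR]
  have "C = {0} \<and> R = {0}"
    using assms(5) span_base[of t "{t}"] by auto
  then show ?thesis
    using C direct_trivial direct_commute by metis
qed

text \<open>A complement in R of the sum of the images receives nothing from T, so it splits off
  with source \<open>{0}\<close>.\<close>

lemma kron_indec_rad:
  assumes "kron_indec T R X Y" "T \<noteq> {0}"
  shows "ssum (X ` T) (Y ` T) = R"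
proof -
  note k = kron_indec_kron[OF assms(1)]
  then have s: "subspace T" "subspace R" by (simp_all add: kron_subspace)
  have i: "subspace (X ` T)" "subspace (Y ` T)" "X ` T \<subseteq> R" "Y ` T \<subseteq> R"
    using k s subspace_image by (auto simp: kron_def)
  then obtain C where C: "direct (ssum (X ` T) (Y ` T)) C R"
    using direct_complement[OF s(2) subspace_ssum] ssum_minimal[OF s(2)] by metis
  have "direct T {0} T"
    using direct_zero[OF s(1)] direct_commute by blast
  moreover have "X ` {0} \<subseteq> C" "Y ` {0} \<subseteq> C"
    using k C subspace_0 by (auto simp: direct_def kron_def linD)
  ultimately have "C = {0}"
    using kron_indecD[OF assms(1) _ C, of T "{0}"] assms(2)
      ssum_left[OF i(2), of "X ` T"] ssum_right[OF i(1), of "Y ` T"] by blast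
  then show ?thesis
    using C direct_trivial direct_commute by metis
qed

text \<open>Where the descent by reflections at the source ends: without a target, any line of T
  splits off.\<close>

lemma kron_indec_sink:
  assumes "kron_indec T R X Y" "R = {0}"
  shows "dim T = 1"
proof -
  have "T \<noteq> {0}"
    using assms by (simp add: kron_indec_def)
  then obtain t where t: "t \<in> T" "t \<noteq> 0"
    using assms kron_indec_kron[of T R X Y] subspace_0[of T] by (auto simp: kron_def fin_subspace_def)
  then have "X t = 0" "Y t = 0"
    using assms by (auto simp: kron_indec_def kron_def)
  then show ?thesis
    using kron_indec_kernel[OF assms(1) t(1)] t dim_line by simp
qed

lemma kron_indec_source:
  assumes "kron_indec T R X Y" "T = {0}"
  shows "dim R = 1"
proof -
  note k = kron_indec_kron[OF assms(1)]
  then have s: "subspace T" "subspace R" by (simp_all add: kron_subspace)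
  have l: "X 0 = 0" "Y 0 = 0"
    using k by (auto simp: kron_def linD)
  have "R \<noteq> {0}"
    using assms by (simp add: kron_indec_def)
  then obtain r where r: "r \<in> R" "r \<noteq> 0"
    using s subspace_0[of R] by auto
  then obtain C where C: "direct (span {r}) C R"
    using direct_complement[OF s(2) subspace_span] span_minimal[of "{r}" R] s by blast
  have "direct {0} {0} T"
    using direct_zero s assms by metis
  from kron_indecD[OF assms(1) this C] l C
  have "C = {0}"
    using r span_base[of r "{r}"] subspace_0 by (auto simp: direct_def)
  then have "R = span {r}"
    using C direct_trivial direct_commute by metis
  then show ?thesis
    using r dim_line by simp
qed

lemma pair_space:
  assumes "fin_subspace R"
  shows "vec_space.fin_subspace (pair_scale scale) (R \<times> R)"
    "vector_space.dim (pair_scale scale) (R \<times> R) = 2 * dim R"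
proof -
  interpret P: vec_space "pair_scale scale" by (rule vec_space_pair_scale)
  interpret i: vec_space_pair scale "pair_scale scale" ..
  let ?f = "\<lambda>r. (r, 0 :: 'b)" and ?g = "\<lambda>r. (0 :: 'b, r)"
  have l: "Vector_Spaces.linear scale (pair_scale scale) ?f" "Vector_Spaces.linear scale (pair_scale scale) ?g"
    by (auto intro!: linear_if vector_space_axioms P.vector_space_axioms simp: pair_scale_def)
  have inj: "inj_on ?f R" "inj_on ?g R"
    by (auto simp: inj_on_def)
  have e: "ssum (?f ` R) (?g ` R) = R \<times> R"
    by (force simp: ssum_def)
  note fin_subspace = i.fin_subspace_image[OF l(1) assms] i.fin_subspace_image[OF l(2) assms]
  show "P.fin_subspace (R \<times> R)"
    using P.fin_subspace_ssum[OF fin_subspace] e by simp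
  have "P.dim (ssum (?f ` R) (?g ` R)) = P.dim (?f ` R) + P.dim (?g ` R)"
    by (rule P.dim_ssum_direct[OF fin_subspace]) (auto simp: zero_prod_def)
  then show "P.dim (R \<times> R) = 2 * dim R"
    using e i.dim_image_inj[OF l(1) assms inj(1)] i.dim_image_inj[OF l(2) assms inj(2)] by simp
qed

text \<open>
  The reflection at the source: \<open>T\<close> embeds into \<open>R \<times> R\<close> by \<open>t \<mapsto> (Y t, - X t)\<close>, and the two
  components of the quotient map \<open>R \<times> R \<rightarrow> S\<close> form the new pair. The bound on dimensions makes room
  for a copy of \<open>S\<close> inside \<open>R\<close>.
\<close>

lemma pair_cokernel:
  assumes k: "kron T R X Y" and ker: "\<And>t. t \<in> T \<Longrightarrow> X t = 0 \<Longrightarrow> Y t = 0 \<Longrightarrow> t = 0"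
    and "dim R \<le> dim T"
  obtains S c d where "kron R S c d" "ssum (c ` R) (d ` R) = S" "dim S + dim T = 2 * dim R"
    "\<And>r r'. r \<in> R \<Longrightarrow> r' \<in> R \<Longrightarrow> c r + d r' = 0 \<longleftrightarrow> (\<exists>t\<in>T. r = Y t \<and> r' = - X t)"
proof -
  interpret P: vec_space "pair_scale scale" by (rule vec_space_pair_scale)
  interpret i: vec_space_pair scale "pair_scale scale" ..
  interpret j: vec_space_pair "pair_scale scale" scale ..
  have K: "fin_subspace T" "fin_subspace R" "lin X" "lin Y" "X ` T \<subseteq> R" "Y ` T \<subseteq> R"
    using k by (auto simp: kron_def)
  have s: "subspace T" "subspace R"
    using K fin_subspace_subspace by auto
  define n where "n t = (Y t, - X t)" for t
  have n: "Vector_Spaces.linear scale (pair_scale scale) n"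
    using K by (auto intro!: linear_if vector_space_axioms P.vector_space_axioms simp: pair_scale_def n_def linD)
  have "inj_on n T"
    using i.linear_inj_on_iff_eq_0[OF n s(1)] ker by (auto simp: n_def zero_prod_def)
  then have dn: "P.dim (n ` T) = dim T"
    by (rule i.dim_image_inj[OF n K(1)])
  note E = pair_space[OF K(2)]
  have nE: "n ` T \<subseteq> R \<times> R"
    using K subspace_neg[OF s(2)] by (auto simp: n_def)
  have sn: "P.subspace (n ` T)" "P.subspace (R \<times> R)"
    using i.fin_subspace_image[OF n K(1)] E P.fin_subspace_subspace by auto
  obtain C where C: "P.direct (n ` T) C (R \<times> R)"
    by (rule P.direct_complement[OF sn(2,1) nE])
  have Cs: "P.subspace C" "C \<subseteq> R \<times> R" "P.fin_subspace C"
    using C P.direct_subset[OF C] P.fin_subspace_subset[OF E(1)] by (auto simp: P.direct_def)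
  have dC: "dim T + P.dim C = 2 * dim R"
    using C P.dim_direct_sum[OF E(1), of "n ` T" C] E(2) dn by (simp add: P.direct_def)
  then obtain f where f: "Vector_Spaces.linear (pair_scale scale) scale f" "inj_on f C" "f ` C \<subseteq> R"
    using j.embedding_exists[OF Cs(3) K(2)] assms(3) by auto
  obtain q where q: "Vector_Spaces.linear (pair_scale scale) (pair_scale scale) q"
    "\<And>u c. u \<in> n ` T \<Longrightarrow> c \<in> C \<Longrightarrow> q (u + c) = c"
    using P.projection_exists[OF C sn(2)] by blast
  \<comment> \<open>The quotient map with kernel the copy of T: project onto the complement C along
    the image of n, then move C into R by f.\<close>
  define g where "g p = f (q p)" for p
  have g: "Vector_Spaces.linear (pair_scale scale) scale g"
    using Vector_Spaces.linear_compose[OF q(1) f(1)] unfolding g_def comp_def .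
  have q0: "q u = 0" if "u \<in> n ` T" for u
    using q(2)[OF that, of 0] P.subspace_0[OF Cs(1)] by simp
  have qC: "q c = c" if "c \<in> C" for c
    using q(2)[OF _ that, of 0] P.subspace_0[OF sn(1)] by simp
  have g0: "g p = 0 \<longleftrightarrow> p \<in> n ` T" if p: "p \<in> R \<times> R" for p
  proof
    assume "p \<in> n ` T"
    then show "g p = 0"
      using q0 j.linear_0[OF f(1)] by (simp add: g_def)
  next
    assume 0: "g p = 0"
    obtain u c where uc: "u \<in> n ` T" "c \<in> C" "p = u + c"
      by (rule P.direct_split[OF C p])
    then have "f c = 0"
      using 0 q(2) by (simp add: g_def)
    then have "c = 0"
      using j.linear_inj_on_iff_eq_0[OF f(1) Cs(1)] f(2) uc by auto
    then show "p \<in> n ` T"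
      using uc by simp
  qed
  have gE: "g ` (R \<times> R) = f ` C"
  proof (intro equalityI subsetI)
    fix x assume "x \<in> g ` (R \<times> R)"
    then obtain p where p: "p \<in> R \<times> R" "x = g p" by blast
    obtain u c where uc: "u \<in> n ` T" "c \<in> C" "p = u + c"
      by (rule P.direct_split[OF C p(1)])
    then show "x \<in> f ` C"
      using p q(2) by (simp add: g_def)
  next
    fix x assume "x \<in> f ` C"
    then obtain c where "c \<in> C" "x = f c" by blast
    then have "x = g c" "c \<in> R \<times> R"
      using qC Cs(2) by (auto simp: g_def)
    then show "x \<in> g ` (R \<times> R)" by blast
  qed
  define c where "c r = g (r, 0)" for r
  define d where "d r = g (0, r)" for r
  have l: "Vector_Spaces.linear scale (pair_scale scale) (\<lambda>r. (r, 0))"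
    "Vector_Spaces.linear scale (pair_scale scale) (\<lambda>r. (0, r))"
    by (auto intro!: linear_if vector_space_axioms P.vector_space_axioms simp: pair_scale_def)
  have lcd: "lin c" "lin d"
    using Vector_Spaces.linear_compose[OF l(1) g] Vector_Spaces.linear_compose[OF l(2) g]
    unfolding c_def d_def comp_def by blast+
  have cd: "c r + d r' = g (r, r')" for r r'
    using j.linear_add[OF g, of "(r, 0)" "(0, r')"] by (simp add: c_def d_def)
  have S: "ssum (c ` R) (d ` R) = f ` C"
  proof -
    have "ssum (c ` R) (d ` R) = g ` (R \<times> R)"
      by (auto simp: ssum_def cd image_iff) (metis cd)+
    then show ?thesis using gE by simp
  qed
  have fS: "fin_subspace (f ` C)"
    by (rule j.fin_subspace_image[OF f(1) Cs(3)])
  have "c ` R \<subseteq> f ` C" "d ` R \<subseteq> f ` C"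
    using S ssum_left[of "d ` R" "c ` R"] ssum_right[of "c ` R" "d ` R"] subspace_image s(2) lcd by auto
  then have "kron R (f ` C) c d"
    using K lcd fS by (simp add: kron_def)
  moreover have "dim (f ` C) + dim T = 2 * dim R"
    using dC j.dim_image_inj[OF f(1) Cs(3) f(2)] by simp
  moreover have "c r + d r' = 0 \<longleftrightarrow> (\<exists>t\<in>T. r = Y t \<and> r' = - X t)" if "r \<in> R" "r' \<in> R" for r r'
    using g0[of "(r, r')"] that by (auto simp: cd n_def)
  ultimately show ?thesis
    using that S by blast
qed

end

section \<open>Reflections of Kronecker modules\<close>

context vec_space
begin

text \<open>The dual reflection, with \<open>K\<close> a copy inside \<open>T\<close> of the kernel of \<open>(t, t') \<mapsto> X t + Y t'\<close>.\<close>

lemma pair_kernel: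
  assumes k: "kron T R X Y" and rad: "ssum (X ` T) (Y ` T) = R" and "dim T \<le> dim R"
  obtains K a b where "kron K T a b" "dim K + dim R = 2 * dim T"
    "\<And>k. k \<in> K \<Longrightarrow> a k = 0 \<Longrightarrow> b k = 0 \<Longrightarrow> k = 0"
    "\<And>t t'. t \<in> T \<Longrightarrow> t' \<in> T \<Longrightarrow> X t + Y t' = 0 \<longleftrightarrow> (\<exists>k\<in>K. t = a k \<and> t' = b k)"
proof -
  interpret P: vec_space "pair_scale scale" by (rule vec_space_pair_scale)
  interpret j: vec_space_pair "pair_scale scale" scale ..
  have K: "fin_subspace T" "fin_subspace R" "lin X" "lin Y" "X ` T \<subseteq> R" "Y ` T \<subseteq> R"
    using k by (auto simp: kron_def)
  note E = pair_space[OF K(1)]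
  define h where "h p = X (fst p) + Y (snd p)" for p
  have h: "Vector_Spaces.linear (pair_scale scale) scale h"
    using K by (auto intro!: linear_if vector_space_axioms P.vector_space_axioms
        simp: pair_scale_def h_def linD scale_right_distrib)
  define N where "N = {p \<in> T \<times> T. h p = 0}"
  have "h ` (T \<times> T) = ssum (X ` T) (Y ` T)"
    by (force simp: h_def ssum_def image_iff)
  then have dN: "P.dim N + dim R = 2 * dim T"
    using j.rank_nullity[OF h E(1)] E(2) rad by (simp add: N_def)
  have sN: "P.subspace N"
    unfolding N_def by (rule j.subspace_kernel_on[OF h P.fin_subspace_subspace[OF E(1)]])
  have fN: "P.fin_subspace N"
    by (rule P.fin_subspace_subset[OF E(1) sN]) (auto simp: N_def)
  obtain f where f: "Vector_Spaces.linear (pair_scale scale) scale f" "inj_on f N" "f ` N \<subseteq> T"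
    using j.embedding_exists[OF fN K(1)] dN assms(3) by auto
  \<comment> \<open>Undoing the embedding f recovers the pair that an element of K stands for; a and
    b are its two coordinates.\<close>
  obtain g where g: "Vector_Spaces.linear scale (pair_scale scale) g" "\<And>p. p \<in> N \<Longrightarrow> g (f p) = p"
    using j.linear_exists_left_inverse_on[OF f(1) sN f(2)] by blast
  interpret g: Vector_Spaces.linear scale "pair_scale scale" g by fact
  define a where "a k = fst (g k)" for k
  define b where "b k = snd (g k)" for k
  have l: "lin a" "lin b"
    by (auto intro!: linear_if vector_space_axioms simp: a_def b_def g.add g.scale)
      (auto simp: pair_scale_def)
  have "kron (f ` N) T a b"
    using K l j.fin_subspace_image[OF f(1) fN] g(2) unfolding kron_def by (force simp: a_def b_def N_def)
  moreover have "dim (f ` N) + dim R = 2 * dim T"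
    using dN j.dim_image_inj[OF f(1) fN f(2)] by simp
  moreover have "k = 0" if "k \<in> f ` N" "a k = 0" "b k = 0" for k
    using that g(2) j.linear_0[OF f(1)] unfolding a_def b_def
    by (metis image_iff prod.collapse zero_prod_def)
  moreover have "X t + Y t' = 0 \<longleftrightarrow> (\<exists>k\<in>f ` N. t = a k \<and> t' = b k)" if "t \<in> T" "t' \<in> T" for t t'
  proof -
    have "X t + Y t' = 0 \<longleftrightarrow> (t, t') \<in> N"
      using that by (simp add: N_def h_def)
    also have "\<dots> \<longleftrightarrow> (\<exists>k\<in>f ` N. (t, t') = g k)"
      using g(2) by force
    finally show ?thesis
      by (auto simp: a_def b_def prod_eq_iff)
  qed
  ultimately show ?thesis
    using that by blast
qed

text \<open>The images of c and d generate S, so a summand whose source is trivial has trivial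
  target as well.\<close>

lemma cokernel_step_zero:
  assumes "ssum (c ` R) (d ` R) = S" "direct S1 S2 S" "c ` R \<subseteq> S2" "d ` R \<subseteq> S2"
  shows "S1 = {0}"
proof -
  have "S \<subseteq> S2"
    using assms ssum_minimal[of S2 "c ` R" "d ` R"] by (auto simp: direct_def)
  then show ?thesis
    using assms(2) direct_subset[OF assms(2)] by (auto simp: direct_def)
qed

text \<open>The original module can be read off the reflected one, because T is the kernel of the
  map from pairs in R to S. A decomposition of the reflected module thus pulls back to T along
  \<open>T'\<close>, and one half of it must vanish.\<close>

lemma kron_indec_cokernel:
  assumes i: "kron_indec T R X Y" and "R \<noteq> {0}" "dim R \<le> dim T"
  obtains S c d where "kron_indec R S c d" "dim S + dim T = 2 * dim R"
    "\<And>r r'. r \<in> R \<Longrightarrow> r' \<in> R \<Longrightarrow> c r + d r' = 0 \<longleftrightarrow> (\<exists>t\<in>T. r = Y t \<and> r' = - X t)"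
proof -
  note k = kron_indec_kron[OF i]
  have l: "lin X" "lin Y" "X ` T \<subseteq> R" "Y ` T \<subseteq> R"
    using k by (auto simp: kron_def)
  have s: "subspace T" "subspace R"
    using k kron_subspace by auto
  have ker: "t = 0" if "t \<in> T" "X t = 0" "Y t = 0" for t
    using kron_indec_kernel[OF i that] assms(2) by blast
  obtain S c d where S: "kron R S c d" "ssum (c ` R) (d ` R) = S" "dim S + dim T = 2 * dim R"
    and cd: "\<And>r r'. r \<in> R \<Longrightarrow> r' \<in> R \<Longrightarrow> c r + d r' = 0 \<longleftrightarrow> (\<exists>t\<in>T. r = Y t \<and> r' = - X t)"
    using pair_cokernel[OF k ker assms(3)] by blast
  have lcd: "lin c" "lin d"
    using S by (auto simp: kron_def)
  have "kron_indec R S c d"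
    unfolding kron_indec_def
  proof (intro conjI allI impI)
    show "kron R S c d" by fact
    show "R \<noteq> {0} \<or> S \<noteq> {0}" using assms by simp
    fix R1 R2 S1 S2
    assume "direct R1 R2 R \<and> direct S1 S2 S \<and>
       c ` R1 \<subseteq> S1 \<and> d ` R1 \<subseteq> S1 \<and> c ` R2 \<subseteq> S2 \<and> d ` R2 \<subseteq> S2"
    then have R: "direct R1 R2 R" and D: "direct S1 S2 S" and
      im: "c ` R1 \<subseteq> S1" "d ` R1 \<subseteq> S1" "c ` R2 \<subseteq> S2" "d ` R2 \<subseteq> S2" by auto
    have sub: "subspace R1" "subspace R2" "subspace S1" "subspace S2" "R1 \<subseteq> R" "R2 \<subseteq> R"
      using R D direct_subset[OF R] by (auto simp: direct_def)
    define T' where "T' Q = {t\<in>T. X t \<in> Q \<and> Y t \<in> Q}" for Q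
    have sT': "subspace (T' Q)" if "subspace Q" for Q
      using that s(1) unfolding subspace_def T'_def by (simp add: linD[OF l(1)] linD[OF l(2)])
    have "direct (T' R1) (T' R2) T"
    proof (rule directI)
      show "subspace (T' R1)" "subspace (T' R2)" "subspace T" "T' R1 \<subseteq> T" "T' R2 \<subseteq> T"
        using sT' sub s by (auto simp: T'_def)
      show "t = 0" if "t \<in> T' R1" "t \<in> T' R2" for t
        using that ker R by (auto simp: T'_def direct_def)
      show "T \<subseteq> ssum (T' R1) (T' R2)"
      proof
        fix t assume t: "t \<in> T"
        then have XY: "X t \<in> R" "Y t \<in> R" using l by auto
        obtain a1 a2 where a: "a1 \<in> R1" "a2 \<in> R2" "Y t = a1 + a2"
          by (rule direct_split[OF R XY(2)])
        obtain b1 b2 where b: "b1 \<in> R1" "b2 \<in> R2" "X t = b1 + b2"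
          by (rule direct_split[OF R XY(1)])
        have nX: "- X t \<in> R"
          using XY s subspace_neg by blast
        have "c (Y t) + d (- X t) = 0"
          using t by (subst cd[OF XY(2) nX]) blast
        \<comment> \<open>The relation attached to t splits along R1 and R2. Its halves take values
          in S1 and S2, so each vanishes, and the R1-half is itself the relation of some t1 in
          T.\<close>
        then have "(c a1 - d b1) + (c a2 - d b2) = 0 + 0"
          by (simp add: a b linD[OF lcd(1)] linD[OF lcd(2)] algebra_simps)
        moreover have "c a1 - d b1 \<in> S1" "c a2 - d b2 \<in> S2" "0 \<in> S1" "0 \<in> S2"
          using a b im sub by (auto intro!: subspace_diff subspace_0)
        ultimately have "c a1 - d b1 = 0"
          using direct_unique(1)[OF D] by blast
        then have "c a1 + d (- b1) = 0"
          by (simp add: linD[OF lcd(2)])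
        moreover have "a1 \<in> R" "- b1 \<in> R"
          using a b sub subspace_neg by auto
        ultimately obtain t1 where t1: "t1 \<in> T" "a1 = Y t1" "b1 = X t1"
          using cd by fastforce
        have "t1 \<in> T' R1" "t - t1 \<in> T' R2"
          using t t1 a b s by (auto simp: T'_def linD[OF l(1)] linD[OF l(2)] intro: subspace_diff)
        then have "t1 + (t - t1) \<in> ssum (T' R1) (T' R2)"
          by (rule ssumI)
        then show "t \<in> ssum (T' R1) (T' R2)" by simp
      qed
    qed
    from kron_indecD[OF i this R]
    have "R1 = {0} \<or> R2 = {0}"
      by (auto simp: T'_def)
    then show "R1 = {0} \<and> S1 = {0} \<or> R2 = {0} \<and> S2 = {0}"
    proof
      assume "R1 = {0}"
      then have "R2 = R" using R direct_trivial by blast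
      then have "S1 = {0}"
        using cokernel_step_zero[OF S(2) D] im by simp
      then show ?thesis using \<open>R1 = {0}\<close> by simp
    next
      assume "R2 = {0}"
      then have "R1 = R" using R direct_trivial direct_commute by blast
      then have "S2 = {0}"
        using cokernel_step_zero[OF S(2)] im D direct_commute by metis
      then show ?thesis using \<open>R2 = {0}\<close> by simp
    qed
  qed
  then show ?thesis
    using that S(3) cd by blast
qed

text \<open>Dually, R is the cokernel of the map from K to pairs in T, since the images of X and Y
  generate R. A decomposition of T is pushed forward by \<open>R'\<close>.\<close>

lemma kron_indec_kernel_step:
  assumes i: "kron_indec T R X Y" and "T \<noteq> {0}" "dim T \<le> dim R"
  obtains K a b where "kron_indec K T a b" "dim K + dim R = 2 * dim T"
proof -
  note k = kron_indec_kron[OF i]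
  have l: "lin X" "lin Y" "X ` T \<subseteq> R" "Y ` T \<subseteq> R"
    using k by (auto simp: kron_def)
  have s: "subspace T" "subspace R"
    using k kron_subspace by auto
  note rad = kron_indec_rad[OF i assms(2)]
  obtain K a b where K: "kron K T a b" "dim K + dim R = 2 * dim T"
    and ker: "\<And>k. k \<in> K \<Longrightarrow> a k = 0 \<Longrightarrow> b k = 0 \<Longrightarrow> k = 0"
    and ab: "\<And>t t'. t \<in> T \<Longrightarrow> t' \<in> T \<Longrightarrow> X t + Y t' = 0 \<longleftrightarrow> (\<exists>k\<in>K. t = a k \<and> t' = b k)"
    using pair_kernel[OF k rad assms(3)] by blast
  have lab: "lin a" "lin b"
    using K by (auto simp: kron_def)
  have "kron_indec K T a b"
    unfolding kron_indec_def
  proof (intro conjI allI impI)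
    show "kron K T a b" by fact
    show "K \<noteq> {0} \<or> T \<noteq> {0}" using assms by simp
    fix K1 K2 T1 T2
    assume "direct K1 K2 K \<and> direct T1 T2 T \<and>
       a ` K1 \<subseteq> T1 \<and> b ` K1 \<subseteq> T1 \<and> a ` K2 \<subseteq> T2 \<and> b ` K2 \<subseteq> T2"
    then have D: "direct K1 K2 K" and T: "direct T1 T2 T" and
      im: "a ` K1 \<subseteq> T1" "b ` K1 \<subseteq> T1" "a ` K2 \<subseteq> T2" "b ` K2 \<subseteq> T2" by auto
    have sub: "subspace K1" "subspace K2" "subspace T1" "subspace T2" "T1 \<subseteq> T" "T2 \<subseteq> T" "K1 \<subseteq> K" "K2 \<subseteq> K"
      using T D direct_subset[OF T] direct_subset[OF D] by (auto simp: direct_def)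
    define R' where "R' Q = ssum (X ` Q) (Y ` Q)" for Q
    have sR': "subspace (R' Q)" "X ` Q \<subseteq> R' Q" "Y ` Q \<subseteq> R' Q" if Q: "subspace Q" for Q
    proof -
      note i = subspace_image[OF l(1) Q] subspace_image[OF l(2) Q]
      show "subspace (R' Q)" "X ` Q \<subseteq> R' Q" "Y ` Q \<subseteq> R' Q"
        unfolding R'_def by (rule subspace_ssum[OF i] ssum_left[OF i(2)] ssum_right[OF i(1)])+
    qed
    have R'R: "R' Q \<subseteq> R" if "Q \<subseteq> T" for Q
      using that l s unfolding R'_def by (intro ssum_minimal) auto
    have "direct (R' T1) (R' T2) R"
    proof (rule directI)
      show "subspace (R' T1)" "subspace (R' T2)" "subspace R" "R' T1 \<subseteq> R" "R' T2 \<subseteq> R"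
        using sR' R'R sub s by auto
      show "r = 0" if r: "r \<in> R' T1" "r \<in> R' T2" for r
      proof -
        obtain t1 t1' t2 t2' where t: "t1 \<in> T1" "t1' \<in> T1" "t2 \<in> T2" "t2' \<in> T2"
          "r = X t1 + Y t1'" "r = X t2 + Y t2'"
          using r by (auto simp: R'_def ssum_def)
        then have "X (t1 - t2) + Y (t1' - t2') = 0"
          by (simp add: linD[OF l(1)] linD[OF l(2)] algebra_simps)
        moreover have "t1 - t2 \<in> T" "t1' - t2' \<in> T"
          using t sub s by (auto intro!: subspace_diff)
        ultimately obtain k where k: "k \<in> K" "t1 - t2 = a k" "t1' - t2' = b k"
          using ab by blast
        obtain k1 k2 where kk: "k1 \<in> K1" "k2 \<in> K2" "k = k1 + k2"
          by (rule direct_split[OF D k(1)])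
        have e: "t1 + (- t2) = a k1 + a k2" "t1' + (- t2') = b k1 + b k2"
          using k kk by (simp_all add: linD[OF lab(1)] linD[OF lab(2)])
        have "- t2 \<in> T2" "- t2' \<in> T2" "a k1 \<in> T1" "b k1 \<in> T1" "a k2 \<in> T2" "b k2 \<in> T2"
          using t kk im sub subspace_neg by auto
        \<comment> \<open>The T1-half of the relation k is k1, so the pair t1, t1' is itself a
          relation and the element r that it represents is 0.\<close>
        then have "t1 = a k1" "t1' = b k1"
          using direct_unique(1)[OF T t(1) _ _ _ e(1)] direct_unique(1)[OF T t(2) _ _ _ e(2)] by auto
        moreover have "k1 \<in> K" "t1 \<in> T" "t1' \<in> T"
          using kk t sub by auto
        ultimately show ?thesis
          using ab[of t1 t1'] t(5) by auto
      qed
      show "R \<subseteq> ssum (R' T1) (R' T2)"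
      proof -
        have "X ` T \<subseteq> ssum (R' T1) (R' T2)" "Y ` T \<subseteq> ssum (R' T1) (R' T2)"
        proof safe
          fix t assume "t \<in> T"
          then obtain t1 t2 where t: "t1 \<in> T1" "t2 \<in> T2" "t = t1 + t2"
            by (rule direct_split[OF T])
          then show "X t \<in> ssum (R' T1) (R' T2)" "Y t \<in> ssum (R' T1) (R' T2)"
            using sR'[OF sub(3)] sR'[OF sub(4)]
            by (auto simp: linD[OF l(1)] linD[OF l(2)] intro!: ssumI)
        qed
        then have "ssum (X ` T) (Y ` T) \<subseteq> ssum (R' T1) (R' T2)"
          using sR' sub by (intro ssum_minimal subspace_ssum) auto
        then show ?thesis
          using rad by simp
      qed
    qed
    from kron_indecD[OF i T this] sR' sub
    have "T1 = {0} \<or> T2 = {0}" by auto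
    moreover have "K1 = {0}" if "T1 = {0}"
      using that im ker sub subspace_0[OF sub(1)] by (auto simp: image_subset_iff)
    moreover have "K2 = {0}" if "T2 = {0}"
      using that im ker sub subspace_0[OF sub(2)] by (auto simp: image_subset_iff)
    ultimately show "K1 = {0} \<and> T1 = {0} \<or> K2 = {0} \<and> T2 = {0}" by blast
  qed
  then show ?thesis
    using that K(2) by blast
qed

text \<open>The kernel step turns the dimensions \<open>(dim T, dim R)\<close> into
  \<open>(2 * dim T - dim R, dim T)\<close>. The difference is kept, and the source shrinks while
  \<open>dim T < dim R\<close>. This can end only at \<open>T = {0}\<close>, where R is a
  line.\<close>

lemma kron_indec_dim_R_le:
  assumes "kron_indec T R X Y"
  shows "dim R \<le> dim T + 1"
  using assms
proof (induction "dim T" arbitrary: T R X Y rule: less_induct)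
  case less
  show ?case
  proof (cases "T = {0} \<or> dim R \<le> dim T")
    case True
    then show ?thesis
      using kron_indec_source[OF less.prems] by auto
  next
    case False
    then obtain K a b where K: "kron_indec K T a b" "dim K + dim R = 2 * dim T"
      using kron_indec_kernel_step[OF less.prems] by (metis linear)
    then have "dim T \<le> dim K + 1"
      using less.hyps[OF _ K(1)] False by auto
    then show ?thesis
      using K(2) by simp
  qed
qed

text \<open>The dual descent: the cokernel step preserves \<open>dim T - dim R\<close> and shrinks
  the target until \<open>R = {0}\<close>.\<close>

lemma kron_indec_dim_T_le:
  assumes "kron_indec T R X Y"
  shows "dim T \<le> dim R + 1"
  using assms
proof (induction "dim R" arbitrary: T R X Y rule: less_induct)
  case less
  show ?case
  proof (cases "R = {0} \<or> dim T \<le> dim R")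
    case True
    then show ?thesis
      using kron_indec_sink[OF less.prems] by auto
  next
    case False
    then obtain S c d where S: "kron_indec R S c d" "dim S + dim T = 2 * dim R"
      using kron_indec_cokernel[OF less.prems] by (metis linear)
    then have "dim R \<le> dim S + 1"
      using less.hyps[OF _ S(1)] False by auto
    then show ?thesis
      using S(2) by simp
  qed
qed

text \<open>
  A violation \<open>dim (X U + Y U) < dim U\<close> is inherited by \<open>X U + Y U\<close> in the reflected module, because
  the kernel of \<open>(X U + Y U)\<^sup>2 \<rightarrow> S\<close> contains a copy of \<open>U\<close>.
\<close>

lemma kron_indec_semistable:
  assumes "kron_indec T R X Y" "dim T = dim R" "subspace U" "U \<subseteq> T"
  shows "dim U \<le> dim (ssum (X ` U) (Y ` U))"
  using assms
proof (induction "dim U" arbitrary: T R X Y U rule: less_induct)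
  case less
  note i = less.prems(1)
  note k = kron_indec_kron[OF i]
  have l: "lin X" "lin Y" "X ` T \<subseteq> R" "Y ` T \<subseteq> R" "fin_subspace T" "fin_subspace R" "subspace R"
    using k fin_subspace_subspace by (auto simp: kron_def)
  have R0: "R \<noteq> {0}"
    using kron_indec_sink[OF i] less.prems(2) by auto
  let ?U' = "ssum (X ` U) (Y ` U)"
  show ?case
  proof (rule ccontr)
    assume "\<not> ?thesis"
    then have lt: "dim ?U' < dim U" by simp
    have le: "dim R \<le> dim T" using less.prems(2) by simp
    obtain S c d where S: "kron_indec R S c d" "dim S + dim T = 2 * dim R"
      and cd: "\<And>r r'. r \<in> R \<Longrightarrow> r' \<in> R \<Longrightarrow> c r + d r' = 0 \<longleftrightarrow> (\<exists>t\<in>T. r = Y t \<and> r' = - X t)"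
      using kron_indec_cokernel[OF i R0 le] by blast
    have lcd: "lin c" "lin d"
      using S by (auto simp: kron_indec_def kron_def)
    note im = subspace_image[OF l(1) less.prems(3)] subspace_image[OF l(2) less.prems(3)]
    have XYU: "X ` U \<subseteq> R" "Y ` U \<subseteq> R"
      using less.prems(4) l(3,4) by blast+
    have sU': "subspace ?U'" "?U' \<subseteq> R"
      by (rule subspace_ssum[OF im] ssum_minimal[OF l(7) XYU])+
    then have fU': "fin_subspace ?U'"
      using fin_subspace_subset l by blast
    \<comment> \<open>The reflected module is square again, since \<open>dim S = dim R\<close>, and
      \<open>?U'\<close> is a smaller subspace of its source.\<close>
    have 1: "dim ?U' \<le> dim (ssum (c ` ?U') (d ` ?U'))"
      using less.hyps[OF lt S(1) _ sU'] S(2) less.prems(2) by simp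
    interpret P: vec_space "pair_scale scale" by (rule vec_space_pair_scale)
    interpret i: vec_space_pair scale "pair_scale scale" ..
    interpret j: vec_space_pair "pair_scale scale" scale ..
    note E = pair_space[OF fU']
    define g where "g p = c (fst p) + d (snd p)" for p
    have g: "Vector_Spaces.linear (pair_scale scale) scale g"
      by (auto intro!: linear_if vector_space_axioms P.vector_space_axioms
        simp: pair_scale_def g_def linD[OF lcd(1)] linD[OF lcd(2)] scale_right_distrib)
    have "g ` (?U' \<times> ?U') = ssum (c ` ?U') (d ` ?U')"
      by (force simp: g_def ssum_def image_iff)
    then have 2: "dim (ssum (c ` ?U') (d ` ?U')) + P.dim {p \<in> ?U' \<times> ?U'. g p = 0} = 2 * dim ?U'"
      using j.rank_nullity[OF g E(1)] E(2) by simp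
    define n where "n t = (Y t, - X t)" for t
    have n: "Vector_Spaces.linear scale (pair_scale scale) n"
      by (auto intro!: linear_if vector_space_axioms P.vector_space_axioms
        simp: pair_scale_def n_def linD[OF l(1)] linD[OF l(2)])
    have ker: "t = 0" if "t \<in> T" "X t = 0" "Y t = 0" for t
      using kron_indec_kernel[OF i that] R0 by blast
    have "inj_on n U"
      using i.linear_inj_on_iff_eq_0[OF n less.prems(3)] ker less.prems(4) by (auto simp: n_def zero_prod_def)
    then have 3: "P.dim (n ` U) = dim U"
      using i.dim_image_inj[OF n] fin_subspace_subset[OF l(5)] less.prems by blast
    have "n ` U \<subseteq> {p \<in> ?U' \<times> ?U'. g p = 0}"
    proof
      fix p assume "p \<in> n ` U"
      then obtain t where t: "t \<in> U" "p = n t" by blast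
      have XY: "X t \<in> ?U'" "Y t \<in> ?U'"
        using t ssum_left[OF im(2), of "X ` U"] ssum_right[OF im(1), of "Y ` U"] by blast+
      then have "- X t \<in> ?U'" using sU' subspace_neg by blast
      moreover have "c (Y t) + d (- X t) = 0"
        using cd[of "Y t" "- X t"] XY calculation sU' t less.prems by blast
      ultimately show "p \<in> {p \<in> ?U' \<times> ?U'. g p = 0}"
        using XY t by (simp add: n_def g_def)
    qed
    then have "dim U \<le> P.dim {p \<in> ?U' \<times> ?U'. g p = 0}"
      using 3 P.dim_mono_fin_subspace[OF P.fin_subspace_subset[OF E(1) j.subspace_kernel_on[OF g P.fin_subspace_subspace[OF E(1)]]]]
      by (metis (no_types, lifting) mem_Collect_eq subsetI)
    \<comment> \<open>The image of the pairs from \<open>?U'\<close> has dimension at least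
      \<open>dim ?U'\<close> and the kernel at least \<open>dim U\<close>, so their sum
      \<open>2 * dim ?U'\<close> would force \<open>dim U \<le> dim ?U'\<close>.\<close>
    then show False
      using 1 2 lt by simp
  qed
qed

end

section \<open>Square Kronecker modules\<close>

context vec_space
begin

lemma exists_dim_minimal:
  assumes "P U"
  obtains Z where "P Z" "\<And>Z'. P Z' \<Longrightarrow> dim Z \<le> dim Z'"
proof -
  obtain Z where "P Z \<and> (\<forall>Z'. P Z' \<longrightarrow> dim Z \<le> dim Z')"
    using ex_has_least_nat[of P U dim, OF assms] ..
  then show ?thesis
    using that by blast
qed

lemma exists_dim_maximal:
  assumes "P U" "\<And>Z. P Z \<Longrightarrow> dim Z \<le> n"
  obtains Z where "P Z" "\<And>Z'. P Z' \<Longrightarrow> dim Z' \<le> dim Z"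
proof -
  have "\<forall>Z. P Z \<longrightarrow> dim Z < Suc n"
    using assms(2) by (simp add: less_Suc_eq_le)
  then show ?thesis
    using that ex_has_greatest_nat[of P U dim "Suc n", OF assms(1)] by blast
qed

lemma dim_image_le: "lin f \<Longrightarrow> fin_subspace U \<Longrightarrow> dim (f ` U) \<le> dim U"
  using rank_nullity[of f U] by simp

lemma ssum_absorb: "subspace B \<Longrightarrow> A \<subseteq> B \<Longrightarrow> subspace A \<Longrightarrow> ssum A B = B"
  using ssum_minimal[of B A B] ssum_right[of A B] by blast

text \<open>
  Fitting's lemma for the linear relation \<open>X\<inverse> Y\<close>: \<open>P\<close> is the part of \<open>T\<close> on which \<open>Y\<close> is bijective
  and \<open>Y\<inverse> X\<close> nilpotent, and on the complement \<open>Q\<close> the map \<open>X\<close> is bijective. Nilpotency is encoded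
  as the absence of subspaces \<open>D\<close> with \<open>X D = Y D\<close>.
\<close>

lemma square_pencil_inj:
  assumes i: "kron_indec T R X Y" and dims: "dim T = dim R"
    and ss: "\<And>U. subspace U \<Longrightarrow> U \<subseteq> T \<Longrightarrow> dim U \<le> dim (ssum (X ` U) (Y ` U))"
  shows "inj_on X T \<or> inj_on Y T"
proof -
  note k = kron_indec_kron[OF i]
  have l: "lin X" "lin Y" "X ` T \<subseteq> R" "Y ` T \<subseteq> R" "fin_subspace T" "fin_subspace R" "subspace R" "subspace T"
    using k fin_subspace_subspace by (auto simp: kron_def)
  note lX = linD[OF l(1)] and lY = linD[OF l(2)]
  have fdT: "fin_subspace U" if "subspace U" "U \<subseteq> T" for U
    using fin_subspace_subset[OF l(5) that] .
  \<comment> \<open>Here the two images add up to the image of Y alone, so semistability says that Y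
    preserves the dimension of U.\<close>
  have injY: "inj_on Y U" if U: "subspace U" "U \<subseteq> T" and "X ` U \<subseteq> Y ` U" for U
  proof (rule inj_on_if_dim_le[OF l(2) fdT[OF U]])
    have "ssum (X ` U) (Y ` U) = Y ` U"
      by (intro ssum_absorb subspace_image l that)
    then show "dim U \<le> dim (Y ` U)"
      using ss[OF U] by simp
  qed
  have injX: "inj_on X U" if U: "subspace U" "U \<subseteq> T" and "Y ` U \<subseteq> X ` U" for U
  proof (rule inj_on_if_dim_le[OF l(1) fdT[OF U]])
    have "ssum (X ` U) (Y ` U) = ssum (Y ` U) (X ` U)"
      by (rule ssum_commute)
    also have "\<dots> = X ` U"
      by (intro ssum_absorb subspace_image l that)
    finally show "dim U \<le> dim (X ` U)"
      using ss[OF U] by simp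
  qed
  \<comment> \<open>\<open>G Z\<close> and \<open>F Z\<close> are the preimages of Z under the
    linear relations "Y inverse after X" and "X inverse after Y". Thus
    \<open>Z \<subseteq> G Z\<close> means that X maps Z into the image of Z under Y.\<close>
  define G where "G Z = {t\<in>T. X t \<in> Y ` Z}" for Z
  define F where "F Z = {t\<in>T. Y t \<in> X ` Z}" for Z
  have sG: "subspace (G Z)" "G Z \<subseteq> T" if "subspace Z" for Z
    using l(8) subspace_image[OF l(2) that] by (auto simp: G_def subspace_def lX)
  have sF: "subspace (F Z)" "F Z \<subseteq> T" if "subspace Z" for Z
    using l(8) subspace_image[OF l(1) that] by (auto simp: F_def subspace_def lY)
  define good where "good Z \<longleftrightarrow> (\<forall>D. subspace D \<and> D \<subseteq> T \<and> X ` D = Y ` D \<longrightarrow> D \<inter> Z = {0})" for Z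
  define pp where "pp Z \<longleftrightarrow> subspace Z \<and> Z \<subseteq> T \<and> Z \<subseteq> G Z \<and> good Z" for Z
  have "pp {0}"
    using subspace_0[OF l(8)] by (auto simp: pp_def G_def good_def lX lY subspace_0)
  then obtain P where P: "pp P" and Pmax: "\<And>Z. pp Z \<Longrightarrow> dim Z \<le> dim P"
    using exists_dim_maximal[of pp "{0}" "dim T"] dim_mono_fin_subspace[OF l(5)] unfolding pp_def by metis
  have P': "subspace P" "P \<subseteq> T" "P \<subseteq> G P" "good P"
    using P by (auto simp: pp_def)
  have XP: "X ` P \<subseteq> Y ` P"
    using P'(3) by (auto simp: G_def)
  note injYP = injY[OF P'(1,2) XP]
  \<comment> \<open>Aims at \<open>G P = P\<close>, by maximality of P. If d in D lies in
    \<open>G P\<close>, then X d is Y z with z in P and also Y d' with d' in D. As Y is injective on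
    \<open>ssum P D\<close>, z equals d', so it lies in both P and D and is 0; finally X is
    injective on D.\<close>
  have "good (G P)"
    unfolding good_def
  proof (intro allI impI)
    fix D assume D: "subspace D \<and> D \<subseteq> T \<and> X ` D = Y ` D"
    have "X ` ssum P D \<subseteq> Y ` ssum P D"
    proof
      fix x assume "x \<in> X ` ssum P D"
      then obtain p q where pq: "p \<in> P" "q \<in> D" "x = X (p + q)"
        by (auto elim!: ssumE)
      then obtain p' q' where "p' \<in> P" "X p = Y p'" "q' \<in> D" "X q = Y q'"
        using XP D by blast
      then have "x = Y (p' + q')" "p' + q' \<in> ssum P D"
        using pq by (auto simp: lX lY intro: ssumI)
      then show "x \<in> Y ` ssum P D" by blast
    qed
    then have inj: "inj_on Y (ssum P D)"
      using D P' l subspace_ssum ssum_minimal[of T P D] by (intro injY) auto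
    have "d = 0" if d: "d \<in> D" "d \<in> G P" for d
    proof -
      obtain z where z: "z \<in> P" "X d = Y z"
        using d by (auto simp: G_def)
      obtain d' where d': "d' \<in> D" "X d = Y d'"
        using d D by blast
      have "z \<in> ssum P D" "d' \<in> ssum P D"
        using z d' D P' ssum_left ssum_right by blast+
      then have "z = d'"
        using z d' inj by (metis inj_onD)
      then have "z \<in> D \<inter> P" using z d' by simp
      then have "z = 0"
        using P'(4) D unfolding good_def by blast
      then have "X d = 0"
        using z by (simp add: lY)
      moreover have "inj_on X D"
        using D by (intro injX) auto
      ultimately show ?thesis
        using d(1) D inj_on_iff_kernel[OF l(1)] by blast
    qed
    then show "D \<inter> G P = {0}"
      using D sG(1)[OF P'(1)] subspace_0 by blast
  qed
  moreover have "G P \<subseteq> G (G P)"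
    using P'(3) by (auto simp: G_def)
  ultimately have "pp (G P)"
    using sG[OF P'(1)] by (simp add: pp_def)
  then have GP: "G P = P"
    using eq_if_dim_le[OF fdT[OF sG[OF P'(1)]] P'(1,3)] Pmax by simp
  \<comment> \<open>By \<open>G P = P\<close> the intersection of the two summands is the image of P
    under X, and P contains the kernel of X. The dimension of the sum is therefore rank plus nullity
    of X, which is \<open>dim T = dim R\<close>.\<close>
  have XTYP: "ssum (X ` T) (Y ` P) = R"
  proof (rule eq_if_dim_le[OF l(6)])
    have f: "fin_subspace (X ` T)" "fin_subspace (Y ` P)" "fin_subspace P"
      using l P' fin_subspace_image fdT by auto
    have "Y ` P \<subseteq> R" using l(4) P'(2) by blast
    then show "subspace (ssum (X ` T) (Y ` P))" "ssum (X ` T) (Y ` P) \<subseteq> R"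
      using ssum_minimal[OF l(7,3)] subspace_ssum[OF f(1,2)[THEN fin_subspace_subspace]] by blast+
    have "X ` T \<inter> Y ` P = X ` P"
      using GP XP P' by (auto simp: G_def)
    then have "dim (ssum (X ` T) (Y ` P)) + dim (X ` P) = dim (X ` T) + dim P"
      using dim_ssum_Int[OF f(1,2)] dim_image_inj[OF l(2) f(3) injYP] by simp
    moreover have "{t\<in>T. X t = 0} = {t\<in>P. X t = 0}"
    proof -
      have "0 \<in> Y ` P"
        using subspace_0[OF P'(1)] by (metis image_eqI lY(3))
      then show ?thesis
        using GP P'(2) by (auto simp: G_def)
    qed
    ultimately show "dim R \<le> dim (ssum (X ` T) (Y ` P))"
      using rank_nullity[OF l(1,5)] rank_nullity[OF l(1) f(3)] dims by simp
  qed
  \<comment> \<open>A least Q of this kind satisfies \<open>F Q = Q\<close>: by \<open>XTYP\<close>,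
    \<open>F Q\<close> and P still generate T, so Q cannot shrink further.\<close>
  define qq where "qq Z \<longleftrightarrow> subspace Z \<and> Z \<subseteq> T \<and> F Z \<subseteq> Z \<and> ssum Z P = T" for Z
  have "ssum T P = T"
    using ssum_minimal[OF l(8) order_refl P'(2)] ssum_left[OF P'(1), of T] by simp
  then have "qq T"
    by (auto simp: qq_def F_def l(8))
  then obtain Q where Q: "qq Q" and Qmin: "\<And>Z. qq Z \<Longrightarrow> dim Q \<le> dim Z"
    using exists_dim_minimal[of qq T] by blast
  have Q': "subspace Q" "Q \<subseteq> T" "F Q \<subseteq> Q" "ssum Q P = T"
    using Q by (auto simp: qq_def)
  have "T \<subseteq> ssum (F Q) P"
  proof
    fix t assume t: "t \<in> T"
    then have "Y t \<in> ssum (X ` T) (Y ` P)"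
      using XTYP l by auto
    then obtain s p where s: "s \<in> T" "p \<in> P" "Y t = X s + Y p"
      by (auto elim!: ssumE)
    have "s \<in> ssum Q P" using s Q' by simp
    then obtain q p' where q: "q \<in> Q" "p' \<in> P" "s = q + p'"
      by (rule ssumE)
    obtain p'' where p'': "p'' \<in> P" "X p' = Y p''"
      using XP q by blast
    have pP: "p + p'' \<in> P"
      using s p'' P' subspace_add by blast
    have "Y (t - (p + p'')) = X q"
      using s q p'' by (simp add: lX lY)
    then have "t - (p + p'') \<in> F Q"
      using q t pP P' l(8) subspace_diff unfolding F_def by blast
    then have "(t - (p + p'')) + (p + p'') \<in> ssum (F Q) P"
      using pP by (rule ssumI)
    then show "t \<in> ssum (F Q) P" by simp
  qed
  then have "ssum (F Q) P = T"
    using ssum_minimal[OF l(8)] sF[OF Q'(1)] P' by blast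
  moreover have "F (F Q) \<subseteq> F Q"
    using Q'(3) by (auto simp: F_def)
  ultimately have "qq (F Q)"
    using sF[OF Q'(1)] by (simp add: qq_def)
  then have FQ: "F Q = Q"
    using eq_if_dim_le[OF fdT[OF Q'(1,2)] sF(1)[OF Q'(1)] Q'(3)] Qmin by simp
  have YQ: "Y ` Q \<subseteq> X ` Q"
    using FQ by (auto simp: F_def)
  note injXQ = injX[OF Q'(1,2) YQ]
  define D where "D = P \<inter> Q"
  have D: "subspace D" "D \<subseteq> T" "D \<subseteq> P" "D \<subseteq> Q"
    using P' Q' subspace_inter by (auto simp: D_def)
  have YPXQ: "Y ` P \<inter> X ` Q = Y ` D"
  proof
    show "Y ` D \<subseteq> Y ` P \<inter> X ` Q"
      using YQ by (auto simp: D_def)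
    show "Y ` P \<inter> X ` Q \<subseteq> Y ` D"
    proof
      fix x assume "x \<in> Y ` P \<inter> X ` Q"
      then obtain p where "p \<in> P" "x = Y p" "Y p \<in> X ` Q" by auto
      then have "p \<in> F Q" using P' by (auto simp: F_def)
      then show "x \<in> Y ` D"
        using FQ \<open>p \<in> P\<close> \<open>x = Y p\<close> by (auto simp: D_def)
    qed
  qed
  have "X ` D \<subseteq> Y ` D"
    using XP D YPXQ by blast
  then have "X ` D = Y ` D"
    using dim_image_inj[OF l(1) fdT[OF D(1,2)] inj_on_subset[OF injXQ D(4)]]
      dim_image_le[OF l(2) fdT[OF D(1,2)]] D l
    by (intro eq_if_dim_le fin_subspace_image fdT subspace_image) auto
  then have "D \<inter> P = {0}"
    using P'(4) D by (simp add: good_def)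
  then have D0: "D = {0}"
    using D by blast
  have dT: "direct P Q T"
  proof -
    have "direct Q P T"
      using P' Q' D0 by (auto simp: direct_def D_def)
    then show ?thesis using direct_commute by blast
  qed
  have dR: "direct (Y ` P) (X ` Q) R"
  proof (rule directI)
    show "subspace (Y ` P)" "subspace (X ` Q)" "subspace R"
      using l(7) subspace_image[OF l(2) P'(1)] subspace_image[OF l(1) Q'(1)] by blast+
    show "Y ` P \<subseteq> R" "X ` Q \<subseteq> R"
      using l(3,4) P'(2) Q'(2) by blast+
    show "x = 0" if "x \<in> Y ` P" "x \<in> X ` Q" for x
      using that YPXQ D0 lY(3) by auto
    show "R \<subseteq> ssum (Y ` P) (X ` Q)"
    proof
      fix r assume "r \<in> R"
      then have "r \<in> ssum (X ` T) (Y ` P)" using XTYP by simp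
      then obtain t p where tp: "t \<in> T" "p \<in> P" "r = X t + Y p"
        by (auto elim!: ssumE)
      have "t \<in> ssum Q P" using tp Q' by simp
      then obtain q p' where q: "q \<in> Q" "p' \<in> P" "t = q + p'"
        by (rule ssumE)
      obtain p'' where p'': "p'' \<in> P" "X p' = Y p''"
        using XP q by blast
      have "Y (p + p'') + X q \<in> ssum (Y ` P) (X ` Q)"
        using p'' tp q P' subspace_add by (intro ssumI) blast+
      then show "r \<in> ssum (Y ` P) (X ` Q)"
        using tp q p'' by (simp add: lX lY algebra_simps)
    qed
  qed
  \<comment> \<open>The summands are P with target \<open>Y\<close>
    P\<open>and Q with target\<close>X \<open>Q\<close>.\<close>
  from kron_indecD[OF i dT dR XP order_refl order_refl YQ]
  have "P = {0} \<or> Q = {0}" by auto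
  then show ?thesis
  proof
    assume "P = {0}"
    then have "Q = T"
      using dT direct_trivial by blast
    then show ?thesis using injXQ by simp
  next
    assume "Q = {0}"
    then have "P = T"
      using dT direct_trivial direct_commute by metis
    then show ?thesis using injYP by simp
  qed
qed

end

section \<open>Frobenius forms and self-adjoint operators\<close>

lemma obtain_least_nat:
  assumes "P (k :: nat)"
  obtains n where "P n" "\<And>m. P m \<Longrightarrow> n \<le> m"
  using assms that LeastI[of P k] Least_le[of P] by blast

context vec_space
begin

text \<open>Nondegeneracy is imposed on the left, matching injectivity of u -> B u into the dual.
  The form obtained from an isomorphism with the dual need not be symmetric.\<close>

definition nondeg_form :: "'b set \<Rightarrow> ('b \<Rightarrow> 'b \<Rightarrow> 'a) \<Rightarrow> bool" where
  "nondeg_form V \<beta> \<longleftrightarrow>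
    (\<forall>s\<in>V. \<forall>t\<in>V. \<forall>u\<in>V. \<beta> s (t + u) = \<beta> s t + \<beta> s u \<and> \<beta> (t + u) s = \<beta> t s + \<beta> u s) \<and>
    (\<forall>c. \<forall>s\<in>V. \<forall>t\<in>V. \<beta> s (c *s t) = c * \<beta> s t \<and> \<beta> (c *s s) t = c * \<beta> s t) \<and>
    (\<forall>s\<in>V. (\<forall>t\<in>V. \<beta> s t = 0) \<longrightarrow> s = 0)"

lemma nondeg_formD:
  assumes "nondeg_form V \<beta>" "s \<in> V" "t \<in> V"
  shows "u \<in> V \<Longrightarrow> \<beta> s (t + u) = \<beta> s t + \<beta> s u" "u \<in> V \<Longrightarrow> \<beta> (t + u) s = \<beta> t s + \<beta> u s"
    "\<beta> s (c *s t) = c * \<beta> s t" "\<beta> (c *s s) t = c * \<beta> s t"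
  using assms unfolding nondeg_form_def by simp_all

lemma nondeg_form_zero:
  assumes "nondeg_form V \<beta>" "s \<in> V"
  shows "\<beta> s 0 = 0" "\<beta> 0 s = 0"
  using nondeg_formD(3,4)[OF assms(1,2,2), of 0] by simp_all

lemma functionalD:
  assumes "Vector_Spaces.linear scale (*) \<phi>"
  shows "\<phi> (x + y) = \<phi> x + \<phi> y" "\<phi> (c *s x) = c * \<phi> x" "\<phi> 0 = 0" "\<phi> (sum f I) = (\<Sum>i\<in>I. \<phi> (f i))"
proof -
  interpret f: Vector_Spaces.linear scale "(*)" \<phi> by fact
  show "\<phi> (x + y) = \<phi> x + \<phi> y" "\<phi> (c *s x) = c * \<phi> x" "\<phi> 0 = 0" "\<phi> (sum f I) = (\<Sum>i\<in>I. \<phi> (f i))"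
    by (auto simp: f.add f.scale f.sum)
qed

lemma lin_sum: "lin f \<Longrightarrow> f (sum g I) = (\<Sum>i\<in>I. f (g i))"
proof -
  assume "lin f"
  then interpret f: Vector_Spaces.linear scale scale f .
  show "f (sum g I) = (\<Sum>i\<in>I. f (g i))" by (rule f.sum)
qed

lemma functional_compose:
  "Vector_Spaces.linear scale (*) \<phi> \<Longrightarrow> lin f \<Longrightarrow> Vector_Spaces.linear scale (*) (\<lambda>v. \<phi> (f v))"
  using Vector_Spaces.linear_compose[of scale scale f "(*)" \<phi>] by (simp add: comp_def)

text \<open>
  If the form \<open>(a, b) \<mapsto> \<phi> (a b v)\<close> of the commutative algebra spanned by the \<open>a i\<close> is
  nondegenerate, then the cyclic submodule \<open>U\<close> generated by \<open>v\<close> has the complement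
  \<open>W = {w. \<forall>i. \<phi> (a i w) = 0}\<close>.
\<close>

lemma frobenius_form:
  fixes a :: "nat \<Rightarrow> 'b \<Rightarrow> 'b"
  assumes V: "fin_subspace V" and "0 < d"
    and lin_a: "\<And>i. i < d \<Longrightarrow> lin (a i)"
    and aV: "\<And>i v. i < d \<Longrightarrow> v \<in> V \<Longrightarrow> a i v \<in> V"
    and comm: "\<And>i j v. i < d \<Longrightarrow> j < d \<Longrightarrow> v \<in> V \<Longrightarrow> a i (a j v) = a j (a i v)"
    and mult: "\<And>i j. i < d \<Longrightarrow> j < d \<Longrightarrow> \<exists>m. \<forall>v\<in>V. a i (a j v) = (\<Sum>l<d. m l *s a l v)"
    and v: "v \<in> V" and \<phi>: "Vector_Spaces.linear scale (*) \<phi>"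
    and nondeg: "\<And>c j. \<forall>i<d. \<phi> (a i (\<Sum>j<d. c j *s a j v)) = 0 \<Longrightarrow> j < d \<Longrightarrow> c j = 0"
    and indec: "\<And>U W. direct U W V \<Longrightarrow> (\<And>i. i < d \<Longrightarrow> a i ` U \<subseteq> U) \<Longrightarrow>
      (\<And>i. i < d \<Longrightarrow> a i ` W \<subseteq> W) \<Longrightarrow> U = {0} \<or> W = {0}"
  obtains \<beta> where "dim V = d" "nondeg_form V \<beta>" "\<And>s t. s \<in> V \<Longrightarrow> t \<in> V \<Longrightarrow> \<beta> s t = \<beta> t s"
    "\<And>i s t. i < d \<Longrightarrow> s \<in> V \<Longrightarrow> t \<in> V \<Longrightarrow> \<beta> (a i s) t = \<beta> s (a i t)"
proof -
  have sV: "subspace V" using V by (rule fin_subspace_subspace)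
  define A where "A c w = (\<Sum>i<d. c i *s a i w)" for c w
  have linA: "lin (A c)" for c
    by (rule linear_if[OF vector_space_axioms vector_space_axioms])
      (simp_all add: A_def lin_a linD[OF lin_a] scale_right_distrib sum.distrib scale_sum_right mult.commute)
  have AV: "A c w \<in> V" if "w \<in> V" for c w
    unfolding A_def using that aV by (auto intro!: subspace_sum[OF sV] subspace_scale[OF sV])
  have A_add: "A (\<lambda>i. c i + e i) w = A c w + A e w" for c e w
    by (simp add: A_def scale_left_distrib sum.distrib)
  have A_scale: "A (\<lambda>i. k * c i) w = k *s A c w" for k c w
    by (simp add: A_def scale_sum_right)
  have A_a: "a i (A c w) = A c (a i w)" if "i < d" "w \<in> V" for i c w
    using that by (simp add: A_def lin_sum[OF lin_a] linD[OF lin_a] comm)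
  have A_comm: "A c (A e w) = A e (A c w)" if "w \<in> V" for c e w
    using that by (subst (1 4) A_def) (simp add: A_a[symmetric] linD[OF linA] lin_sum[OF linA])
  have A_unit: "A (\<lambda>j. if j = i then 1 else 0) w = a i w" if "i < d" for i w
  proof -
    have "(if j = i then 1 else 0) *s a j w = (if j = i then a j w else 0)" for j
      by simp
    then show ?thesis
      using that by (simp add: A_def)
  qed
  have aA: "\<exists>e. \<forall>w\<in>V. a i (A c w) = A e w" if i: "i < d" for i c
  proof -
    obtain m where m: "\<And>j w. j < d \<Longrightarrow> w \<in> V \<Longrightarrow> a i (a j w) = (\<Sum>l<d. m j l *s a l w)"
      using mult[OF i] by metis
    have "a i (A c w) = A (\<lambda>l. \<Sum>j<d. c j * m j l) w" if w: "w \<in> V" for w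
    proof -
      have "a i (A c w) = (\<Sum>j<d. \<Sum>l<d. (c j * m j l) *s a l w)"
        using i w by (simp add: A_def lin_sum[OF lin_a] linD[OF lin_a] m scale_sum_right)
      also have "\<dots> = (\<Sum>l<d. \<Sum>j<d. (c j * m j l) *s a l w)"
        by (rule sum.swap)
      finally show ?thesis
        by (simp add: A_def scale_sum_left)
    qed
    then show ?thesis by blast
  qed
  define U where "U = range (\<lambda>c. A c v)"
  define W where "W = {w\<in>V. \<forall>i<d. \<phi> (a i w) = 0}"
  have sU: "subspace U"
    unfolding subspace_def
  proof (intro conjI ballI allI)
    have "A (\<lambda>_. 0) v \<in> U" by (simp add: U_def)
    then show "0 \<in> U" by (simp add: A_def)
    fix x y k assume "x \<in> U" "y \<in> U"
    then obtain c e where "x = A c v" "y = A e v" by (auto simp: U_def)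
    then show "x + y \<in> U" "k *s x \<in> U"
      unfolding U_def using A_add[of c e v] A_scale[of k c v] by (metis rangeI)+
  qed
  have UV: "U \<subseteq> V" using AV v by (auto simp: U_def)
  have fU: "fin_subspace U" by (rule fin_subspace_subset[OF V sU UV])
  have sW: "subspace W"
    unfolding W_def using functional_compose[OF \<phi> lin_a] by (rule subspace_kernel_functionals[OF sV])
  have c0: "c j = 0" if "\<forall>i<d. \<phi> (a i (A c v)) = 0" "j < d" for c j
    using nondeg[of c j] that by (simp add: A_def)
  have UW: "U \<inter> W \<subseteq> {0}"
  proof
    fix x assume x: "x \<in> U \<inter> W"
    then obtain c where c: "x = A c v" by (auto simp: U_def)
    then have "\<forall>i<d. \<phi> (a i (A c v)) = 0"
      using x by (simp add: W_def)
    then have "x = 0"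
      using c c0[of c] by (simp add: A_def)
    then show "x \<in> {0}" by simp
  qed
  \<comment> \<open>Applying \<open>a i\<close> and then \<open>\<phi>\<close> to a vanishing
    combination of the vectors \<open>a j v\<close> gives the premise of \<open>nondeg\<close>, so
    these d vectors are independent.\<close>
  have dU: "d \<le> dim U"
  proof (rule card_le_dim_if_independent_family[OF fU])
    show "a i v \<in> U" if "i < d" for i
      using A_unit[OF that, of v] by (metis U_def rangeI)
    show "c i = 0" if "(\<Sum>i<d. c i *s a i v) = 0" "i < d" for c i
      using nondeg[of c i] that by (simp add: linD[OF lin_a] functionalD[OF \<phi>])
  qed
  have dW: "dim V \<le> dim W + d"
    unfolding W_def using functional_compose[OF \<phi> lin_a] by (rule dim_kernel_functionals[OF V])
  have "ssum U W = V"
    using dU dW UW UV by (intro direct_sum_if_dim[OF V sU sW]) (auto simp: W_def)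
  then have D: "direct U W V"
    using sU sW UW subspace_0 by (auto simp: direct_def)
  have "a i ` U \<subseteq> U" if "i < d" for i
    using aA[OF that] v by (force simp: U_def)
  moreover have "a i ` W \<subseteq> W" if i: "i < d" for i
  proof (rule image_subsetI)
    fix w assume w: "w \<in> W"
    have "\<phi> (a j (a i w)) = 0" if j: "j < d" for j
    proof -
      obtain m where "a j (a i w) = (\<Sum>l<d. m l *s a l w)"
        using mult[OF j i] w by (auto simp: W_def)
      then show ?thesis
        using w by (simp add: functionalD[OF \<phi>] W_def)
    qed
    then show "a i w \<in> W"
      using w aV i by (simp add: W_def)
  qed
  ultimately have "U = {0} \<or> W = {0}"
    by (rule indec[OF D])
  then have W0: "W = {0}"
    using dU \<open>0 < d\<close> by auto
  then have UV': "U = V"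
    using D direct_commute direct_trivial by metis
  have dim: "dim V = d"
    using dW dU W0 UV' by simp
  \<comment> \<open>V is cyclic by now, so each s in V is \<open>A c v\<close> for some c. By
    commutativity \<open>A c\<close> is determined on V by \<open>A c v\<close>; hence the choice of
    c does not matter, and \<open>\<beta>\<close> sends \<open>A c v\<close>, \<open>A e v\<close>
    to \<open>\<phi> (A c (A e v))\<close>.\<close>
  define C where "C s = (SOME c. A c v = s)" for s
  define \<beta> where "\<beta> s t = \<phi> (A (C s) t)" for s t
  have ex: "\<exists>c. s = A c v" if "s \<in> V" for s
    using that UV' by (auto simp: U_def)
  have \<beta>: "\<beta> (A c v) t = \<phi> (A c t)" if t: "t \<in> V" for c t
  proof -
    obtain e where e: "t = A e v" using ex[OF t] by blast
    have "A (C (A c v)) v = A c v"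
      unfolding C_def by (rule someI[of _ c]) simp
    then have "A (C (A c v)) t = A c t"
      unfolding e by (simp add: A_comm[OF v])
    then show ?thesis by (simp add: \<beta>_def)
  qed
  have sym: "\<beta> s t = \<beta> t s" if st: "s \<in> V" "t \<in> V" for s t
  proof -
    obtain c e where "s = A c v" "t = A e v" using ex st by meson
    then show ?thesis
      using st by (simp add: \<beta> A_comm[OF v])
  qed
  have bil: "\<beta> s (t + u) = \<beta> s t + \<beta> s u" "\<beta> s (k *s t) = k * \<beta> s t" for s t u k
    by (simp_all add: \<beta>_def linD[OF linA] functionalD[OF \<phi>])
  have "s = 0" if s: "s \<in> V" "\<forall>t\<in>V. \<beta> s t = 0" for s
  proof -
    have "\<phi> (a i s) = 0" if i: "i < d" for i
    proof -
      have "\<phi> (a i s) = \<beta> (a i v) s"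
        using \<beta>[OF s(1), of "\<lambda>j. if j = i then 1 else 0"] A_unit[OF i] by simp
      also have "\<dots> = \<beta> s (a i v)"
        using sym s(1) aV[OF i v] by blast
      also have "\<dots> = 0"
        using s(2) aV[OF i v] by blast
      finally show ?thesis .
    qed
    then have "s \<in> W" using s(1) by (simp add: W_def)
    then show ?thesis using W0 by simp
  qed
  moreover have "\<beta> (t + u) s = \<beta> t s + \<beta> u s" "\<beta> (k *s t) s = k * \<beta> t s"
    if "s \<in> V" "t \<in> V" "u \<in> V" for s t u k
    using that bil sym subspace_add[OF sV] subspace_scale[OF sV] by metis+
  ultimately have "nondeg_form V \<beta>"
    using bil unfolding nondeg_form_def by blast
  moreover have "\<beta> (a i s) t = \<beta> s (a i t)" if i: "i < d" and st: "s \<in> V" "t \<in> V" for i s t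
  proof -
    obtain c e where ce: "s = A c v" "t = A e v" using ex st by meson
    have "\<beta> (a i s) t = \<beta> t (a i s)"
      using sym aV i st by blast
    also have "\<dots> = \<phi> (A e (a i s))"
      using \<beta> aV i st ce by simp
    also have "\<dots> = \<phi> (a i (A e (A c v)))"
      using A_a i st ce by simp
    also have "\<dots> = \<phi> (a i (A c t))"
      using A_comm[OF v] ce by simp
    also have "\<dots> = \<beta> s (a i t)"
      using \<beta> aV i st ce A_a by simp
    finally show ?thesis .
  qed
  ultimately show ?thesis
    using that dim sym by blast
qed

section \<open>Powers of an operator and Fitting's lemma\<close>

lemma lin_funpow: "lin f \<Longrightarrow> lin (f ^^ n)"
proof (induction n)
  case 0
  then show ?case using linear_id by (simp add: id_def)
next
  case (Suc n)
  then show ?case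
    using Vector_Spaces.linear_compose[of scale scale "f ^^ n" scale f] by (simp only: funpow.simps)
qed

lemma funpow_closed: "(\<And>t. t \<in> T \<Longrightarrow> f t \<in> T) \<Longrightarrow> t \<in> T \<Longrightarrow> (f ^^ n) t \<in> T"
  by (induction n) auto

lemma funpow_commute_on:
  "(\<And>t. f (g t) = g (f t)) \<Longrightarrow> (f ^^ n) (g t) = g ((f ^^ n) t)"
  by (induction n) auto

text \<open>Once the images of the powers of f stop shrinking, T is the direct sum of the image and
  the kernel of \<open>f ^^ n\<close>. Both are A-invariant because f commutes with A.\<close>

lemma fitting:
  assumes T: "fin_subspace T" and f: "lin f" "\<And>t. t \<in> T \<Longrightarrow> f t \<in> T" and A: "lin A" "\<And>t. t \<in> T \<Longrightarrow> A t \<in> T"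
    and comm: "\<And>t. f (A t) = A (f t)"
    and indec: "\<And>U W. direct U W T \<Longrightarrow> A ` U \<subseteq> U \<Longrightarrow> A ` W \<subseteq> W \<Longrightarrow> U = {0} \<or> W = {0}"
  shows "inj_on f T \<or> (\<exists>n. \<forall>t\<in>T. (f ^^ n) t = 0)"
proof -
  have sT: "subspace T" using T by (rule fin_subspace_subspace)
  note lf = lin_funpow[OF f(1)]
  define I where "I n = (f ^^ n) ` T" for n
  have sI: "subspace (I n)" "I n \<subseteq> T" "fin_subspace (I n)" for n
    using subspace_image[OF lf sT] fin_subspace_image[OF lf T] funpow_closed[of T f] f(2) by (auto simp: I_def)
  obtain n where n: "\<And>m. dim (I n) \<le> dim (I m)"
    using ex_has_least_nat[of "\<lambda>_. True" 0 "\<lambda>n. dim (I n)"] by blast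
  define J where "J = {t\<in>T. (f ^^ n) t = 0}"
  have ImI: "I (n + m) = I n" for m
  proof (rule eq_if_dim_le[OF sI(3) sI(1)])
    show "I (n + m) \<subseteq> I n"
      using funpow_closed[of T f] f(2) by (auto simp: I_def funpow_add)
  qed (rule n)
  have "I n = (f ^^ n) ` I n"
    using ImI[of n] by (simp add: I_def funpow_add image_comp)
  then have inj: "inj_on (f ^^ n) (I n)"
    using sI by (intro inj_on_if_dim_le lf) auto
  have "direct (I n) J T"
  proof (rule directI)
    show "subspace J"
      using sT by (auto simp: subspace_def J_def linD[OF lf])
    show "x = 0" if "x \<in> I n" "x \<in> J" for x
      using that inj inj_on_iff_kernel[OF lf sI(1)] by (auto simp: J_def)
    show "T \<subseteq> ssum (I n) J"
    proof
      fix t assume t: "t \<in> T"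
      then have "(f ^^ n) t \<in> I (n + n)"
        unfolding ImI by (simp add: I_def)
      then obtain s where s: "s \<in> T" "(f ^^ n) t = (f ^^ n) ((f ^^ n) s)"
        by (auto simp: I_def funpow_add)
      have "(f ^^ n) s \<in> I n" "t - (f ^^ n) s \<in> J"
        using s t f(2) by (auto simp: I_def J_def linD[OF lf] intro!: subspace_diff[OF sT] funpow_closed)
      then have "(f ^^ n) s + (t - (f ^^ n) s) \<in> ssum (I n) J"
        by (rule ssumI)
      then show "t \<in> ssum (I n) J" by simp
    qed
  qed (use sI sT in \<open>auto simp: J_def\<close>)
  moreover have "A ` I n \<subseteq> I n" "A ` J \<subseteq> J"
    using A funpow_commute_on[of f A, OF comm] by (auto simp: I_def J_def linD image_iff) metis
  ultimately have "I n = {0} \<or> J = {0}"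
    by (rule indec)
  then show ?thesis
  proof
    assume "I n = {0}"
    then show ?thesis by (auto simp: I_def)
  next
    assume "J = {0}"
    have "t = 0" if "t \<in> T" "f t = 0" for t
    proof (cases n)
      \<comment> \<open>For n = 0 the kernel J is \<open>{0}\<close> in any case, so injectivity
        must come from surjectivity: the images are constant from the start.\<close>
      case 0
      then have "f ` T = T"
        using ImI[of 1] by (simp add: I_def)
      then have "inj_on f T"
        using T f(1) by (intro inj_on_if_dim_le) auto
      then show ?thesis
        using that inj_on_iff_kernel[OF f(1) sT] by blast
    next
      case (Suc m)
      have "(f ^^ n) t = (f ^^ m) (f t)"
        unfolding Suc by (simp add: funpow_swap1)
      then have "t \<in> J"
        using that by (simp add: J_def linD[OF lf])
      then show ?thesis using \<open>J = {0}\<close> by simp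
    qed
    then show ?thesis
      using inj_on_iff_kernel[OF f(1) sT] by blast
  qed
qed

section \<open>Polynomials in an operator\<close>

definition peval :: "('b \<Rightarrow> 'b) \<Rightarrow> 'a poly \<Rightarrow> 'b \<Rightarrow> 'b" where
  "peval A p t = (\<Sum>i\<le>degree p. coeff p i *s (A ^^ i) t)"

lemma peval_ge:
  assumes "degree p \<le> n"
  shows "peval A p t = (\<Sum>i\<le>n. coeff p i *s (A ^^ i) t)"
  unfolding peval_def
  by (rule sum.mono_neutral_left) (use assms in \<open>auto simp: coeff_eq_0\<close>)

lemma peval_add: "peval A (p + q) t = peval A p t + peval A q t"
proof -
  define n where "n = max (degree p) (degree q)"
  have "degree p \<le> n" "degree q \<le> n" "degree (p + q) \<le> n"
    by (auto simp: n_def degree_add_le_max)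
  then show ?thesis
    by (simp add: peval_ge[of _ n] scale_left_distrib sum.distrib)
qed

lemma peval_smult: "peval A (smult c p) t = c *s peval A p t"
  by (simp add: peval_ge[OF degree_smult_le] peval_def[of A p] scale_sum_right)

lemma peval_0 [simp]: "peval A 0 t = 0"
  by (simp add: peval_def)

lemma peval_pCons:
  assumes "lin A"
  shows "peval A (pCons c p) t = c *s t + A (peval A p t)"
proof -
  have "peval A (pCons c p) t = (\<Sum>i\<le>Suc (degree p). coeff (pCons c p) i *s (A ^^ i) t)"
    by (rule peval_ge) (rule degree_pCons_le)
  also have "\<dots> = c *s t + (\<Sum>i\<le>degree p. coeff p i *s (A ^^ Suc i) t)"
    by (subst sum.atMost_Suc_shift) simp
  finally show ?thesis
    by (simp add: peval_def lin_sum[OF assms] linD[OF assms])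
qed

lemma peval_const: "lin A \<Longrightarrow> peval A [:c:] t = c *s t"
  by (simp add: peval_pCons linD)

lemma lin_peval:
  assumes "lin A"
  shows "lin (peval A p)"
  by (rule linear_if[OF vector_space_axioms vector_space_axioms])
    (simp_all add: peval_def linD[OF lin_funpow[OF assms]] scale_right_distrib sum.distrib
      scale_sum_right mult.commute)

lemma peval_commute:
  assumes "lin A"
  shows "peval A p (A t) = A (peval A p t)"
  by (simp add: peval_def lin_sum[OF assms] linD[OF assms] funpow_swap1)

lemma peval_mult:
  assumes "lin A"
  shows "peval A (p * q) t = peval A p (peval A q t)"
proof (induction p)
  case (pCons c p)
  then show ?case
    by (simp add: peval_add peval_smult peval_pCons[OF assms])
qed simp

lemma peval_mult_commute: "lin A \<Longrightarrow> peval A p (peval A q t) = peval A q (peval A p t)"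
  by (metis peval_mult mult.commute)

lemma peval_power: "lin A \<Longrightarrow> peval A (p ^ n) t = (peval A p ^^ n) t"
  by (induction n) (simp_all add: peval_mult peval_const one_pCons)

lemma peval_closed:
  assumes "subspace T" "\<And>t. t \<in> T \<Longrightarrow> A t \<in> T" "t \<in> T"
  shows "peval A p t \<in> T"
  unfolding peval_def
  by (intro subspace_sum[OF assms(1)] subspace_scale[OF assms(1)] funpow_closed assms)

lemma peval_eq_sum:
  assumes "degree p < n \<or> p = 0"
  shows "peval A p t = (\<Sum>i<n. coeff p i *s (A ^^ i) t)"
proof (cases "p = 0")
  case False
  then obtain m where "n = Suc m" "degree p \<le> m"
    using assms by (cases n) auto
  then show ?thesis
    by (simp add: peval_ge[of p m] lessThan_Suc_atMost)
qed simp

definition poly_of :: "nat \<Rightarrow> (nat \<Rightarrow> 'a) \<Rightarrow> 'a poly" where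
  "poly_of n c = (\<Sum>i<n. monom (c i) i)"

lemma coeff_poly_of: "coeff (poly_of n c) i = (if i < n then c i else 0)"
  by (simp add: poly_of_def coeff_sum)

lemma degree_poly_of: "degree (poly_of n c) < n \<or> poly_of n c = 0"
proof (cases "poly_of n c = 0")
  case False
  then have "coeff (poly_of n c) (degree (poly_of n c)) \<noteq> 0" by simp
  then show ?thesis
    by (metis coeff_poly_of)
qed simp

lemma peval_poly_of: "peval A (poly_of n c) t = (\<Sum>i<n. c i *s (A ^^ i) t)"
  by (simp add: peval_eq_sum[OF degree_poly_of] coeff_poly_of)

lemma peval_mod:
  assumes "lin A" "peval A \<mu> t = 0"
  shows "peval A (f mod \<mu>) t = peval A f t"
proof -
  have "peval A (f div \<mu> * \<mu> + f mod \<mu>) t = peval A (f mod \<mu>) t"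
    unfolding peval_add peval_mult[OF assms(1)] assms(2) by (simp add: linD[OF lin_peval[OF assms(1)]])
  then show ?thesis
    unfolding div_mult_mod_eq by simp
qed

text \<open>Since p has positive degree, each division by p lowers the degree, so the process stops
  at a quotient that p fails to divide.\<close>

lemma dvd_decomposition:
  fixes p f :: "'k::field poly"
  assumes "0 < degree p" "f \<noteq> 0"
  obtains j h where "f = p ^ j * h" "\<not> p dvd h"
proof -
  have "\<exists>j h. f = p ^ j * h \<and> \<not> p dvd h"
    using assms(2)
  proof (induction "degree f" arbitrary: f rule: less_induct)
    case less
    show ?case
    proof (cases "p dvd f")
      case False
      then show ?thesis by (intro exI[of _ 0] exI[of _ f]) simp
    next
      case True
      then obtain g where g: "f = p * g" by (rule dvdE)
      then have "g \<noteq> 0" "p \<noteq> 0" using less.prems by auto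
      then have "degree g < degree f"
        using g assms(1) by (simp add: degree_mult_eq)
      then obtain j h where "g = p ^ j * h" "\<not> p dvd h"
        using less.hyps \<open>g \<noteq> 0\<close> by blast
      then show ?thesis
        using g by (intro exI[of _ "Suc j"] exI[of _ h]) (simp add: mult.assoc)
    qed
  qed
  then show ?thesis using that by blast
qed

text \<open>The first \<open>dim T + 1\<close> iterates of a nonzero vector are linearly dependent,
  and the coefficients of a dependence form a polynomial that kills this vector.\<close>

lemma exists_noninjective_poly:
  assumes T: "fin_subspace T" "T \<noteq> {0}" and A: "lin A" "\<And>t. t \<in> T \<Longrightarrow> A t \<in> T"
  obtains \<mu> where "\<mu> \<noteq> 0" "\<not> inj_on (peval A \<mu>) T"
proof -
  have sT: "subspace T" using T fin_subspace_subspace by blast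
  then obtain v where v: "v \<in> T" "v \<noteq> 0"
    using T subspace_0 by blast
  have "\<not> (\<forall>c i. (\<Sum>i<Suc (dim T). c i *s (A ^^ i) v) = 0 \<longrightarrow> i < Suc (dim T) \<longrightarrow> c i = 0)"
    using card_le_dim_if_independent_family[OF T(1), of "Suc (dim T)" "\<lambda>i. (A ^^ i) v"]
      funpow_closed[of T A v] A(2) v(1) by fastforce
  then obtain c i where c: "(\<Sum>i<Suc (dim T). c i *s (A ^^ i) v) = 0" "i < Suc (dim T)" "c i \<noteq> 0"
    by blast
  have "poly_of (Suc (dim T)) c \<noteq> 0"
    using c(2,3) coeff_poly_of by (metis coeff_0)
  moreover have "peval A (poly_of (Suc (dim T)) c) v = 0"
    using c(1) by (simp only: peval_poly_of)
  then have "\<not> inj_on (peval A (poly_of (Suc (dim T)) c)) T"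
    using v inj_on_iff_kernel[OF lin_peval[OF A(1)] sT] by blast
  ultimately show ?thesis using that by blast
qed

text \<open>
  Choosing \<open>p\<close> of least degree with \<open>p(A)\<close> singular replaces the irreducible factor of the minimal
  polynomial: \<open>p(A)\<close> is nilpotent by Fitting's lemma, and \<open>h(A)\<close> is injective unless \<open>p\<close> divides \<open>h\<close>.
\<close>

lemma selfadjoint_form:
  assumes T: "fin_subspace T" "T \<noteq> {0}" and A: "lin A" "\<And>t. t \<in> T \<Longrightarrow> A t \<in> T"
    and indec: "\<And>U W. direct U W T \<Longrightarrow> A ` U \<subseteq> U \<Longrightarrow> A ` W \<subseteq> W \<Longrightarrow> U = {0} \<or> W = {0}"
  obtains \<beta> where "nondeg_form T \<beta>" "\<And>s t. s \<in> T \<Longrightarrow> t \<in> T \<Longrightarrow> \<beta> s t = \<beta> t s"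
    "\<And>s t. s \<in> T \<Longrightarrow> t \<in> T \<Longrightarrow> \<beta> (A s) t = \<beta> s (A t)"
proof -
  have sT: "subspace T" using T fin_subspace_subspace by blast
  note lp = lin_peval[OF A(1)]
  have cl: "peval A p t \<in> T" if "t \<in> T" for p t
    using peval_closed[of T A t p] sT A(2) that by blast
  obtain p where p: "p \<noteq> 0" "\<not> inj_on (peval A p) T"
    and pmin: "\<And>q. q \<noteq> 0 \<Longrightarrow> \<not> inj_on (peval A q) T \<Longrightarrow> degree p \<le> degree q"
  proof -
    let ?P = "\<lambda>p. p \<noteq> 0 \<and> \<not> inj_on (peval A p) T"
    obtain \<mu> where "?P \<mu>"
      using exists_noninjective_poly[of T A] T A by blast
    from ex_has_least_nat[of ?P, OF this, of degree] show ?thesis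
      using that by blast
  qed
  have degp: "0 < degree p"
  proof (rule ccontr)
    assume "\<not> ?thesis"
    then obtain c where c: "p = [:c:]" by (metis degree_eq_zeroE gr0I)
    then have "c \<noteq> 0" using p(1) by simp
    then have "inj_on (peval A p) T"
      by (auto simp: inj_on_def c peval_const[OF A(1)])
    then show False using p(2) by simp
  qed
  have "inj_on (peval A p) T \<or> (\<exists>n. \<forall>t\<in>T. (peval A p ^^ n) t = 0)"
  proof (rule fitting[of T "peval A p" A])
    show "U = {0} \<or> W = {0}" if "direct U W T" "A ` U \<subseteq> U" "A ` W \<subseteq> W" for U W
      by (rule indec[OF that])
    show "peval A p t \<in> T" "A t \<in> T" if "t \<in> T" for t
      using cl A(2) that by blast+
    show "peval A p (A t) = A (peval A p t)" for t
      by (rule peval_commute[OF A(1)])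
  qed (fact T(1) lp A(1))+
  then obtain n' where n': "\<forall>t\<in>T. peval A (p ^ n') t = 0"
    using p(2) by (auto simp: peval_power[OF A(1)])
  then obtain n where n: "\<forall>t\<in>T. peval A (p ^ n) t = 0"
    and nmin: "\<And>m. \<forall>t\<in>T. peval A (p ^ m) t = 0 \<Longrightarrow> n \<le> m"
    using obtain_least_nat[of "\<lambda>n. \<forall>t\<in>T. peval A (p ^ n) t = 0" n'] by blast
  have "n \<noteq> 0"
  proof
    assume "n = 0"
    then have "\<forall>t\<in>T. t = 0"
      using n by (simp add: one_pCons peval_const[OF A(1)])
    then show False using T(2) subspace_0[OF sT] by blast
  qed
  then obtain m where m: "n = Suc m" by (cases n) auto
  then obtain v where v: "v \<in> T" "peval A (p ^ m) v \<noteq> 0"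
    using nmin[of m] by auto
  \<comment> \<open>\<open>p ^ m\<close> is the last power that does not act as zero on T, and
    \<open>p ^ m\<close> applied to v plays the role of the socle generator of the cyclic module of
    v.\<close>
  obtain \<phi> where \<phi>: "Vector_Spaces.linear scale (*) \<phi>" "\<phi> (peval A (p ^ m) v) = 1"
    using separating_functional[OF subspace_single_0, of "peval A (p ^ m) v"] v(2) by auto
  define d where "d = degree (p ^ n)"
  have dd: "d = n * degree p"
    by (simp add: d_def degree_power_eq p(1))
  have pn0: "p ^ n \<noteq> 0" using p(1) by simp
  have d0: "0 < d" using dd degp m by simp
  have red: "\<exists>c. \<forall>t\<in>T. peval A f t = (\<Sum>l<d. c l *s (A ^^ l) t)" for f
  proof -
    have "degree (f mod p ^ n) < d \<or> f mod p ^ n = 0"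
      using degree_mod_less[OF pn0] by (auto simp: d_def)
    then have "peval A f t = (\<Sum>l<d. coeff (f mod p ^ n) l *s (A ^^ l) t)" if "t \<in> T" for t
      using peval_mod[OF A(1), of "p ^ n" t f] n that peval_eq_sum by simp
    then show ?thesis by blast
  qed
  have inj: "inj_on (peval A h) T" if h: "\<not> p dvd h" for h
  proof -
    have r0: "h mod p \<noteq> 0" using h by (simp add: dvd_eq_mod_eq_0)
    then have "degree (h mod p) < degree p"
      using degree_mod_less[OF p(1)] by blast
    then have rinj: "inj_on (peval A (h mod p)) T"
      using pmin[OF r0] by force
    have "t = 0" if t: "t \<in> T" "peval A h t = 0" for t
    proof (rule ccontr)
      assume "t \<noteq> 0"
      have "peval A (p ^ n) t = 0" using n t by simp
      then obtain l where l: "peval A (p ^ l) t = 0" and lmin: "\<And>k. peval A (p ^ k) t = 0 \<Longrightarrow> l \<le> k"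
        using obtain_least_nat[of "\<lambda>l. peval A (p ^ l) t = 0" n] by blast
      have "l \<noteq> 0"
        using l \<open>t \<noteq> 0\<close> by (intro notI) (simp add: one_pCons peval_const[OF A(1)])
      then obtain k where k: "l = Suc k" by (cases l) auto
      \<comment> \<open>The last nonzero p-multiple of t. It is killed by p and by h, hence by
        \<open>h mod p\<close>, a nonzero polynomial of smaller degree than p; minimality of
        \<open>degree p\<close> makes that one injective.\<close>
      define s where "s = peval A (p ^ k) t"
      have s: "s \<in> T" "s \<noteq> 0"
        using cl t lmin[of k] k by (auto simp: s_def)
      have ps: "peval A p s = 0"
        using l k by (simp add: s_def peval_mult[OF A(1)])
      have "peval A h s = 0"
        using t peval_mult_commute[OF A(1), of h "p ^ k" t] by (simp add: s_def linD[OF lp])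
      then have "peval A (h mod p) s = 0"
        using peval_mod[OF A(1) ps] by simp
      then show False
        using rinj s inj_on_iff_kernel[OF lp sT] by blast
    qed
    then show ?thesis
      using inj_on_iff_kernel[OF lp sT] by blast
  qed
  have nondeg: "c j = 0"
    if c: "\<forall>i<d. \<phi> ((A ^^ i) (\<Sum>j<d. c j *s (A ^^ j) v)) = 0" and j: "j < d" for c j
  proof (rule ccontr)
    assume "c j \<noteq> 0"
    define f where "f = poly_of d c"
    have f0: "f \<noteq> 0"
      using \<open>c j \<noteq> 0\<close> j coeff_poly_of by (metis coeff_0 f_def)
    then have df: "degree f < d"
      using degree_poly_of by (auto simp: f_def)
    have c': "\<forall>i<d. \<phi> ((A ^^ i) (peval A f v)) = 0"
      using c by (simp add: f_def peval_poly_of)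
    obtain k h where kh: "f = p ^ k * h" "\<not> p dvd h"
      by (rule dvd_decomposition[OF degp f0])
    have "h \<noteq> 0" using f0 kh by auto
    then have "k * degree p \<le> degree f"
      using kh p(1) by (simp add: degree_mult_eq degree_power_eq)
    then have "k * degree p < n * degree p"
      using df dd by linarith
    then have "k < n" by simp
    then have "k \<le> m" using m by simp
    \<comment> \<open>The largest A-invariant subspace of T inside the kernel of
      \<open>\<phi>\<close>. It contains f(A) v, hence also \<open>p ^ (m - k)\<close> applied to
      it, which is h(A) applied to \<open>p ^ m\<close> of v. As h(A) maps E onto E and is injective
      on T, \<open>p ^ m\<close> of v lies in E, although \<open>\<phi>\<close> is 1 there.\<close>
    define E where "E = {w\<in>T. \<forall>g. \<phi> (peval A g w) = 0}"
    have sE: "subspace E"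
      using sT by (auto simp: subspace_def E_def linD[OF lp] functionalD[OF \<phi>(1)])
    have ET: "E \<subseteq> T" by (auto simp: E_def)
    have fv: "peval A f v \<in> E"
    proof -
      have "\<phi> (peval A g (peval A f v)) = 0" for g
      proof -
        obtain e where "\<forall>t\<in>T. peval A g t = (\<Sum>l<d. e l *s (A ^^ l) t)"
          using red by blast
        then show ?thesis
          using c' cl[OF v(1)] by (simp add: functionalD[OF \<phi>(1)])
      qed
      then show ?thesis using cl v(1) by (simp add: E_def)
    qed
    have Einv: "peval A g w \<in> E" if "w \<in> E" for g w
      using that cl by (auto simp: E_def peval_mult[OF A(1), symmetric])
    have injE: "inj_on (peval A h) E"
      using inj[OF kh(2)] ET by (rule inj_on_subset)
    have "peval A h ` E = E"
      using dim_image_inj[OF lp fin_subspace_subset[OF T(1) sE ET] injE] Einv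
      by (intro eq_if_dim_le[OF fin_subspace_subset[OF T(1) sE ET]] subspace_image[OF lp sE]) auto
    moreover have "peval A (p ^ (m - k)) (peval A f v) \<in> E"
      by (rule Einv[OF fv])
    moreover have "peval A (p ^ (m - k)) (peval A f v) = peval A h (peval A (p ^ m) v)"
    proof -
      have "p ^ (m - k) * f = h * p ^ m"
        using \<open>k \<le> m\<close> by (simp add: kh(1) power_add[symmetric] mult.assoc[symmetric] mult.commute)
      then show ?thesis
        by (simp add: peval_mult[OF A(1), symmetric])
    qed
    ultimately obtain w where w: "w \<in> E" "peval A h w = peval A h (peval A (p ^ m) v)"
      by (metis image_iff)
    then have "w = peval A (p ^ m) v"
      using inj[OF kh(2)] ET cl[OF v(1)] by (meson inj_onD subsetD)
    then have "\<phi> (peval A 1 (peval A (p ^ m) v)) = 0"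
      using w(1) by (simp add: E_def)
    then show False
      using \<phi>(2) by (simp add: one_pCons peval_const[OF A(1)])
  qed
  have mult: "\<exists>c. \<forall>t\<in>T. (A ^^ i) ((A ^^ j) t) = (\<Sum>l<d. c l *s (A ^^ l) t)" for i j
  proof -
    have "peval A (monom 1 (i + j)) t = (A ^^ i) ((A ^^ j) t)" for t
    proof -
      have "peval A (monom 1 (i + j)) t = (\<Sum>l\<le>i + j. if l = i + j then (A ^^ l) t else 0)"
        by (subst peval_ge[OF degree_monom_le]) (intro sum.cong, auto)
      then show ?thesis by (simp add: funpow_add)
    qed
    then show ?thesis using red[of "monom 1 (i + j)"] by simp
  qed
  \<comment> \<open>For d = 1 the operator A is not among the powers \<open>A ^^ i\<close> with i <
    d. Writing it as a combination of them covers this case, both for invariant subspaces and for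
    self-adjointness.\<close>
  obtain c where c: "\<forall>t\<in>T. peval A [:0, 1:] t = (\<Sum>l<d. c l *s (A ^^ l) t)"
    using red by blast
  have Ac: "A t = (\<Sum>l<d. c l *s (A ^^ l) t)" if "t \<in> T" for t
    using c that by (simp add: peval_pCons[OF A(1)] peval_const[OF A(1)] linD[OF A(1)])
  have ind: "U = {0} \<or> W = {0}"
    if "direct U W T" "\<And>i. i < d \<Longrightarrow> (A ^^ i) ` U \<subseteq> U" "\<And>i. i < d \<Longrightarrow> (A ^^ i) ` W \<subseteq> W" for U W
  proof (rule indec[OF that(1)])
    have sub: "U \<subseteq> T" "W \<subseteq> T" "subspace U" "subspace W"
      using direct_subset[OF that(1)] that(1) by (auto simp: direct_def)
    show "A ` U \<subseteq> U" "A ` W \<subseteq> W"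
      using sub that(2,3) by (auto simp: Ac subset_iff intro!: subspace_sum subspace_scale)
  qed
  obtain \<beta> where \<beta>: "nondeg_form T \<beta>" "\<And>s t. s \<in> T \<Longrightarrow> t \<in> T \<Longrightarrow> \<beta> s t = \<beta> t s"
    "\<And>i s t. i < d \<Longrightarrow> s \<in> T \<Longrightarrow> t \<in> T \<Longrightarrow> \<beta> ((A ^^ i) s) t = \<beta> s ((A ^^ i) t)"
  proof (rule frobenius_form[of T d "\<lambda>i. A ^^ i" v \<phi>])
    show "(A ^^ i) t \<in> T" if "t \<in> T" for i t
      by (rule funpow_closed[OF A(2) that])
    show "(A ^^ i) ((A ^^ j) t) = (A ^^ j) ((A ^^ i) t)" for i j t
      by (metis add.commute comp_apply funpow_add)
    show "lin (A ^^ i)" for i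
      by (rule lin_funpow[OF A(1)])
    show "\<exists>c. \<forall>t\<in>T. (A ^^ i) ((A ^^ j) t) = (\<Sum>l<d. c l *s (A ^^ l) t)" for i j
      by (rule mult)
    show "c j = 0" if "\<forall>i<d. \<phi> ((A ^^ i) (\<Sum>j<d. c j *s (A ^^ j) v)) = 0" "j < d" for c j
      by (rule nondeg[OF that])
    show "U = {0} \<or> W = {0}"
      if "direct U W T" "\<And>i. i < d \<Longrightarrow> (A ^^ i) ` U \<subseteq> U" "\<And>i. i < d \<Longrightarrow> (A ^^ i) ` W \<subseteq> W" for U W
      using that by (rule ind)
  qed (use T d0 v \<phi> in auto)
  have "\<beta> (A s) t = \<beta> s (A t)" if st: "s \<in> T" "t \<in> T" for s t
  proof -
    have cl': "(\<Sum>l\<in>I. c l *s (A ^^ l) u) \<in> T" "c l *s (A ^^ l) u \<in> T" "(A ^^ l) u \<in> T" if "u \<in> T" for I u l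
      using that funpow_closed[of T A u] A(2) by (auto intro!: subspace_sum[OF sT] subspace_scale[OF sT])
    have "\<beta> (\<Sum>l\<in>I. c l *s (A ^^ l) s) t = \<beta> s (\<Sum>l\<in>I. c l *s (A ^^ l) t)" if "finite I" "I \<subseteq> {..<d}" for I
      using that
    proof (induction I)
      case (insert l I)
      then have "\<beta> ((A ^^ l) s) t = \<beta> s ((A ^^ l) t)"
        using \<beta>(3) st by simp
      then show ?case
        using insert cl'[OF st(1)] cl'[OF st(2)] st by (simp add: nondeg_formD[OF \<beta>(1)])
    qed (simp add: nondeg_form_zero[OF \<beta>(1)] st)
    then show ?thesis using Ac st by simp
  qed
  then show ?thesis using that \<beta> by blast
qed

end

section \<open>Invariant forms\<close>

context vec_space
begin

lemma vec_space_pair_functional: "vec_space_pair scale ((*) :: 'a \<Rightarrow> 'a \<Rightarrow> 'a)"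
  by unfold_locales (auto simp: algebra_simps)

lemma form_functional:
  assumes V: "subspace V" and B: "nondeg_form V B" and w: "w \<in> V"
  obtains \<psi> where "Vector_Spaces.linear scale (*) \<psi>" "\<And>u. u \<in> V \<Longrightarrow> \<psi> u = B u w"
proof -
  have "linear_on scale (*) V (\<lambda>u. B u w)"
    using w by (simp add: linear_on_def nondeg_formD[OF B])
  then show ?thesis
    using vec_space_pair.linear_on_extend[OF vec_space_pair_functional _ V] that by blast
qed

section \<open>Orthogonal subspaces and representation of functionals\<close>

definition perp :: "('b \<Rightarrow> 'b \<Rightarrow> 'a) \<Rightarrow> 'b set \<Rightarrow> 'b set \<Rightarrow> 'b set" where
  "perp B V W = {u\<in>V. \<forall>w\<in>W. B u w = 0}"

lemma subspace_perp:
  assumes V: "subspace V" and B: "nondeg_form V B" and W: "W \<subseteq> V"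
  shows "subspace (perp B V W)"
proof (rule subspaceI)
  show "0 \<in> perp B V W"
    using subspace_0[OF V] W nondeg_form_zero[OF B] by (auto simp: perp_def)
next
  fix u v assume uv: "u \<in> perp B V W" "v \<in> perp B V W"
  then have "B (u + v) w = 0" if "w \<in> W" for w
    using that W nondeg_formD(2)[OF B, of w u v] by (auto simp: perp_def)
  then show "u + v \<in> perp B V W"
    using uv subspace_add[OF V] by (simp add: perp_def)
next
  fix c u assume u: "u \<in> perp B V W"
  then have "B (c *s u) w = 0" if "w \<in> W" for w
    using that W nondeg_formD(4)[OF B, of u w c] by (auto simp: perp_def)
  then show "c *s u \<in> perp B V W"
    using u subspace_scale[OF V] by (simp add: perp_def)
qed

text \<open>Orthogonality to W need only be tested on a basis of W, which amounts to
  \<open>dim W\<close> linear equations.\<close>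

lemma dim_perp:
  assumes V: "fin_subspace V" and B: "nondeg_form V B" and W: "subspace W" "W \<subseteq> V"
  shows "dim V \<le> dim (perp B V W) + dim W"
proof -
  have sV: "subspace V" using V by (rule fin_subspace_subspace)
  obtain C where C: "finite C" "span C = W" "card C = dim W" "C \<subseteq> W"
    using fin_subspace_basis[OF fin_subspace_subset[OF V W]] by metis
  obtain b where b: "bij_betw b {..<dim W} C"
    using C ex_bij_betw_nat_finite by (metis atLeast0LessThan)
  have bW: "b i \<in> W" if "i < dim W" for i
    using that b C(4) by (auto simp: bij_betw_def)
  have "\<exists>\<psi>. Vector_Spaces.linear scale (*) \<psi> \<and> (\<forall>u\<in>V. \<psi> u = B u (b i))" if i: "i < dim W" for i
    using form_functional[OF sV B] bW[OF i] W(2) by (metis subsetD)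
  then obtain \<psi> where \<psi>: "\<And>i. i < dim W \<Longrightarrow> Vector_Spaces.linear scale (*) (\<psi> i)"
    "\<And>i u. i < dim W \<Longrightarrow> u \<in> V \<Longrightarrow> \<psi> i u = B u (b i)"
    by metis
  have "{u\<in>V. \<forall>i<dim W. \<psi> i u = 0} \<subseteq> perp B V W"
  proof
    fix u assume "u \<in> {u\<in>V. \<forall>i<dim W. \<psi> i u = 0}"
    then have u: "u \<in> V" "\<And>i. i < dim W \<Longrightarrow> B u (b i) = 0"
      using \<psi>(2) by auto
    have "C \<subseteq> {w\<in>V. B u w = 0}"
      using u(2) b W C(4) unfolding bij_betw_def by auto
    moreover have "subspace {w\<in>V. B u w = 0}"
      by (rule subspaceI) (simp_all add: u(1) nondeg_formD[OF B] nondeg_form_zero[OF B]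
          subspace_0[OF sV] subspace_add[OF sV] subspace_scale[OF sV])
    ultimately have "W \<subseteq> {w\<in>V. B u w = 0}"
      using span_minimal C(2) by metis
    then show "u \<in> perp B V W"
      using u(1) by (auto simp: perp_def)
  qed
  moreover have "perp B V W \<subseteq> V" by (auto simp: perp_def)
  then have "fin_subspace (perp B V W)"
    using fin_subspace_subset[OF V subspace_perp[OF sV B W(2)]] by blast
  ultimately have "dim {u\<in>V. \<forall>i<dim W. \<psi> i u = 0} \<le> dim (perp B V W)"
    using dim_mono_fin_subspace by blast
  moreover have "dim V \<le> dim {u\<in>V. \<forall>i<dim W. \<psi> i u = 0} + dim W"
    by (rule dim_kernel_functionals[OF V]) (rule \<psi>(1))
  ultimately show ?thesis by linarith
qed

text \<open>The orthogonal of the hyperplane where \<open>\<psi>\<close> vanishes is nonzero by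
  dimension. A nonzero u in it gives a functional proportional to \<open>\<psi>\<close>, and
  nondegeneracy allows rescaling.\<close>

lemma form_represents:
  assumes V: "fin_subspace V" and B: "nondeg_form V B" and \<psi>: "Vector_Spaces.linear scale (*) \<psi>"
  obtains u where "u \<in> V" "\<And>v. v \<in> V \<Longrightarrow> B u v = \<psi> v"
proof (cases "\<forall>v\<in>V. \<psi> v = 0")
  case True
  then show ?thesis
    using that[of 0] subspace_0[OF fin_subspace_subspace[OF V]] nondeg_form_zero[OF B] by simp
next
  case False
  then obtain v0 where v0: "v0 \<in> V" "\<psi> v0 \<noteq> 0" by blast
  have sV: "subspace V" using V by (rule fin_subspace_subspace)
  let ?K = "{v\<in>V. \<psi> v = 0}"
  have K: "subspace ?K" "?K \<subseteq> V"
    by (auto intro!: subspaceI simp: functionalD[OF \<psi>] subspace_0[OF sV] subspace_add[OF sV] subspace_scale[OF sV])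
  have "dim ?K < dim V"
  proof (rule ccontr)
    assume "\<not> dim ?K < dim V"
    then have "?K = V"
      by (intro eq_if_dim_le[OF V K]) simp
    then show False using v0 by blast
  qed
  then have "dim (perp B V ?K) \<noteq> 0"
    using dim_perp[OF V B K] by linarith
  then obtain u where u: "u \<in> perp B V ?K" "u \<noteq> 0"
  proof -
    have "perp B V ?K \<noteq> {0}"
      using \<open>dim (perp B V ?K) \<noteq> 0\<close> dim_zero by metis
    moreover have "0 \<in> perp B V ?K"
      by (rule subspace_0[OF subspace_perp[OF sV B K(2)]])
    ultimately show ?thesis using that by blast
  qed
  then have uV: "u \<in> V" by (simp add: perp_def)
  have eq: "B u v = (\<psi> v / \<psi> v0) * B u v0" if v: "v \<in> V" for v
  proof -
    let ?c = "\<psi> v / \<psi> v0"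
    have "v + (- ?c) *s v0 \<in> V"
      using v v0 subspace_add[OF sV] subspace_scale[OF sV] by blast
    moreover have "\<psi> (v + (- ?c) *s v0) = 0"
      unfolding functionalD[OF \<psi>] using v0 by simp
    ultimately have "v + (- ?c) *s v0 \<in> ?K" by simp
    then have "B u (v + (- ?c) *s v0) = 0"
      using u(1) by (auto simp: perp_def)
    moreover have "(- ?c) *s v0 \<in> V"
      using v0 sV subspace_scale by blast
    ultimately show ?thesis
      using v v0 uV nondeg_formD(1)[OF B uV v, of "(- ?c) *s v0"] nondeg_formD(3)[OF B uV v0(1), of "- ?c"]
      by (simp del: scale_minus_left)
  qed
  have "B u v0 \<noteq> 0"
  proof
    assume "B u v0 = 0"
    then have "\<forall>v\<in>V. B u v = 0" using eq by simp
    then show False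
      using B uV u(2) by (simp add: nondeg_form_def)
  qed
  let ?u = "(\<psi> v0 / B u v0) *s u"
  have "B ?u v = \<psi> v" if "v \<in> V" for v
    using \<open>B u v0 \<noteq> 0\<close> v0 that uV nondeg_formD(4)[OF B uV that] eq[OF that] by simp
  then show ?thesis
    using that uV sV subspace_scale by blast
qed

text \<open>\<open>dim_perp\<close> at R bounds \<open>dim V\<close> by \<open>2 * dim R\<close>.
  For the other bound take a complement C of R: a vector of R orthogonal to C is orthogonal to
  everything, so \<open>perp B V C\<close> meets R trivially, and its dimension is at least
  \<open>dim V - dim C = dim R\<close>.\<close>

lemma self_perp_dim:
  assumes V: "fin_subspace V" and B: "nondeg_form V B" and R: "subspace R" "R \<subseteq> V" and perp: "perp B V R = R"
  shows "dim V = 2 * dim R"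
proof -
  have sV: "subspace V" using V by (rule fin_subspace_subspace)
  obtain C where C: "direct R C V"
    by (rule direct_complement[OF sV R])
  have C': "subspace C" "C \<subseteq> V" "dim V = dim R + dim C"
    using C direct_subset[OF C] dim_direct_sum[OF V] by (auto simp: direct_def)
  have P: "subspace (perp B V C)" "perp B V C \<subseteq> V"
    using subspace_perp[OF sV B C'(2)] by (auto simp: perp_def)
  have "u = 0" if u: "u \<in> perp B V C" "u \<in> R" for u
  proof -
    have uV: "u \<in> V" using u by (simp add: perp_def)
    have "B u v = 0" if v: "v \<in> V" for v
    proof -
      obtain r c where rc: "r \<in> R" "c \<in> C" "v = r + c"
        by (rule direct_split[OF C v])
      have "B u r = 0" using u(2) perp rc unfolding perp_def by blast
      moreover have "B u c = 0" using u(1) rc unfolding perp_def by blast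
      ultimately show ?thesis
        using rc uV R C' nondeg_formD(1)[OF B uV, of r c] by auto
    qed
    then show ?thesis
      using B uV by (simp add: nondeg_form_def)
  qed
  then have "dim (ssum (perp B V C) R) = dim (perp B V C) + dim R"
    using fin_subspace_subset[OF V] P R by (intro dim_ssum_direct) auto
  moreover have "ssum (perp B V C) R \<subseteq> V"
    using sV P R by (intro ssum_minimal)
  ultimately have "dim (perp B V C) + dim R \<le> dim V"
    using dim_mono_fin_subspace[OF V] by metis
  then show ?thesis
    using dim_perp[OF V B C'(1,2)] dim_perp[OF V B R] perp C'(3) by simp
qed

section \<open>Forms with x and y self-adjoint\<close>

definition selfadjoint_on :: "'b set \<Rightarrow> ('b \<Rightarrow> 'b \<Rightarrow> 'a) \<Rightarrow> ('b \<Rightarrow> 'b) \<Rightarrow> bool" where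
  "selfadjoint_on V B f \<longleftrightarrow> (\<forall>u\<in>V. \<forall>v\<in>V. B (f u) v = B u (f v))"

text \<open>The 4 is the dimension of the group algebra with basis 1, x, y, xy, listed as
  \<open>a 0\<close> to \<open>a 3\<close>. Its socle is spanned by xy, so a functional with value 1
  at \<open>x (y v)\<close> gives a Frobenius form.\<close>

lemma free_case_form:
  assumes V: "fin_subspace V" and x: "lin x" "\<And>v. v \<in> V \<Longrightarrow> x v \<in> V" and y: "lin y" "\<And>v. v \<in> V \<Longrightarrow> y v \<in> V"
    and rel: "\<And>v. v \<in> V \<Longrightarrow> x (x v) = 0" "\<And>v. v \<in> V \<Longrightarrow> y (y v) = 0" "\<And>v. v \<in> V \<Longrightarrow> y (x v) = x (y v)"
    and indec: "\<And>U W. direct U W V \<Longrightarrow> x ` U \<subseteq> U \<Longrightarrow> y ` U \<subseteq> U \<Longrightarrow> x ` W \<subseteq> W \<Longrightarrow> y ` W \<subseteq> W \<Longrightarrow>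
      U = {0} \<or> W = {0}"
    and v: "v \<in> V" "x (y v) \<noteq> 0"
  obtains B where "dim V = 4" "nondeg_form V B" "selfadjoint_on V B x" "selfadjoint_on V B y"
proof -
  obtain \<phi> where \<phi>: "Vector_Spaces.linear scale (*) \<phi>" "\<phi> (x (y v)) = 1"
    using separating_functional[OF subspace_single_0, of "x (y v)"] v(2) by auto
  define a where "a i = (if i = 0 then \<lambda>v. v else if i = 1 then x else if i = 2 then y else (\<lambda>v. x (y v)))"
    for i :: nat
  have a: "a 0 w = w" "a 1 w = x w" "a (Suc 0) w = x w" "a 2 w = y w" "a 3 w = x (y w)" for w
    by (simp_all add: a_def)
  have lt4: "i < 4 \<longleftrightarrow> i = 0 \<or> i = 1 \<or> i = 2 \<or> i = 3" for i :: nat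
    by auto
  have sum4: "(\<Sum>i<4. f i) = f 0 + f 1 + f 2 + f 3" for f :: "nat \<Rightarrow> 'b"
    by (simp add: numeral_eq_Suc)
  note lx = linD[OF x(1)] and ly = linD[OF y(1)]
  obtain B where B: "dim V = 4" "nondeg_form V B" "\<And>s t. s \<in> V \<Longrightarrow> t \<in> V \<Longrightarrow> B s t = B t s"
    "\<And>i s t. i < 4 \<Longrightarrow> s \<in> V \<Longrightarrow> t \<in> V \<Longrightarrow> B (a i s) t = B s (a i t)"
  proof (rule frobenius_form[of V 4 a v \<phi>])
    show "lin (a i)" if "i < 4" for i
      using that x y Vector_Spaces.linear_compose[OF y(1) x(1)] linear_ident
      unfolding lt4 by (auto simp: a_def comp_def)
    show "a i w \<in> V" if "i < 4" "w \<in> V" for i w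
      using that x y unfolding lt4 by (auto simp: a)
    show "a i (a j w) = a j (a i w)" if "i < 4" "j < 4" "w \<in> V" for i j w
      using that x y rel unfolding lt4 by (elim disjE) (simp_all add: a lx ly)
    show "\<exists>m. \<forall>w\<in>V. a i (a j w) = (\<Sum>l<4. m l *s a l w)" if "i < 4" "j < 4" for i j
    proof -
      have "(\<forall>w\<in>V. a i (a j w) = 0) \<or> (\<exists>l<4. \<forall>w\<in>V. a i (a j w) = a l w)"
        using that x y rel unfolding lt4 by (elim disjE) (auto simp: a lx ly)
      then show ?thesis
      proof
        assume "\<forall>w\<in>V. a i (a j w) = 0"
        then show ?thesis by (intro exI[of _ "\<lambda>_. 0"]) simp
      next
        assume "\<exists>l<4. \<forall>w\<in>V. a i (a j w) = a l w"
        then obtain l where "l < 4" "\<forall>w\<in>V. a i (a j w) = a l w" by blast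
        then show ?thesis
          by (intro exI[of _ "\<lambda>k. if k = l then 1 else 0"]) (auto simp: sum4 lt4)
      qed
    qed
    show "c j = 0" if c: "\<forall>i<4. \<phi> (a i (\<Sum>j<4. c j *s a j v)) = 0" and j: "j < 4" for c j
    proof -
      have i: "\<phi> (a 0 (\<Sum>j<4. c j *s a j v)) = 0" "\<phi> (a 1 (\<Sum>j<4. c j *s a j v)) = 0"
        "\<phi> (a 2 (\<Sum>j<4. c j *s a j v)) = 0" "\<phi> (a 3 (\<Sum>j<4. c j *s a j v)) = 0"
        using c by simp_all
      \<comment> \<open>Nothing is known about \<open>\<phi>\<close> at v, x v and y v, so the order
        matters: multiplication by xy isolates \<open>c 0\<close>, then y isolates
        \<open>c 1\<close>, x isolates \<open>c 2\<close>, and 1 leaves \<open>c 3\<close>.\<close>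
      have "c 0 = 0"
        using i(4) rel x y v(1) by (simp add: sum4 a lx ly functionalD[OF \<phi>(1)] \<phi>(2))
      moreover from this have "c 1 = 0"
        using i(3) rel x y v(1) by (simp add: sum4 a lx ly functionalD[OF \<phi>(1)] \<phi>(2))
      moreover from calculation have "c 2 = 0"
        using i(2) rel x y v(1) by (simp add: sum4 a lx ly functionalD[OF \<phi>(1)] \<phi>(2))
      moreover from calculation have "c 3 = 0"
        using i(1) rel x y v(1) by (simp add: sum4 a lx ly functionalD[OF \<phi>(1)] \<phi>(2))
      ultimately show ?thesis
        using j unfolding lt4 by auto
    qed
    show "U = {0} \<or> W = {0}"
      if "direct U W V" "\<And>i. i < 4 \<Longrightarrow> a i ` U \<subseteq> U" "\<And>i. i < 4 \<Longrightarrow> a i ` W \<subseteq> W" for U W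
      using that(2)[of 1] that(2)[of 2] that(3)[of 1] that(3)[of 2] by (intro indec[OF that(1)]) (auto simp: a_def)
  qed (use V v \<phi> in auto)
  have "selfadjoint_on V B x" "selfadjoint_on V B y"
    using B(4)[of 1] B(4)[of 2] by (simp_all add: selfadjoint_on_def a)
  then show ?thesis
    using that B by blast
qed

text \<open>Identifying R with T through x turns V into two copies of T, with x the shift from one
  to the other and y the shift followed by A. A form for which A is self-adjoint then pairs the two
  copies.\<close>

lemma pencil_form:
  assumes V: "fin_subspace V" "direct T R V" and i: "kron_indec T R x y"
    and R0: "\<And>r. r \<in> R \<Longrightarrow> x r = 0" "\<And>r. r \<in> R \<Longrightarrow> y r = 0"
    and inj: "inj_on x T" and dims: "dim T = dim R"
  obtains B where "nondeg_form V B" "selfadjoint_on V B x" "selfadjoint_on V B y"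
proof -
  interpret p: vec_space_pair scale scale ..
  note k = kron_indec_kron[OF i]
  have l: "lin x" "lin y" "x ` T \<subseteq> R" "y ` T \<subseteq> R" "fin_subspace T" "fin_subspace R" "subspace R" "subspace T"
    using k fin_subspace_subspace by (auto simp: kron_def)
  note lx = linD[OF l(1)] and ly = linD[OF l(2)]
  have xT: "x ` T = R"
    using dim_image_inj[OF l(1,5) inj] dims
    by (intro eq_if_dim_le[OF l(6) subspace_image[OF l(1,8)] l(3)]) simp
  obtain z where z: "z ` UNIV \<subseteq> T" "lin z" "\<And>t. t \<in> T \<Longrightarrow> z (x t) = t"
    using p.linear_exists_left_inverse_on[OF l(1,8) inj] by blast
  have xz: "x (z r) = r" if "r \<in> R" for r
    using that xT z(3) by (metis image_iff)
  have zT: "z w \<in> T" for w using z(1) by blast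
  note lz = linD[OF z(2)]
  define A where "A t = z (y t)" for t
  have A: "lin A"
    using Vector_Spaces.linear_compose[OF l(2) z(2)] unfolding A_def comp_def .
  have AT: "A t \<in> T" for t
    by (simp add: A_def zT)
  have xA: "x (A t) = y t" if "t \<in> T" for t
    using that l(4) xz by (auto simp: A_def)
  have T0: "T \<noteq> {0}"
    using kron_indec_source[OF i] dims by auto
  have ind: "U = {0} \<or> W = {0}" if D: "direct U W T" and UW: "A ` U \<subseteq> U" "A ` W \<subseteq> W" for U W
  proof -
    have sub: "U \<subseteq> T" "W \<subseteq> T" "subspace U" "subspace W"
      using direct_subset[OF D] D by (auto simp: direct_def)
    have "direct (x ` U) (x ` W) R"
    proof (rule directI)
      show "subspace (x ` U)" "subspace (x ` W)" "subspace R" "x ` U \<subseteq> R" "x ` W \<subseteq> R"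
        using l(7) sub l(3) subspace_image[OF l(1)] by blast+
      show "w = 0" if w: "w \<in> x ` U" "w \<in> x ` W" for w
      proof -
        obtain u u' where "u \<in> U" "u' \<in> W" "w = x u" "w = x u'"
          using w by blast
        moreover from this have "u \<in> T" "u' \<in> T" using sub by auto
        ultimately have "z w = u" "z w = u'" "u \<in> U" "u' \<in> W" "w = x u"
          using z(3)[of u] z(3)[of u'] by simp_all
        then have "u \<in> U \<inter> W" using \<open>u \<in> U\<close> \<open>u' \<in> W\<close> by simp
        then have "u = 0" using D unfolding direct_def by blast
        then show ?thesis using \<open>w = x u\<close> lx by simp
      qed
      show "R \<subseteq> ssum (x ` U) (x ` W)"
      proof
        fix r assume "r \<in> R"
        then obtain t where t: "t \<in> T" "r = x t" using xT by blast
        obtain u w where "u \<in> U" "w \<in> W" "t = u + w"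
          by (rule direct_split[OF D t(1)])
        then show "r \<in> ssum (x ` U) (x ` W)"
          using t by (auto simp: lx intro!: ssumI)
      qed
    qed
    moreover have "y ` Z \<subseteq> x ` Z" if "Z \<subseteq> T" "A ` Z \<subseteq> Z" for Z
    proof (rule image_subsetI)
      fix t assume "t \<in> Z"
      then have "y t = x (A t)" "A t \<in> Z" using that xA[of t] by auto
      then show "y t \<in> x ` Z" by simp
    qed
    ultimately show ?thesis
      using kron_indecD[OF i D _ order_refl _ order_refl] sub UW by blast
  qed
  obtain \<beta> where \<beta>: "nondeg_form T \<beta>"
    "\<And>s t. s \<in> T \<Longrightarrow> t \<in> T \<Longrightarrow> \<beta> (A s) t = \<beta> s (A t)"
  proof (rule selfadjoint_form[OF l(5) T0 A AT])
    show "U = {0} \<or> W = {0}" if "direct U W T" "A ` U \<subseteq> U" "A ` W \<subseteq> W" for U W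
      using that by (rule ind)
  qed (rule that)
  have sV: "subspace V" using V fin_subspace_subspace by blast
  have VR: "direct R T V" using V(2) direct_commute by blast
  obtain \<tau> where \<tau>: "lin \<tau>" "\<And>r t. r \<in> R \<Longrightarrow> t \<in> T \<Longrightarrow> \<tau> (r + t) = t"
    using projection_exists[OF VR sV] by blast
  note lt = linD[OF \<tau>(1)]
  define \<rho> where "\<rho> v = z (v - \<tau> v)" for v
  have l\<rho>: "\<rho> (u + v) = \<rho> u + \<rho> v" "\<rho> (c *s u) = c *s \<rho> u" for u v c
    by (simp_all add: \<rho>_def lt lz scale_right_diff_distrib)
  have \<tau>T: "\<tau> v \<in> T" if v: "v \<in> V" for v
  proof -
    obtain r t where "r \<in> R" "t \<in> T" "v = r + t"
      by (rule direct_split[OF VR v])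
    then show ?thesis using \<tau>(2) by simp
  qed
  have \<rho>T: "\<rho> v \<in> T" for v
    by (simp add: \<rho>_def zT)
  have on_R: "\<tau> r = 0" "\<rho> r = z r" if "r \<in> R" for r
    using \<tau>(2)[OF that subspace_0[OF l(8)]] by (simp_all add: \<rho>_def)
  have on_T: "\<tau> t = t" "\<rho> t = 0" if "t \<in> T" for t
    using \<tau>(2)[OF subspace_0[OF l(7)] that] by (simp_all add: \<rho>_def lz)
  have decomp: "v = x (\<rho> v) + \<tau> v" if v: "v \<in> V" for v
  proof -
    obtain r t where rt: "r \<in> R" "t \<in> T" "v = r + t"
      by (rule direct_split[OF VR v])
    then show ?thesis by (simp add: l\<rho> lt on_R on_T xz)
  qed
  have xV: "x v = x (\<tau> v)" "y v = y (\<tau> v)" if v: "v \<in> V" for v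
  proof -
    obtain r t where rt: "r \<in> R" "t \<in> T" "v = r + t"
      by (rule direct_split[OF VR v])
    then show "x v = x (\<tau> v)" "y v = y (\<tau> v)"
      using \<tau>(2) R0 by (simp_all add: lx ly)
  qed
  have xyv: "\<tau> (x v) = 0" "\<tau> (y v) = 0" "\<rho> (x v) = \<tau> v" "\<rho> (y v) = A (\<tau> v)" if v: "v \<in> V" for v
  proof -
    have m: "x (\<tau> v) \<in> R" "y (\<tau> v) \<in> R"
      using \<tau>T[OF v] l by auto
    show "\<tau> (x v) = 0" "\<tau> (y v) = 0" "\<rho> (x v) = \<tau> v" "\<rho> (y v) = A (\<tau> v)"
      using on_R[OF m(1)] on_R[OF m(2)] z(3)[OF \<tau>T[OF v]] by (simp_all add: xV[OF v] A_def)
  qed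
  \<comment> \<open>Here \<open>\<tau>\<close> takes the T-component and \<open>\<rho>\<close> the
    R-component read in T. Both \<open>B (x u) v\<close> and \<open>B u (x v)\<close> equal
    \<open>\<beta> (\<tau> u) (\<tau> v)\<close>; for y an A appears on one side or the
    other.\<close>
  define B where "B u v = \<beta> (\<tau> u) (\<rho> v) + \<beta> (\<rho> u) (\<tau> v)" for u v
  note bD = nondeg_formD[OF \<beta>(1)] and b0 = nondeg_form_zero[OF \<beta>(1)]
  have "u = 0" if u: "u \<in> V" "\<forall>v\<in>V. B u v = 0" for u
  proof -
    have TV: "T \<subseteq> V" "R \<subseteq> V" using direct_subset[OF V(2)] by auto
    have "\<beta> (\<rho> u) t = 0" if t: "t \<in> T" for t
    proof -
      have "B u t = 0" using u t TV by blast
      then show ?thesis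
        using t \<tau>T[OF u(1)] by (simp add: B_def on_T b0)
    qed
    then have "\<rho> u = 0"
      using \<beta>(1) \<rho>T by (simp add: nondeg_form_def)
    have "\<beta> (\<tau> u) t = 0" if t: "t \<in> T" for t
    proof -
      have xt: "x t \<in> R" using t l by blast
      then have "B u (x t) = 0" using u TV by blast
      then show ?thesis
        using t xt \<rho>T[of u] by (simp add: B_def on_R b0 z(3))
    qed
    then have "\<tau> u = 0"
      using \<beta>(1) \<tau>T[OF u(1)] by (simp add: nondeg_form_def)
    then show ?thesis
      using decomp[OF u(1)] \<open>\<rho> u = 0\<close> by (simp add: lx)
  qed
  then have "nondeg_form V B"
    using \<tau>T \<rho>T unfolding nondeg_form_def
    by (auto simp: B_def l\<rho> lt bD algebra_simps)
  moreover have "selfadjoint_on V B x" "selfadjoint_on V B y"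
    using \<tau>T \<rho>T by (auto simp: selfadjoint_on_def B_def xyv b0 \<beta>(2))
  ultimately show ?thesis using that by blast
qed

lemma kron_indec_commute:
  assumes "kron_indec T R X Y"
  shows "kron_indec T R Y X"
  using assms unfolding kron_indec_def kron_def by blast

lemma square_form:
  assumes V: "fin_subspace V" "direct T R V" and i: "kron_indec T R x y"
    and R0: "\<And>r. r \<in> R \<Longrightarrow> x r = 0" "\<And>r. r \<in> R \<Longrightarrow> y r = 0" and dims: "dim T = dim R"
  obtains B where "nondeg_form V B" "selfadjoint_on V B x" "selfadjoint_on V B y"
  using square_pencil_inj[OF i dims kron_indec_semistable[OF i dims]]
proof
  assume "inj_on x T"
  then show ?thesis using pencil_form[OF V i R0 _ dims] that by blast
next
  assume "inj_on y T"
  then show ?thesis using pencil_form[OF V kron_indec_commute[OF i] R0(2,1) _ dims] that by blast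
qed

end

section \<open>Representations of the Klein four group\<close>

context group_rep
begin

sublocale vec_space scale ..

lemma fin_subspace_carrier: "fin_subspace V"
  using subspace_carrier finite_dim by (simp add: fin_subspace_def)

lemma self_dual_if_form:
  assumes B: "nondeg_form V B"
    and inv: "\<And>g u v. g \<in> carrier G \<Longrightarrow> u \<in> V \<Longrightarrow> v \<in> V \<Longrightarrow> B (act g u) v = B u (act (inv g) v)"
  shows "self_dual_rep G scale V act"
proof -
  interpret group G
    using group_hom by (simp add: group_hom_def)
  let ?D = "dual_carrier scale V"
  \<comment> \<open>The cut-off is forced by the encoding of the dual, whose functionals vanish
    outside V.\<close>
  define f where "f u = (\<lambda>v. if v \<in> V then B u v else 0)" for u
  have fD: "f u \<in> ?D" if "u \<in> V" for u
    using that by (auto simp: f_def dual_carrier_def linear_on_def nondeg_formD[OF B]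
        subspace_add[OF subspace_carrier] subspace_scale[OF subspace_carrier])
  have lin_f: "linear_on scale dual_scale V f"
    by (auto simp: linear_on_def f_def dual_scale_def fun_eq_iff nondeg_formD[OF B])
  have "bij_betw f V ?D"
    unfolding bij_betw_def
  proof
    show "inj_on f V"
    proof
      fix u u' assume u: "u \<in> V" "u' \<in> V" "f u = f u'"
      have d: "u - u' \<in> V"
        using u subspace_diff[OF subspace_carrier] by blast
      have "B (u - u') v = 0" if v: "v \<in> V" for v
      proof -
        have "B u v = B u' v"
          using u(3) v by (auto simp: f_def fun_eq_iff split: if_splits)
        moreover have "B ((u - u') + u') v = B (u - u') v + B u' v"
          using nondeg_formD(2)[OF B v d u(2)] .
        ultimately show ?thesis by simp
      qed
      then have "u - u' = 0"
        using B d unfolding nondeg_form_def by blast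
      then show "u = u'" by simp
    qed
    show "f ` V = ?D"
    proof
      show "f ` V \<subseteq> ?D" using fD by blast
      show "?D \<subseteq> f ` V"
      proof
        fix \<phi> assume \<phi>: "\<phi> \<in> ?D"
        then obtain \<psi> where \<psi>: "Vector_Spaces.linear scale (*) \<psi>" "\<And>v. v \<in> V \<Longrightarrow> \<psi> v = \<phi> v"
          using vec_space_pair.linear_on_extend[OF vec_space_pair_functional _ subspace_carrier]
          by (auto simp: dual_carrier_def)
        obtain u where "u \<in> V" "\<And>v. v \<in> V \<Longrightarrow> B u v = \<psi> v"
          using form_represents[OF fin_subspace_carrier B \<psi>(1)] by blast
        then have "f u = \<phi>"
          using \<phi> \<psi>(2) by (auto simp: f_def dual_carrier_def fun_eq_iff)
        then show "\<phi> \<in> f ` V" using \<open>u \<in> V\<close> by blast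
      qed
    qed
  qed
  moreover have "f (act g u) = dual_act G scale V act g (f u)" if "g \<in> carrier G" "u \<in> V" for g u
    using that fD[of u] act_closed[of "inv g"] by (auto simp: dual_act_def f_def fun_eq_iff inv)
  ultimately show ?thesis
    using lin_f unfolding self_dual_rep_def rep_iso_def by blast
qed

text \<open>An isomorphism f onto the dual, read as a function of two arguments, is already the
  form; its injectivity is left nondegeneracy.\<close>

lemma form_if_self_dual:
  assumes "self_dual_rep G scale V act"
  obtains B where "nondeg_form V B"
    "\<And>g u v. g \<in> carrier G \<Longrightarrow> u \<in> V \<Longrightarrow> v \<in> V \<Longrightarrow> B (act g u) v = B u (act (inv g) v)"
proof -
  obtain f where f: "bij_betw f V (dual_carrier scale V)" "linear_on scale dual_scale V f"
    "\<And>g u. g \<in> carrier G \<Longrightarrow> u \<in> V \<Longrightarrow> f (act g u) = dual_act G scale V act g (f u)"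
    using assms unfolding self_dual_rep_def rep_iso_def by blast
  have fD: "f u \<in> dual_carrier scale V" if "u \<in> V" for u
    using f(1) that by (auto simp: bij_betw_def)
  have sc: "f (c *s u) = (\<lambda>v. c * f u v)" if "u \<in> V" for c u
    using f(2) that by (simp add: linear_on_def dual_scale_def)
  have f0: "f 0 = (\<lambda>v. 0)"
    using sc[of 0 0] subspace_0[OF subspace_carrier] by simp
  have "u = 0" if u: "u \<in> V" "\<forall>v\<in>V. f u v = 0" for u
  proof -
    have "f u = f 0"
      using fD[OF u(1)] u(2) by (auto simp: f0 dual_carrier_def)
    then show ?thesis
      using f(1) u(1) subspace_0[OF subspace_carrier] by (auto simp: bij_betw_def inj_on_def)
  qed
  moreover have "f (u + v) w = f u w + f v w" if "u \<in> V" "v \<in> V" for u v w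
    using f(2) that by (simp add: linear_on_def)
  moreover have "f u (v + w) = f u v + f u w" "f u (c *s v) = c * f u v" if "u \<in> V" "v \<in> V" "w \<in> V" for u v w c
    using fD[OF that(1)] that(2,3) by (auto simp: dual_carrier_def linear_on_def)
  ultimately have "nondeg_form V f"
    using sc unfolding nondeg_form_def by simp
  moreover have "f (act g u) v = f u (act (inv g) v)" if "g \<in> carrier G" "u \<in> V" "v \<in> V" for g u v
    using that f(3) fD by (simp add: dual_act_def)
  ultimately show ?thesis using that by blast
qed

end

section \<open>The Klein four group in characteristic 2\<close>

lemma char_2_add_self:
  fixes v :: "'v::ab_group_add"
  assumes "CHAR('k::field) = 2" "vector_space (scale :: 'k \<Rightarrow> 'v \<Rightarrow> 'v)"
  shows "v + v = 0"
proof -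
  interpret vector_space scale by fact
  have "of_nat 2 = (0 :: 'k)"
    using of_nat_CHAR[where 'a = 'k] assms(1) by simp
  then have "(1 + 1 :: 'k) = 0" by simp
  then have "scale (1 + 1) v = 0"
    by (simp only: scale_zero_left)
  then show ?thesis
    by (simp only: scale_left_distrib scale_one)
qed

lemma carrier_klein_four: "carrier klein_four = {(0, 0), (1, 0), (0, 1), (1, 1)}"
  by (auto simp: klein_four_def DirProd_def carrier_integer_mod_group)

lemma mult_klein_four:
  "(a, b) \<otimes>\<^bsub>klein_four\<^esub> (c, d) = ((a + c) mod 2, (b + d) mod 2)"
  by (simp add: klein_four_def DirProd_def mult_integer_mod_group)

lemma one_klein_four: "\<one>\<^bsub>klein_four\<^esub> = (0, 0)"
  by (simp add: klein_four_def DirProd_def)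

text \<open>Turns invariance of a form under the group into self-adjointness of the group
  elements.\<close>

lemma inv_klein_four:
  assumes "g \<in> carrier klein_four"
  shows "inv\<^bsub>klein_four\<^esub> g = g"
proof -
  interpret group klein_four by (rule group_klein_four)
  have "g \<otimes>\<^bsub>klein_four\<^esub> g = \<one>\<^bsub>klein_four\<^esub>"
    using assms by (auto simp: carrier_klein_four mult_klein_four one_klein_four)
  then show ?thesis
    using assms inv_equality by blast
qed

locale klein_four_rep = group_rep klein_four scale V act
  for scale :: "'k::field \<Rightarrow> 'v::ab_group_add \<Rightarrow> 'v" (infixr \<open>*s\<close> 75) and V and act +
  assumes char_2: "CHAR('k) = 2"
begin

lemma add_self: "(v :: 'v) + v = 0"
  using char_2_add_self[OF char_2 vector_space_axioms] .

lemma carrier: "(1, 0) \<in> carrier klein_four" "(0, 1) \<in> carrier klein_four" "(1, 1) \<in> carrier klein_four"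
  by (simp_all add: carrier_klein_four)

text \<open>
  The operator \<open>g + 1\<close>, extended from \<open>V\<close> to a linear map on the ambient space since \<open>act g\<close> is
  \<open>undefined\<close> outside \<open>V\<close>.
\<close>

definition act_nil :: "int \<times> int \<Rightarrow> 'v \<Rightarrow> 'v" where
  "act_nil g = (SOME f. lin f \<and> (\<forall>v\<in>V. f v = act g v + v))"

lemma act_nil:
  assumes g: "g \<in> carrier klein_four"
  shows "lin (act_nil g)" "\<And>v. v \<in> V \<Longrightarrow> act_nil g v = act g v + v"
proof -
  interpret p: vec_space_pair scale scale ..
  have "linear_on scale scale V (\<lambda>v. act g v + v)"
    using act_linear[OF g] by (auto simp: linear_on_def scale_right_distrib algebra_simps)
  then obtain f where "lin f" "\<And>v. v \<in> V \<Longrightarrow> f v = act g v + v"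
    using p.linear_on_extend[OF _ subspace_carrier] by blast
  then have "\<exists>f. lin f \<and> (\<forall>v\<in>V. f v = act g v + v)"
    by blast
  then have "lin (act_nil g) \<and> (\<forall>v\<in>V. act_nil g v = act g v + v)"
    unfolding act_nil_def by (rule someI_ex)
  then show "lin (act_nil g)" "\<And>v. v \<in> V \<Longrightarrow> act_nil g v = act g v + v"
    by simp_all
qed

abbreviation x where "x \<equiv> act_nil (1, 0)"
abbreviation y where "y \<equiv> act_nil (0, 1)"

lemmas lin_xy = act_nil(1)[OF carrier(1)] act_nil(1)[OF carrier(2)]
lemmas xD = linD[OF lin_xy(1)] and yD = linD[OF lin_xy(2)]

lemma act_xy:
  assumes "v \<in> V"
  shows "act (1, 0) v = x v + v" "act (0, 1) v = y v + v"
  using act_nil(2)[OF carrier(1) assms] act_nil(2)[OF carrier(2) assms] by (simp_all add: add.assoc add_self)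

lemma xy_closed:
  assumes "v \<in> V"
  shows "x v \<in> V" "y v \<in> V"
  by (simp_all add: act_nil(2)[OF _ assms] carrier act_closed assms subspace_add[OF subspace_carrier])

lemma act_mult:
  "g \<in> carrier klein_four \<Longrightarrow> h \<in> carrier klein_four \<Longrightarrow> v \<in> V \<Longrightarrow>
    act (g \<otimes>\<^bsub>klein_four\<^esub> h) v = act g (act h v)"
  by (rule composition_rule)

lemma act_11: "v \<in> V \<Longrightarrow> act (1, 1) v = act (1, 0) (act (0, 1) v)"
  using act_mult[OF carrier(1,2)] by (simp add: mult_klein_four)

lemma act_00: "v \<in> V \<Longrightarrow> act (0, 0) v = v"
  using act_one by (simp add: one_klein_four)

text \<open>\<open>(g + 1)^2 = g^2 + 2 g + 1\<close> is zero because g is an involution and 2 = 0;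
  commutativity of x and y is that of the group.\<close>

lemma xy_rel:
  assumes v: "v \<in> V"
  shows "x (x v) = 0" "y (y v) = 0" "y (x v) = x (y v)"
proof -
  note c = act_closed[OF carrier(1) v] act_closed[OF carrier(2) v] xy_closed[OF v]
  have "act (1, 0) (act (1, 0) v) = v" "act (0, 1) (act (0, 1) v) = v"
    using act_mult[OF carrier(1,1) v] act_mult[OF carrier(2,2) v] act_00[OF v] by (simp_all add: mult_klein_four)
  then show "x (x v) = 0" "y (y v) = 0"
    using c v by (simp_all add: act_xy xD yD subspace_add[OF subspace_carrier] add.assoc add_self)
  have "act (1, 0) (act (0, 1) v) = act (0, 1) (act (1, 0) v)"
    using act_mult[OF carrier(1,2) v] act_mult[OF carrier(2,1) v] by (simp add: mult_klein_four)
  then show "y (x v) = x (y v)"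
    using c v by (simp add: act_xy xD yD subspace_add[OF subspace_carrier] algebra_simps)
qed

lemma subrep_if_xy:
  assumes "subspace U" "U \<subseteq> V" "x ` U \<subseteq> U" "y ` U \<subseteq> U"
  shows "subrep klein_four scale V act U"
proof -
  have 1: "act (1, 0) u \<in> U" "act (0, 1) u \<in> U" if u: "u \<in> U" for u
  proof -
    have "u \<in> V" "x u \<in> U" "y u \<in> U"
      using assms(2-4) u by blast+
    then show "act (1, 0) u \<in> U" "act (0, 1) u \<in> U"
      using u subspace_add[OF assms(1)] by (simp_all add: act_xy)
  qed
  have "act g u \<in> U" if "g \<in> carrier klein_four" "u \<in> U" for g u
  proof -
    have "u \<in> V" using that assms by blast
    then show ?thesis
      using that 1 act_11 act_00 by (auto simp: carrier_klein_four)
  qed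
  then show ?thesis
    using assms(1,2) by (simp add: subrep_def)
qed

lemma indec_xy:
  assumes "indecomposable_rep klein_four scale V act" "direct U W V"
    "x ` U \<subseteq> U" "y ` U \<subseteq> U" "x ` W \<subseteq> W" "y ` W \<subseteq> W"
  shows "U = {0} \<or> W = {0}"
proof -
  have "subspace U" "subspace W" "U \<subseteq> V" "W \<subseteq> V"
    using assms(2) direct_subset[OF assms(2)] unfolding direct_def by blast+
  then have "subrep klein_four scale V act U" "subrep klein_four scale V act W"
    using assms(3-6) by (blast intro: subrep_if_xy)+
  then show ?thesis
    using assms(1,2) unfolding indecomposable_rep_def direct_def ssum_def by blast
qed

lemma self_dual_if_selfadjoint:
  assumes B: "nondeg_form V B" and s: "selfadjoint_on V B x" "selfadjoint_on V B y"
  shows "self_dual_rep klein_four scale V act"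
proof (rule self_dual_if_form[OF B])
  fix g u v assume g: "g \<in> carrier klein_four" and uv: "u \<in> V" "v \<in> V"
  have 1: "B (act h u) v = B u (act h v)" if "h = (1, 0) \<or> h = (0, 1)" "u \<in> V" "v \<in> V" for h u v
    using that s xy_closed by (auto simp: act_xy selfadjoint_on_def nondeg_formD[OF B])
  have "B (act g u) v = B u (act g v)"
  proof (cases "g = (1, 1)")
    case True
    \<comment> \<open>Moving a product of self-adjoint operators across B reverses it, so
      commutativity is what makes the product self-adjoint.\<close>
    have "act (1, 0) (act (0, 1) v) = act (0, 1) (act (1, 0) v)"
      using act_mult[OF carrier(1,2) uv(2)] act_mult[OF carrier(2,1) uv(2)] by (simp add: mult_klein_four)
    then show ?thesis
      using True uv act_closed carrier by (simp add: act_11 1)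
  next
    case False
    then show ?thesis
      using g uv act_00 1 by (auto simp: carrier_klein_four)
  qed
  then show "B (act g u) v = B u (act (inv\<^bsub>klein_four\<^esub> g) v)"
    using inv_klein_four[OF g] by simp
qed

lemma selfadjoint_if_self_dual:
  assumes "self_dual_rep klein_four scale V act"
  obtains B where "nondeg_form V B" "selfadjoint_on V B x" "selfadjoint_on V B y"
proof -
  obtain B where B: "nondeg_form V B"
    "\<And>g u v. g \<in> carrier klein_four \<Longrightarrow> u \<in> V \<Longrightarrow> v \<in> V \<Longrightarrow>
      B (act g u) v = B u (act (inv\<^bsub>klein_four\<^esub> g) v)"
    using form_if_self_dual[OF assms] by blast
  have "B (act_nil g u) v = B u (act_nil g v)" if "g \<in> carrier klein_four" "u \<in> V" "v \<in> V" for g u v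
    using that B(2) act_closed by (simp add: act_nil inv_klein_four nondeg_formD[OF B(1)])
  then have "selfadjoint_on V B x" "selfadjoint_on V B y"
    using carrier by (simp_all add: selfadjoint_on_def)
  then show ?thesis using that B(1) by blast
qed

section \<open>Socle, radical and the passage to Kronecker modules\<close>

lemma trivial_if_line:
  assumes V: "V = span {s}" and s: "s \<noteq> 0" "x s = 0" "y s = 0"
  shows "rep_iso klein_four scale V act ((*) :: 'k \<Rightarrow> 'k \<Rightarrow> 'k) UNIV trivial_act"
proof -
  have mem: "v \<in> V \<longleftrightarrow> (\<exists>c. v = c *s s)" for v
    by (subst V) (simp add: span_singleton image_iff)
  have xy0: "x v = 0" "y v = 0" if "v \<in> V" for v
    using that s unfolding mem by (auto simp: xD yD)
  have "act g v = v" if "g \<in> carrier klein_four" "v \<in> V" for g v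
    using that by (auto simp: carrier_klein_four act_00 act_11 act_xy xy0)
  moreover obtain \<phi> where \<phi>: "Vector_Spaces.linear scale (*) \<phi>" "\<phi> s = 1"
    using separating_functional[OF subspace_single_0, of s] s(1) by auto
  moreover have "bij_betw \<phi> V UNIV"
    by (rule bij_betwI[of _ _ _ "\<lambda>c. c *s s"])
      (auto simp: mem functionalD[OF \<phi>(1)] \<phi>(2))
  moreover have "linear_on scale (*) V \<phi>"
    by (simp add: linear_on_def functionalD[OF \<phi>(1)])
  ultimately show ?thesis
    unfolding rep_iso_def trivial_act_def by (intro exI[of _ \<phi>]) simp
qed

text \<open>Non-triviality enters here. If s lies outside the radical, a functional that vanishes on
  the radical and is 1 at s has as kernel a submodule complementary to the line of s.
  Indecomposability leaves only that line, on which the group acts trivially.\<close>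

lemma socle_in_radical:
  assumes indec: "indecomposable_rep klein_four scale V act"
    and nontriv: "\<not> rep_iso klein_four scale V act ((*) :: 'k \<Rightarrow> 'k \<Rightarrow> 'k) UNIV trivial_act"
    and s: "s \<in> V" "x s = 0" "y s = 0"
  shows "s \<in> ssum (x ` V) (y ` V)"
proof (rule ccontr)
  assume ns: "s \<notin> ssum (x ` V) (y ` V)"
  have i: "subspace (x ` V)" "subspace (y ` V)"
    using subspace_image[OF _ subspace_carrier] lin_xy by blast+
  obtain \<phi> where \<phi>: "Vector_Spaces.linear scale (*) \<phi>" "\<phi> s = 1"
    "\<And>w. w \<in> ssum (x ` V) (y ` V) \<Longrightarrow> \<phi> w = 0"
    using separating_functional[OF subspace_ssum[OF i] ns] by blast
  note \<phi>D = functionalD[OF \<phi>(1)]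
  define W where "W = {w\<in>V. \<phi> w = 0}"
  have xyW: "x v \<in> W" "y v \<in> W" if "v \<in> V" for v
    using that \<phi>(3) ssum_left[OF i(2), of "x ` V"] ssum_right[OF i(1), of "y ` V"] xy_closed
    by (auto simp: W_def)
  have "direct (span {s}) W V"
  proof (rule directI)
    show "subspace W"
      by (rule subspaceI) (auto simp: W_def \<phi>D subspace_0[OF subspace_carrier]
          subspace_add[OF subspace_carrier] subspace_scale[OF subspace_carrier])
    show "span {s} \<subseteq> V"
      using s(1) by (intro span_minimal subspace_carrier) simp
    show "w = 0" if "w \<in> span {s}" "w \<in> W" for w
      using that by (auto simp: W_def span_singleton \<phi>D \<phi>(2))
    show "V \<subseteq> ssum (span {s}) W"
    proof
      fix v assume v: "v \<in> V"
      have "v - \<phi> v *s s \<in> V"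
        using v s(1) by (intro subspace_diff subspace_scale subspace_carrier)
      moreover have "\<phi> ((v - \<phi> v *s s) + \<phi> v *s s) = \<phi> (v - \<phi> v *s s) + \<phi> v"
        unfolding \<phi>D \<phi>(2) by simp
      ultimately have "v - \<phi> v *s s \<in> W"
        by (simp add: W_def)
      then have "\<phi> v *s s + (v - \<phi> v *s s) \<in> ssum (span {s}) W"
        by (intro ssumI) (auto simp: span_singleton)
      then show "v \<in> ssum (span {s}) W" by simp
    qed
  qed (auto simp: W_def subspace_carrier)
  moreover have "x ` span {s} \<subseteq> span {s}" "y ` span {s} \<subseteq> span {s}"
    using s by (auto simp: span_singleton xD yD intro: range_eqI[of _ _ 0])
  moreover have "x ` W \<subseteq> W" "y ` W \<subseteq> W"
    using xyW by (auto simp: W_def)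
  ultimately have "span {s} = {0} \<or> W = {0}"
    by (intro indec_xy[OF indec])
  moreover have "s \<noteq> 0"
    using \<phi>(2) \<phi>D(3) by auto
  ultimately have "W = {0}"
    using span_base[of s "{s}"] by auto
  then have "V = span {s}"
    using \<open>direct (span {s}) W V\<close> direct_trivial direct_commute by metis
  then show False
    using nontriv trivial_if_line s \<open>s \<noteq> 0\<close> by blast
qed

text \<open>A decomposition of the pencil into T1, R1 and T2, R2 gives the decomposition of V into
  \<open>ssum T1 R1\<close> and \<open>ssum T2 R2\<close>. These are invariant because x and y
  vanish on R.\<close>

lemma kron_indec_if_indec:
  assumes indec: "indecomposable_rep klein_four scale V act"
    and R: "subspace R" "\<And>r. r \<in> R \<Longrightarrow> x r = 0" "\<And>r. r \<in> R \<Longrightarrow> y r = 0"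
    and im: "\<And>v. v \<in> V \<Longrightarrow> x v \<in> R" "\<And>v. v \<in> V \<Longrightarrow> y v \<in> R"
    and D: "direct T R V"
  shows "kron_indec T R x y"
  unfolding kron_indec_def
proof (intro conjI allI impI)
  have sub: "subspace T" "T \<subseteq> V" "R \<subseteq> V"
    using D direct_subset[OF D] by (auto simp: direct_def)
  show "kron T R x y"
    using fin_subspace_subset[OF fin_subspace_carrier] sub R im lin_xy by (auto simp: kron_def)
  have "V \<noteq> {0}"
    using indec by (simp add: indecomposable_rep_def)
  moreover have "V = {0}" if "T = {0}" "R = {0}"
    using D direct_trivial[OF D] that by simp
  ultimately show "T \<noteq> {0} \<or> R \<noteq> {0}"
    by blast
  fix T1 T2 R1 R2
  assume "direct T1 T2 T \<and> direct R1 R2 R \<and> x ` T1 \<subseteq> R1 \<and> y ` T1 \<subseteq> R1 \<and> x ` T2 \<subseteq> R2 \<and> y ` T2 \<subseteq> R2"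
  then have TD: "direct T1 T2 T" and RD: "direct R1 R2 R"
    and xy: "x ` T1 \<subseteq> R1" "y ` T1 \<subseteq> R1" "x ` T2 \<subseteq> R2" "y ` T2 \<subseteq> R2" by auto
  have s: "subspace T1" "subspace T2" "subspace R1" "subspace R2" "T1 \<subseteq> T" "T2 \<subseteq> T" "R1 \<subseteq> R" "R2 \<subseteq> R"
    using TD RD direct_subset[OF TD] direct_subset[OF RD] by (auto simp: direct_def)
  have inv: "x ` ssum A B \<subseteq> ssum A B" "y ` ssum A B \<subseteq> ssum A B"
    if "x ` A \<subseteq> B" "y ` A \<subseteq> B" "B \<subseteq> R" "subspace A" for A B
  proof -
    have "x w \<in> B \<and> y w \<in> B" if "w \<in> ssum A B" for w
      using that
    proof (rule ssumE)
      fix a b assume "a \<in> A" "b \<in> B" "w = a + b"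
      moreover from this have "x b = 0" "y b = 0"
        using R(2,3) \<open>B \<subseteq> R\<close> by blast+
      ultimately show ?thesis
        using \<open>x ` A \<subseteq> B\<close> \<open>y ` A \<subseteq> B\<close> by (auto simp: xD yD)
    qed
    then show "x ` ssum A B \<subseteq> ssum A B" "y ` ssum A B \<subseteq> ssum A B"
      using ssum_right[OF that(4), of B] by blast+
  qed
  have "direct (ssum T1 R1) (ssum T2 R2) V"
  proof (rule directI)
    show "subspace (ssum T1 R1)" "subspace (ssum T2 R2)"
      using s subspace_ssum by blast+
    show "ssum T1 R1 \<subseteq> V" "ssum T2 R2 \<subseteq> V"
      using s sub by (intro ssum_minimal[OF subspace_carrier]; blast)+
    show "w = 0" if w: "w \<in> ssum T1 R1" "w \<in> ssum T2 R2" for w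
    proof -
      obtain t1 r1 where 1: "t1 \<in> T1" "r1 \<in> R1" "w = t1 + r1" using w(1) by (rule ssumE)
      obtain t2 r2 where 2: "t2 \<in> T2" "r2 \<in> R2" "w = t2 + r2" using w(2) by (rule ssumE)
      have "t1 = t2" "r1 = r2"
        using direct_unique[OF D, of t1 r1 t2 r2] 1 2 s by auto
      then have "t1 \<in> T1 \<inter> T2" "r1 \<in> R1 \<inter> R2" using 1 2 by auto
      then have "t1 = 0" "r1 = 0"
        using TD RD unfolding direct_def by blast+
      then show ?thesis using 1 by simp
    qed
    show "V \<subseteq> ssum (ssum T1 R1) (ssum T2 R2)"
    proof
      fix v assume "v \<in> V"
      then obtain t r where tr: "t \<in> T" "r \<in> R" "v = t + r" by (rule direct_split[OF D])
      obtain t1 t2 where t: "t1 \<in> T1" "t2 \<in> T2" "t = t1 + t2" by (rule direct_split[OF TD tr(1)])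
      obtain r1 r2 where r: "r1 \<in> R1" "r2 \<in> R2" "r = r1 + r2" by (rule direct_split[OF RD tr(2)])
      have "(t1 + r1) + (t2 + r2) \<in> ssum (ssum T1 R1) (ssum T2 R2)"
        using t r by (intro ssumI)
      then show "v \<in> ssum (ssum T1 R1) (ssum T2 R2)"
        using tr t r by (simp add: algebra_simps)
    qed
  qed (rule subspace_carrier)
  from indec_xy[OF indec this inv[OF xy(1,2) s(7,1)] inv[OF xy(3,4) s(8,2)]]
  have "ssum T1 R1 = {0} \<or> ssum T2 R2 = {0}" .
  moreover have "A = {0} \<and> B = {0}" if "ssum A B = {0}" "subspace A" "subspace B" for A B
    using that ssum_left[of B A] ssum_right[of A B] subspace_0[of A] subspace_0[of B] by auto
  ultimately show "T1 = {0} \<and> R1 = {0} \<or> T2 = {0} \<and> R2 = {0}"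
    using s(1-4) by blast
qed

theorem even_dim_iff_self_dual:
  assumes indec: "indecomposable_rep klein_four scale V act"
    and nontriv: "\<not> rep_iso klein_four scale V act ((*) :: 'k \<Rightarrow> 'k \<Rightarrow> 'k) UNIV trivial_act"
  shows "even (dim V) \<longleftrightarrow> self_dual_rep klein_four scale V act"
proof (cases "\<exists>v\<in>V. x (y v) \<noteq> 0")
  case True
  then obtain v where v: "v \<in> V" "x (y v) \<noteq> 0" by blast
  obtain B where "dim V = 4" "nondeg_form V B" "selfadjoint_on V B x" "selfadjoint_on V B y"
  proof (rule free_case_form[OF fin_subspace_carrier lin_xy(1) xy_closed(1) lin_xy(2) xy_closed(2) xy_rel _ v])
    show "U = {0} \<or> W = {0}"
      if "direct U W V" "x ` U \<subseteq> U" "y ` U \<subseteq> U" "x ` W \<subseteq> W" "y ` W \<subseteq> W" for U W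
      by (rule indec_xy[OF indec that])
  qed (assumption | rule that)+
  \<comment> \<open>Both sides of the equivalence hold: the dimension is 4, and B gives the
    self-duality.\<close>
  then show ?thesis
    using self_dual_if_selfadjoint by simp
next
  case False
  then have xy0: "x (y v) = 0" "y (x v) = 0" if "v \<in> V" for v
    using that xy_rel(3) by simp_all
  define R where "R = {v\<in>V. x v = 0 \<and> y v = 0}"
  have sR: "subspace R" "R \<subseteq> V"
    by (auto intro!: subspaceI simp: R_def xD yD subspace_0[OF subspace_carrier]
          subspace_add[OF subspace_carrier] subspace_scale[OF subspace_carrier])
  have im: "x v \<in> R" "y v \<in> R" if "v \<in> V" for v
    using that xy0 xy_rel xy_closed by (simp_all add: R_def)
  obtain T where T: "direct T R V"
    using direct_complement[OF subspace_carrier sR] direct_commute by metis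
  have kr: "kron_indec T R x y"
    by (rule kron_indec_if_indec[OF indec sR(1) _ _ im T]) (simp_all add: R_def)
  have dV: "dim V = dim T + dim R"
    using T dim_direct_sum[OF fin_subspace_carrier] by (simp add: direct_def)
  show ?thesis
  proof
    assume "even (dim V)"
    moreover have "a = b" if "even (a + b)" "b \<le> a + 1" "a \<le> b + 1" for a b :: nat
      using that by presburger
    ultimately have "dim T = dim R"
      using dV kron_indec_dim_R_le[OF kr] kron_indec_dim_T_le[OF kr] by metis
    have "x r = 0" "y r = 0" if "r \<in> R" for r
      using that by (simp_all add: R_def)
    then obtain B where "nondeg_form V B" "selfadjoint_on V B x" "selfadjoint_on V B y"
      using square_form[OF fin_subspace_carrier T kr _ _ \<open>dim T = dim R\<close>] by blast
    then show "self_dual_rep klein_four scale V act"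
      by (rule self_dual_if_selfadjoint)
  next
    assume "self_dual_rep klein_four scale V act"
    then obtain B where B: "nondeg_form V B" "selfadjoint_on V B x" "selfadjoint_on V B y"
      by (rule selfadjoint_if_self_dual)
    \<comment> \<open>By self-adjointness and nondegeneracy, the vectors orthogonal to the radical
      are those killed by x and y, which form the socle R. The radical is R as well, by
      \<open>im\<close> and \<open>socle_in_radical\<close>.\<close>
    have "perp B V R = R"
    proof
      show "perp B V R \<subseteq> R"
      proof
        fix u assume u: "u \<in> perp B V R"
        then have uV: "u \<in> V" by (simp add: perp_def)
        have "B (x u) v = 0" "B (y u) v = 0" if "v \<in> V" for v
          using that u uV im B(2,3) by (auto simp: perp_def selfadjoint_on_def)
        then have "x u = 0" "y u = 0"
          using B(1) xy_closed[OF uV] by (auto simp: nondeg_form_def)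
        then show "u \<in> R" using uV by (simp add: R_def)
      qed
      show "R \<subseteq> perp B V R"
      proof
        fix u assume u: "u \<in> R"
        then have uV: "u \<in> V" "x u = 0" "y u = 0" by (simp_all add: R_def)
        have "B u w = 0" if w: "w \<in> R" for w
        proof -
          have "w \<in> ssum (x ` V) (y ` V)"
            using socle_in_radical[OF indec nontriv] w by (simp add: R_def)
          then obtain p q where pq: "p \<in> V" "q \<in> V" "w = x p + y q"
            by (auto elim!: ssumE)
          have "B (x u) p = B u (x p)" "B (y u) q = B u (y q)"
            using B(2,3) uV(1) pq(1,2) unfolding selfadjoint_on_def by blast+
          then show ?thesis
            using pq uV xy_closed by (simp add: nondeg_formD[OF B(1)] nondeg_form_zero[OF B(1)])
        qed
        then show "u \<in> perp B V R" using uV by (simp add: perp_def)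
      qed
    qed
    then have "dim V = 2 * dim R"
      using self_perp_dim[OF fin_subspace_carrier B(1) sR] by blast
    then show "even (dim V)" by simp
  qed
qed

end

theorem corollary3p4:
  fixes scale :: "'k::field \<Rightarrow> 'v::ab_group_add \<Rightarrow> 'v"
    and V :: "'v set"
    and act :: "int \<times> int \<Rightarrow> 'v \<Rightarrow> 'v"
  assumes "CHAR('k) = 2"
    and "group_rep klein_four scale V act"
    and "indecomposable_rep klein_four scale V act"
    and "\<not> rep_iso klein_four scale V act ((*) :: 'k \<Rightarrow> 'k \<Rightarrow> 'k) UNIV trivial_act"
  shows "even (vector_space.dim scale V) \<longleftrightarrow> self_dual_rep klein_four scale V act"
proof -
  interpret klein_four_rep scale V act
    using assms by (simp add: klein_four_rep_def klein_four_rep_axioms_def)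
  show ?thesis
    using assms by (intro even_dim_iff_self_dual)
qed

end
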